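(* Let $A$ be a unital simple C*-algebra, and let $D=\mathrm C(X)\subseteq A$ be a unital commutative sub-C*-algebra, where $X$ is a compact metrizable space with no isolated points. Assume that the pair $(D,A)$ has Properties (C) and (E). Then, if the C*-algebra $A$ has Property (S), the pair $(D,\mathrm T(A))$ has the small boundary property (SBP).
   Context: **Trace notation.** $\mathrm T(A)$ is the set of tracial states of $A$; $\|a\|_{2,\mathrm T(A)}=\sup_{\tau\in \mathrm T(A)}\tau(a^*a)^{1/2}$; $\mathrm d_\tau(a)=\lim_{n\to\infty}\tau(a^{1/n})$ for $a\ge0$; $\mathrm{dist}_{2,\mathrm T(A)}(a,S)=\inf_{s\in S}\|a-s\|_{2,\mathrm T(A)}$; $(D)_1$ is the closed unit ball of $D$. **Property (C).** Let $A$ be a unital C*-algebra and $D\subseteq A$ a unital commutative sub-C*-algebra. The pair $(D,A)$ has Property (C) if for any positive contractions $f,g,h\in D$ with $f,g\in\overline{hDh}$ and $\mathrm d_\tau(f)<\mathrm d_\tau(g)$ for all $\tau\in \mathrm T(A)$, and for any $\varepsilon>0$, there is a contraction $u\in\overline{hAh}+\mathbb C1_A$ such that: (i) there is $y\in\overline{gAg}$ with $\|ufu^*-y\|_{2,\mathrm T(A)}<\varepsilon$; (ii) $\mathrm{dist}_{2,\mathrm T(A)}(udu^*,(D)_1)<\varepsilon$ and $\mathrm{dist}_{2,\mathrm T(A)}(u^*du,(D)_1)<\varepsilon$ for all $d\in(D)_1$; (iii) $\|uu^*-1\|_{2,\mathrm T(A)}<\varepsilon$ and $\|u^*u-1\|_{2,\mathrm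 T(A)}<\varepsilon$. **Property (E).** The pair $(D,A)$ has Property (E) if for any positive contraction $a\in A$, any finite subset $\mathcal F\subseteq\mathrm C([0,1])$ and any $\varepsilon>0$, there is a positive contraction $b\in D$ such that $|\tau(f(a))-\tau(f(b))|<\varepsilon$ for all $f\in\mathcal F$ and $\tau\in \mathrm T(A)$. **Property (S).** For $\delta>0$ let $\chi_\delta:\mathbb R\to[0,1]$ be given by $\chi_\delta(t)=1$ if $|t|<\delta$, $\chi_\delta(t)=2-|t|/\delta$ if $\delta\le|t|<2\delta$, and $\chi_\delta(t)=0$ otherwise. $A$ has Property (S) if for any self-adjoint contraction $f\in A$ and any $\varepsilon>0$ there is a self-adjoint contraction $g\in A$ such that $\|f-g\|_{2,\mathrm T(A)}<\varepsilon$ and there is $\delta>0$ with $\tau(\chi_\delta(g))<\varepsilon$ for all $\tau\in \mathrm T(A)$. **SBP for pairs.** For a compact metrizable $X$ and a set $\Delta$ of Borel probability measures on $X$, $(X,\Delta)$ has the (SBP) if for any $x\in X$ and any open neighbourhood $U$ of $x$ there is a neighbourhood $V$ of $x$ with $V\subseteq U$ and $\mu(\partial V)=0$ for all $\mu\in\Delta$. The pair $(D,\mathrm T(A))$ with $D=\mathrm C(X)$ has the (SBP) if $(X,\Delta)$ does, where $\Delta$ is the set of measures on $X$ induced by the restrictions to $D$ of the tracial states of $A$. *)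

theory Defs
  imports "HOL-Probability.Probability"
begin

section \<open>Unital C*-algebras\<close>

class scaleC =
  fixes scaleC :: "complex \<Rightarrow> 'a \<Rightarrow> 'a" (infixr \<open>*\<^sub>C\<close> 75)

class star =
  fixes star :: "'a \<Rightarrow> 'a"

text \<open>All algebras in this class are nonzero (\<open>norm 1 = 1\<close> is inherited).\<close>

class unital_cstar_algebra = real_normed_algebra_1 + banach + scaleC + star +
  assumes scaleC_add_right: "c *\<^sub>C (x + y) = c *\<^sub>C x + c *\<^sub>C y"
    and scaleC_add_left: "(c + d) *\<^sub>C x = c *\<^sub>C x + d *\<^sub>C x"
    and scaleC_scaleC: "c *\<^sub>C d *\<^sub>C x = (c * d) *\<^sub>C x"
    and scaleC_of_real: "complex_of_real r *\<^sub>C x = r *\<^sub>R x"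
    and mult_scaleC_left: "(c *\<^sub>C x) * y = c *\<^sub>C (x * y)"
    and mult_scaleC_right: "x * (c *\<^sub>C y) = c *\<^sub>C (x * y)"
    and norm_scaleC: "norm (c *\<^sub>C x) = cmod c * norm x"
    and star_add: "star (x + y) = star x + star y"
    and star_scaleC: "star (c *\<^sub>C x) = cnj c *\<^sub>C star x"
    and star_mult: "star (x * y) = star y * star x"
    and star_star: "star (star x) = x"
    and cstar_identity: "norm (star x * x) = (norm x)\<^sup>2"

instantiation complex :: unital_cstar_algebra
begin

definition scaleC_complex :: "complex \<Rightarrow> complex \<Rightarrow> complex"
  where "scaleC_complex c x = c * x"

definition star_complex :: "complex \<Rightarrow> complex"
  where "star_complex = cnj"

instance
  by standard
    (simp_all add: scaleC_complex_def star_complex_def algebra_simps norm_mult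
      power2_eq_square scaleR_conv_of_real)

end

definition complex_subspace :: "'a::unital_cstar_algebra set \<Rightarrow> bool"
  where "complex_subspace V \<longleftrightarrow>
    0 \<in> V \<and> (\<forall>x\<in>V. \<forall>y\<in>V. x + y \<in> V) \<and> (\<forall>c. \<forall>x\<in>V. c *\<^sub>C x \<in> V)"

definition closed_two_sided_ideal :: "'a::unital_cstar_algebra set \<Rightarrow> bool"
  where "closed_two_sided_ideal I \<longleftrightarrow>
    complex_subspace I \<and> closed I \<and> (\<forall>a. \<forall>x\<in>I. a * x \<in> I \<and> x * a \<in> I)"

definition simple_cstar_algebra :: "'a::unital_cstar_algebra itself \<Rightarrow> bool"
  where "simple_cstar_algebra _ \<longleftrightarrow>
    (\<forall>I :: 'a set. closed_two_sided_ideal I \<longrightarrow> I = {0} \<or> I = UNIV)"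

definition unital_sub_cstar_algebra :: "'a::unital_cstar_algebra set \<Rightarrow> bool"
  where "unital_sub_cstar_algebra D \<longleftrightarrow>
    complex_subspace D \<and> closed D \<and> 1 \<in> D \<and>
    (\<forall>x\<in>D. \<forall>y\<in>D. x * y \<in> D) \<and> (\<forall>x\<in>D. star x \<in> D)"

definition commutative_set :: "'a::unital_cstar_algebra set \<Rightarrow> bool"
  where "commutative_set D \<longleftrightarrow> (\<forall>x\<in>D. \<forall>y\<in>D. x * y = y * x)"

definition spectrum :: "'a::unital_cstar_algebra \<Rightarrow> complex set"
  where "spectrum a = {z. \<not> (\<exists>b. (z *\<^sub>C 1 - a) * b = 1 \<and> b * (z *\<^sub>C 1 - a) = 1)}"

definition self_adjoint :: "'a::unital_cstar_algebra \<Rightarrow> bool"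
  where "self_adjoint a \<longleftrightarrow> star a = a"

definition positive :: "'a::unital_cstar_algebra \<Rightarrow> bool"
  where "positive a \<longleftrightarrow> self_adjoint a \<and> spectrum a \<subseteq> \<real>\<^sub>\<ge>\<^sub>0"

definition contraction :: "'a::unital_cstar_algebra \<Rightarrow> bool"
  where "contraction a \<longleftrightarrow> norm a \<le> 1"

section \<open>Algebras of continuous functions and functional calculus\<close>

text \<open>An isometric unital *-homomorphism from \<open>C(S)\<close>, for a nonempty compact \<open>S\<close>.
  Elements of \<open>C(S)\<close> are represented by total functions continuous on \<open>S\<close>; the isometry
  condition forces functions that agree on \<open>S\<close> to have the same image.\<close>

definition C_embedding ::
    "'x::topological_space set \<Rightarrow> (('x \<Rightarrow> complex) \<Rightarrow> 'a::unital_cstar_algebra) \<Rightarrow> bool"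
  where "C_embedding S \<phi> \<longleftrightarrow>
    (\<forall>f g. continuous_on S f \<longrightarrow> continuous_on S g \<longrightarrow>
       \<phi> (\<lambda>x. f x + g x) = \<phi> f + \<phi> g \<and> \<phi> (\<lambda>x. f x * g x) = \<phi> f * \<phi> g) \<and>
    (\<forall>c f. continuous_on S f \<longrightarrow> \<phi> (\<lambda>x. c * f x) = c *\<^sub>C \<phi> f) \<and>
    (\<forall>f. continuous_on S f \<longrightarrow> \<phi> (\<lambda>x. cnj (f x)) = star (\<phi> f)) \<and>
    \<phi> (\<lambda>x. 1) = 1 \<and>
    (\<forall>f. continuous_on S f \<longrightarrow> norm (\<phi> f) = (SUP x\<in>S. cmod (f x)))"

text \<open>The identification \<open>D = C(X)\<close>, where \<open>X\<close> is the type \<open>'x\<close>.\<close>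

definition C_isomorphism ::
    "(('x::topological_space \<Rightarrow> complex) \<Rightarrow> 'a::unital_cstar_algebra) \<Rightarrow> 'a set \<Rightarrow> bool"
  where "C_isomorphism \<iota> D \<longleftrightarrow> C_embedding UNIV \<iota> \<and> \<iota> ` {f. continuous_on UNIV f} = D"

text \<open>Continuous functional calculus \<open>f(a)\<close> for self-adjoint \<open>a\<close> (whose spectrum is real) and
  \<open>f\<close> continuous on the spectrum: the value at \<open>f\<close> of the unique isometric unital
  *-homomorphism on \<open>C(\<sigma>(a))\<close> that sends the inclusion \<open>\<sigma>(a) \<rightarrow> \<complex>\<close> to \<open>a\<close>.\<close>

definition cfc :: "(real \<Rightarrow> complex) \<Rightarrow> 'a::unital_cstar_algebra \<Rightarrow> 'a"
  where "cfc f a = (THE b. \<exists>\<phi>. C_embedding (complex_of_real -` spectrum a) \<phi> \<and>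
    \<phi> complex_of_real = a \<and> \<phi> f = b)"

section \<open>Traces\<close>

definition tracial_states :: "('a::unital_cstar_algebra \<Rightarrow> complex) set"
  where "tracial_states = {\<tau>.
    (\<forall>x y. \<tau> (x + y) = \<tau> x + \<tau> y) \<and> (\<forall>c x. \<tau> (c *\<^sub>C x) = c * \<tau> x) \<and>
    (\<forall>a. positive a \<longrightarrow> \<tau> a \<in> \<real>\<^sub>\<ge>\<^sub>0) \<and> \<tau> 1 = 1 \<and>
    (\<forall>x y. \<tau> (x * y) = \<tau> (y * x))}"

text \<open>Inserting \<open>0\<close> only matters when there are no tracial states: the supremum is then \<open>0\<close>.\<close>

definition tnorm :: "'a::unital_cstar_algebra \<Rightarrow> real"
  where "tnorm a = Sup (insert 0 ((\<lambda>\<tau>. sqrt (Re (\<tau> (star a * a)))) ` tracial_states))"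

definition tdist :: "'a::unital_cstar_algebra \<Rightarrow> 'a set \<Rightarrow> real"
  where "tdist a S = (INF s\<in>S. tnorm (a - s))"

definition d_tau :: "('a::unital_cstar_algebra \<Rightarrow> complex) \<Rightarrow> 'a \<Rightarrow> real"
  where "d_tau \<tau> a = lim (\<lambda>n. Re (\<tau> (cfc (\<lambda>t. complex_of_real (root n t)) a)))"

definition unit_ball :: "'a::unital_cstar_algebra set \<Rightarrow> 'a set"
  where "unit_ball D = {d\<in>D. norm d \<le> 1}"

section \<open>Properties (C), (E), (S) and the small boundary property\<close>

text \<open>\<open>hereditary h B\<close> is the norm closure of \<open>hBh\<close>.\<close>

definition hereditary :: "'a::unital_cstar_algebra \<Rightarrow> 'a set \<Rightarrow> 'a set"
  where "hereditary h B = closure ((\<lambda>b. h * b * h) ` B)"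

definition property_C :: "'a::unital_cstar_algebra set \<Rightarrow> bool"
  where "property_C D \<longleftrightarrow>
    (\<forall>f\<in>D. \<forall>g\<in>D. \<forall>h\<in>D.
      positive f \<and> contraction f \<and> positive g \<and> contraction g \<and> positive h \<and> contraction h \<and>
      f \<in> hereditary h D \<and> g \<in> hereditary h D \<and> (\<forall>\<tau>\<in>tracial_states. d_tau \<tau> f < d_tau \<tau> g) \<longrightarrow>
      (\<forall>\<epsilon>>0. \<exists>u. contraction u \<and> (\<exists>x\<in>hereditary h UNIV. \<exists>c. u = x + c *\<^sub>C 1) \<and>
         (\<exists>y\<in>hereditary g UNIV. tnorm (u * f * star u - y) < \<epsilon>) \<and>
         (\<forall>d\<in>unit_ball D. tdist (u * d * star u) (unit_ball D) < \<epsilon> \<and>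
                          tdist (star u * d * u) (unit_ball D) < \<epsilon>) \<and>
         tnorm (u * star u - 1) < \<epsilon> \<and> tnorm (star u * u - 1) < \<epsilon>))"

definition property_E :: "'a::unital_cstar_algebra set \<Rightarrow> bool"
  where "property_E D \<longleftrightarrow>
    (\<forall>a. positive a \<and> contraction a \<longrightarrow>
      (\<forall>F. finite F \<and> (\<forall>f\<in>F. continuous_on {0..1} f) \<longrightarrow>
        (\<forall>\<epsilon>>0. \<exists>b\<in>D. positive b \<and> contraction b \<and>
          (\<forall>f\<in>F. \<forall>\<tau>\<in>tracial_states. cmod (\<tau> (cfc f a) - \<tau> (cfc f b)) < \<epsilon>))))"

definition chi :: "real \<Rightarrow> real \<Rightarrow> real"
  where "chi \<delta> t = (if \<bar>t\<bar> < \<delta> then 1 else if \<bar>t\<bar> < 2 * \<delta> then 2 - \<bar>t\<bar> / \<delta> else 0)"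

definition property_S :: "'a::unital_cstar_algebra itself \<Rightarrow> bool"
  where "property_S _ \<longleftrightarrow>
    (\<forall>f :: 'a. self_adjoint f \<and> contraction f \<longrightarrow>
      (\<forall>\<epsilon>>0. \<exists>g :: 'a. self_adjoint g \<and> contraction g \<and> tnorm (f - g) < \<epsilon> \<and>
        (\<exists>\<delta>>0. \<forall>\<tau>\<in>tracial_states. Re (\<tau> (cfc (\<lambda>t. complex_of_real (chi \<delta> t)) g)) < \<epsilon>)))"

text \<open>Neighbourhoods \<open>V\<close> need not be open.\<close>

definition small_boundary_property :: "'x::topological_space measure set \<Rightarrow> bool"
  where "small_boundary_property \<Delta> \<longleftrightarrow>
    (\<forall>x U. open U \<and> x \<in> U \<longrightarrow>
      (\<exists>V. x \<in> interior V \<and> V \<subseteq> U \<and> (\<forall>\<mu>\<in>\<Delta>. emeasure \<mu> (frontier V) = 0)))"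

text \<open>The Borel probability measures on \<open>X\<close> that represent \<open>f \<mapsto> \<tau>(\<iota>(f))\<close> for some tracial
  state \<open>\<tau>\<close> of the ambient algebra.\<close>

definition trace_measures ::
    "(('x::topological_space \<Rightarrow> complex) \<Rightarrow> 'a::unital_cstar_algebra) \<Rightarrow> 'x measure set"
  where "trace_measures \<iota> = {\<mu>. prob_space \<mu> \<and> sets \<mu> = sets borel \<and>
    (\<exists>\<tau>\<in>tracial_states. \<forall>f. continuous_on UNIV f \<longrightarrow> \<tau> (\<iota> f) = (\<integral>x. f x \<partial>\<mu>))}"

definition pair_SBP ::
    "(('x::topological_space \<Rightarrow> complex) \<Rightarrow> 'a::unital_cstar_algebra) \<Rightarrow> bool"
  where "pair_SBP \<iota> \<longleftrightarrow> small_boundary_property (trace_measures \<iota>)"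

end

theory Submission
  imports Defs "HOL-Computational_Algebra.Fundamental_Theorem_Algebra"
begin

text \<open>
  The small boundary property follows as soon as every continuous \<open>f : X \<rightarrow> \<real>\<close> has uniformly close
  continuous \<open>g\<close> for which some set \<open>{|g| < \<delta>}\<close> has small measure for all trace measures at once
  (\<open>uniform_perturbation\<close>): iterating with rapidly decreasing distances gives a limit \<open>G\<close> that is close to
  the distance from \<open>x\<close> minus a constant and whose zero set is null for every trace measure, and \<open>{G < 0}\<close> is the required
  neighbourhood of \<open>x\<close> (\<open>small_boundary_property_of_perturbation\<close>).

  To perturb \<open>f\<close> near its zero set it suffices to cut \<open>X\<close> into two pieces compatible with \<open>f\<close>:
  a continuous \<open>\<rho>\<close> which, off a set of small trace measure, takes values near \<open>0\<close> or \<open>1\<close>, is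
  near \<open>1\<close> where \<open>f\<close> is clearly negative, and near \<open>0\<close> where \<open>f\<close> is clearly positive
  (\<open>almost_indicator\<close>). Then \<open>1 - 2\<rho>\<close>, clipped to a band around \<open>f\<close>, is the perturbation.

  Properties (S) and (E) give such a cut with the right measure in the wrong place. Property (S)
  replaces \<open>f\<close> by a nearby \<open>g \<in> A\<close> with little spectral mass around \<open>0\<close>, and Property (E) replaces
  \<open>g\<close> by a function \<open>\<beta>\<close> on \<open>X\<close> whose distribution under all traces is nearly that of \<open>g\<close>, hence nearly that
  of \<open>f\<close> (\<open>same_distribution_function\<close>). A ramp \<open>e\<close> of \<open>\<beta>\<close> is then an approximate projection in \<open>D\<close>
  with trace about that of \<open>{f < 0}\<close>, up to small shifts of the level \<open>0\<close>. Property (C) moves it into place in two steps. It first conjugates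
  \<open>e\<close> into the hereditary subalgebra of a slightly larger sublevel set of \<open>f\<close>, and the result is close
  to an element \<open>q\<close> of \<open>D\<close> (\<open>first_comparison\<close>). Next, the set \<open>{f < -3t}\<close> has smaller trace
  than \<open>q\<close> and is conjugated into the support of \<open>q\<close> by some \<open>u\<close>; the approximate projection
  \<open>u\<^sup>*qu\<close> contains \<open>{f < -3t}\<close>, and it stays inside \<open>{f < 4t}\<close> because \<open>u\<close> lies in the
  hereditary subalgebra of that set up to a scalar (\<open>second_comparison\<close>). The strict inequalities that
  Property (C) requires hold uniformly in the trace because \<open>A\<close> is simple: a nonzero positive
  element has traces bounded away from \<open>0\<close> (\<open>simple_trace_lower_bound\<close>). If the relevant
  positive element is zero, then \<open>f\<close> omits an interval of values and can be cut there.

  The rest provides the C*-algebra theory behind this: the continuous functional calculus of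
  self-adjoint elements, the seminorms of traces, and the calculus in a copy of \<open>C(X)\<close>. Values
  \<open>d_tau\<close> of elements of \<open>C(X)\<close> are only compared with traces of continuous functions.
\<close>

section \<open>Scalar multiplication and involution\<close>

lemma scaleC_zero_right [simp]: "c *\<^sub>C (0::'a::unital_cstar_algebra) = 0"
  using scaleC_add_right[of c "0::'a" 0] by simp

lemma scaleC_zero_left [simp]: "0 *\<^sub>C (x::'a::unital_cstar_algebra) = 0"
  using scaleC_add_left[of 0 0 x] by simp

lemma scaleC_one [simp]: "1 *\<^sub>C (x::'a::unital_cstar_algebra) = x"
  using scaleC_of_real[of 1 x] by simp

lemma scaleC_minus_left: "(- c) *\<^sub>C (x::'a::unital_cstar_algebra) = - (c *\<^sub>C x)"
  using scaleC_add_left[of "-c" c x] by (simp add: eq_neg_iff_add_eq_0)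

lemma scaleC_minus_right: "c *\<^sub>C (- x) = - (c *\<^sub>C (x::'a::unital_cstar_algebra))"
  using scaleC_add_right[of c "-x" x] by (simp add: eq_neg_iff_add_eq_0)

lemma scaleC_diff_left: "(c - d) *\<^sub>C (x::'a::unital_cstar_algebra) = c *\<^sub>C x - d *\<^sub>C x"
  using scaleC_add_left[of c "-d" x] by (simp add: scaleC_minus_left)

lemma scaleC_diff_right: "c *\<^sub>C (x - y) = c *\<^sub>C (x::'a::unital_cstar_algebra) - c *\<^sub>C y"
  using scaleC_add_right[of c x "-y"] by (simp add: scaleC_minus_right)

lemma star_zero [simp]: "star (0::'a::unital_cstar_algebra) = 0"
  using star_add[of "0::'a" 0] by simp

lemma star_one [simp]: "star (1::'a::unital_cstar_algebra) = 1"
  by (metis mult.left_neutral mult.right_neutral star_mult star_star)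

lemma star_minus: "star (- x) = - star (x::'a::unital_cstar_algebra)"
  using star_add[of "-x" x] by (simp add: eq_neg_iff_add_eq_0)

lemma star_diff: "star (x - y) = star x - star (y::'a::unital_cstar_algebra)"
  using star_add[of x "-y"] by (simp add: star_minus)

lemma star_scaleR: "star (r *\<^sub>R x) = r *\<^sub>R star (x::'a::unital_cstar_algebra)"
  using star_scaleC[of "of_real r" x] by (simp add: scaleC_of_real)

lemma norm_star [simp]: "norm (star x) = norm (x::'a::unital_cstar_algebra)"
proof -
  have le: "norm y \<le> norm (star y)" for y :: 'a
  proof (cases "y = 0")
    case False
    have "norm y * norm y \<le> norm (star y) * norm y"
      using norm_mult_ineq[of "star y" y] by (simp add: cstar_identity power2_eq_square)
    then show ?thesis using False by simp
  qed simp
  show ?thesis using le[of x] le[of "star x"] by (simp add: star_star)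
qed

lemma star_power: "star (x ^ n) = star (x::'a::unital_cstar_algebra) ^ n"
  by (induction n) (simp_all add: star_mult power_commutes)

lemma norm_square_self_adjoint:
  "self_adjoint a \<Longrightarrow> norm (a * a) = (norm (a::'a::unital_cstar_algebra))\<^sup>2"
  using cstar_identity[of a] by (simp add: self_adjoint_def)

section \<open>Invertible elements and the spectrum\<close>

definition unit_el :: "'a::monoid_mult \<Rightarrow> bool"
  where "unit_el x \<longleftrightarrow> (\<exists>y. x * y = 1 \<and> y * x = 1)"

definition minv :: "'a::monoid_mult \<Rightarrow> 'a"
  where "minv x = (SOME y. x * y = 1 \<and> y * x = 1)"

lemma minv: "unit_el x \<Longrightarrow> x * minv x = 1" "unit_el x \<Longrightarrow> minv x * x = 1"
  unfolding unit_el_def minv_def by (metis (mono_tags, lifting) someI_ex)+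

lemma minv_unique: "x * y = 1 \<Longrightarrow> y * x = 1 \<Longrightarrow> minv x = y"
  by (metis minv(2) mult.assoc mult.left_neutral mult.right_neutral unit_el_def)

lemma spectrum_unit_el: "z \<in> spectrum a \<longleftrightarrow> \<not> unit_el (z *\<^sub>C 1 - a)"
  by (simp add: spectrum_def unit_el_def)

lemma unit_el_mult: "unit_el x \<Longrightarrow> unit_el y \<Longrightarrow> unit_el (x * y)"
  unfolding unit_el_def by (metis mult.assoc mult.right_neutral)

lemma unit_el_factor:
  assumes "unit_el (x * y)" "x * y = y * x"
  shows "unit_el x"
proof -
  obtain z where z: "x * y * z = 1" "z * (x * y) = 1" using assms(1) by (auto simp: unit_el_def)
  have "x * (y * z) = 1" using z by (simp add: mult.assoc)
  moreover have "z * y * x = 1" using z assms(2) by (simp add: mult.assoc)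
  ultimately show ?thesis unfolding unit_el_def by (metis mult.assoc mult.left_neutral mult.right_neutral)
qed

lemma unit_el_scaleC:
  assumes "c \<noteq> 0" shows "unit_el (c *\<^sub>C (x::'a::unital_cstar_algebra)) \<longleftrightarrow> unit_el x"
proof -
  have *: "unit_el (c *\<^sub>C x)" if "unit_el x" "c \<noteq> 0" for c and x :: 'a
  proof -
    obtain y where "x * y = 1" "y * x = 1" using \<open>unit_el x\<close> by (auto simp: unit_el_def)
    then have "c *\<^sub>C x * (inverse c *\<^sub>C y) = 1 \<and> inverse c *\<^sub>C y * c *\<^sub>C x = 1"
      using \<open>c \<noteq> 0\<close> by (simp add: mult_scaleC_left mult_scaleC_right scaleC_scaleC)
    then show ?thesis by (auto simp: unit_el_def)
  qed
  show ?thesis using *[of x c] *[of "c *\<^sub>C x" "inverse c"] assms by (auto simp: scaleC_scaleC)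
qed

text \<open>The inverse is the Neumann series.\<close>

lemma unit_el_one_minus:
  fixes x :: "'a::{real_normed_algebra_1,banach}"
  assumes "norm x < 1"
  shows "unit_el (1 - x)"
proof -
  have s: "summable (\<lambda>n. x ^ n)"
  proof (rule summable_comparison_test)
    show "\<exists>N. \<forall>n\<ge>N. norm (x ^ n) \<le> norm x ^ n" using norm_power_ineq by blast
    show "summable (\<lambda>n. norm x ^ n)" using assms by (simp add: summable_geometric)
  qed
  define S where "S = (\<Sum>n. x ^ n)"
  have h: "S = 1 + (\<Sum>n. x ^ Suc n)" unfolding S_def using suminf_split_head[OF s] by simp
  have "(\<Sum>n. x ^ Suc n) = x * S" unfolding S_def using suminf_mult[OF s, of x] by simp
  moreover have "(\<Sum>n. x ^ Suc n) = S * x"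
    unfolding S_def using suminf_mult2[OF s, of x] by (simp add: power_commutes)
  ultimately have "(1 - x) * S = 1" "S * (1 - x) = 1" using h by (simp_all add: algebra_simps)
  then show ?thesis by (auto simp: unit_el_def)
qed

lemma spectrum_bound:
  assumes "z \<in> spectrum (a::'a::unital_cstar_algebra)"
  shows "cmod z \<le> norm a"
proof (rule ccontr)
  assume "\<not> cmod z \<le> norm a"
  then have z: "norm a < cmod z" "z \<noteq> 0" by auto
  have "norm (inverse z *\<^sub>C a) < 1"
    using z(1) le_less_trans[OF norm_ge_zero z(1)]
    by (simp only: norm_scaleC norm_inverse) (simp add: divide_simps)
  from unit_el_one_minus[OF this] have "unit_el (z *\<^sub>C (1 - inverse z *\<^sub>C a))"
    using z by (simp add: unit_el_scaleC)
  then have "unit_el (z *\<^sub>C 1 - a)" using z by (simp add: scaleC_diff_right scaleC_scaleC)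
  with assms show False by (simp add: spectrum_unit_el)
qed

text \<open>The Lipschitz estimate comes from the resolvent identity
  \<open>y\<^sup>-\<^sup>1 - x\<^sup>-\<^sup>1 = y\<^sup>-\<^sup>1 (x - y) x\<^sup>-\<^sup>1\<close>, which also bounds \<open>y\<^sup>-\<^sup>1\<close> by \<open>2 \<parallel>x\<^sup>-\<^sup>1\<parallel>\<close>.\<close>

lemma resolvent_bound:
  fixes x y :: "'a::{real_normed_algebra_1,banach}"
  assumes "unit_el x" "norm (y - x) * norm (minv x) \<le> 1 / 2"
  shows "unit_el y" "norm (minv y - minv x) \<le> 2 * (norm (minv x))\<^sup>2 * norm (y - x)"
proof -
  define c where "c = minv x"
  have c: "x * c = 1" "c * x = 1" using minv[OF assms(1)] by (auto simp: c_def)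
  have "norm ((x - y) * c) \<le> 1 / 2"
    using norm_mult_ineq[of "x - y" c] assms(2) by (simp add: c_def norm_minus_commute)
  then have "unit_el (1 - (x - y) * c)" by (intro unit_el_one_minus) auto
  then have "unit_el ((1 - (x - y) * c) * x)" using assms(1) by (rule unit_el_mult)
  moreover have "(1 - (x - y) * c) * x = y" using c by (simp add: algebra_simps)
  ultimately show y: "unit_el y" by simp
  define d where "d = minv y"
  have d: "y * d = 1" "d * y = 1" using minv[OF y] by (auto simp: d_def)
  have dc: "d - c = d * (x - y) * c" using c d by (simp add: algebra_simps) 
  have 1: "norm (d - c) \<le> norm d * (norm (y - x) * norm c)"
    unfolding dc using norm_mult_ineq[of "d * (x - y)" c] norm_mult_ineq[of d "x - y"]
    by (smt (verit, best) mult.assoc mult_right_mono norm_ge_zero norm_minus_commute)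
  also have "\<dots> \<le> norm d * (1 / 2)" using assms(2) by (intro mult_left_mono) (auto simp: c_def)
  finally have "norm d \<le> 2 * norm c" using norm_triangle_ineq2[of d c] by linarith
  then have "norm d * (norm (y - x) * norm c) \<le> 2 * norm c * (norm (y - x) * norm c)"
    by (intro mult_right_mono) auto
  with 1 show "norm (minv y - minv x) \<le> 2 * (norm (minv x))\<^sup>2 * norm (y - x)"
    by (simp add: c_def d_def power2_eq_square mult_ac)
qed

section \<open>Norm and spectrum of self-adjoint elements\<close>

text \<open>The next two lemmas are the induction step of an elementary replacement for the spectral radius
  formula. Write \<open>R(a,z)\<close> for the inverse of \<open>1 - za\<close>. By partial fractions \<open>R(a\<^sup>2,w\<^sup>2)\<close> is the
  average of \<open>R(a,w)\<close> and \<open>R(a,-w)\<close>, so a bound on \<open>R(a,z) - R(a,sz)\<close> that is uniform in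
  \<open>|z| \<le> 1\<close> passes to \<open>a\<^sup>2\<close> and \<open>s\<^sup>2\<close> with the same constant.\<close>

lemma unit_el_one_minus_square:
  fixes x :: "'a::{real_normed_algebra_1,banach}"
  assumes "unit_el (1 - x)" "unit_el (1 + x)"
  shows "unit_el (1 - x * x)" "minv (1 - x * x) = (1/2) *\<^sub>R (minv (1 - x) + minv (1 + x))"
proof -
  define p q where "p = minv (1 - x)" and "q = minv (1 + x)"
  have p: "(1 - x) * p = 1" "p * (1 - x) = 1" and q: "(1 + x) * q = 1" "q * (1 + x) = 1"
    using minv assms by (auto simp: p_def q_def)
  have f: "1 - x * x = (1 + x) * (1 - x)" "1 - x * x = (1 - x) * (1 + x)" by (simp_all add: algebra_simps)
  show "unit_el (1 - x * x)" unfolding f(1) using assms by (intro unit_el_mult)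
  have "(1 - x * x) * (p + q) = (1 + x) * ((1 - x) * p) + (1 - x) * ((1 + x) * q)"
    unfolding distrib_left by (metis f mult.assoc)
  also have "\<dots> = 2" using p q by simp
  finally have 1: "(1 - x * x) * (p + q) = 2" .
  have "(p + q) * (1 - x * x) = (p * (1 - x)) * (1 + x) + (q * (1 + x)) * (1 - x)"
    unfolding distrib_right by (metis f mult.assoc)
  also have "\<dots> = 2" using p q by simp
  finally have 2: "(p + q) * (1 - x * x) = 2" .
  have two: "(1/2) *\<^sub>R (2::'a) = 1" by (metis half_gt_zero_iff less_irrefl one_add_one scaleR_half_double)
  show "minv (1 - x * x) = (1/2) *\<^sub>R (minv (1 - x) + minv (1 + x))"
    using 1 2 two by (intro minv_unique) (auto simp flip: p_def q_def)
qed

lemma resolvent_square: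
  fixes a :: "'a::unital_cstar_algebra"
  assumes "\<And>z. cmod z \<le> 1 \<Longrightarrow> unit_el (1 - z *\<^sub>C a)"
    and "0 \<le> s" "s \<le> 1"
    and "\<And>z. cmod z \<le> 1 \<Longrightarrow> norm (minv (1 - z *\<^sub>C a) - minv (1 - (of_real s * z) *\<^sub>C a)) \<le> e"
  shows "\<And>z. cmod z \<le> 1 \<Longrightarrow> unit_el (1 - z *\<^sub>C (a * a))"
    and "\<And>z. cmod z \<le> 1 \<Longrightarrow>
      norm (minv (1 - z *\<^sub>C (a * a)) - minv (1 - (of_real (s * s) * z) *\<^sub>C (a * a))) \<le> e"
proof -
  have sq: "unit_el (1 - (w * w) *\<^sub>C (a * a)) \<and>
     minv (1 - (w * w) *\<^sub>C (a * a)) = (1/2) *\<^sub>R (minv (1 - w *\<^sub>C a) + minv (1 - (-w) *\<^sub>C a))"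
    if "cmod w \<le> 1" for w
  proof -
    have "(w * w) *\<^sub>C (a * a) = (w *\<^sub>C a) * (w *\<^sub>C a)"
      by (simp add: mult_scaleC_left mult_scaleC_right scaleC_scaleC)
    then show ?thesis
      using unit_el_one_minus_square[of "w *\<^sub>C a"] assms(1)[of w] assms(1)[of "-w"] that
      by (simp add: scaleC_minus_left)
  qed
  fix z :: complex assume z: "cmod z \<le> 1"
  define w where "w = csqrt z"
  have w: "w * w = z" "cmod w \<le> 1" using z by (auto simp: w_def power2_eq_square[symmetric] norm_csqrt)
  show "unit_el (1 - z *\<^sub>C (a * a))" using sq w by metis
  have sw: "cmod (of_real s * w) \<le> 1" using w(2) assms(2,3) by (simp add: norm_mult mult_le_one)
  have swz: "of_real (s * s) * z = (of_real s * w) * (of_real s * w)" by (simp add: w(1)[symmetric])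
  let ?G = "\<lambda>z. minv (1 - z *\<^sub>C a)"
  have "minv (1 - z *\<^sub>C (a * a)) - minv (1 - (of_real (s * s) * z) *\<^sub>C (a * a))
     = (1/2) *\<^sub>R ((?G w - ?G (of_real s * w)) + (?G (-w) - ?G (of_real s * (-w))))"
    unfolding swz using sq[OF w(2)] sq[OF sw] w(1) by (simp add: algebra_simps)
  also have "norm \<dots> \<le> (1/2) * (e + e)"
    using norm_triangle_ineq[of "?G w - ?G (of_real s * w)" "?G (-w) - ?G (of_real s * (-w))"]
      assms(4)[of w] assms(4)[of "-w"] w(2) by simp
  finally show "norm (minv (1 - z *\<^sub>C (a * a)) - minv (1 - (of_real (s * s) * z) *\<^sub>C (a * a))) \<le> e"
    by simp
qed

text \<open>If \<open>z\<close> is in the spectrum of \<open>a\<close>, then \<open>z + il\<close> is in that of \<open>a + il\<close>, whose norm is at most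
  the square root of \<open>\<parallel>a\<parallel>\<^sup>2 + l\<^sup>2\<close>; for large real \<open>l\<close> of the sign of \<open>Im z\<close> this is a contradiction.\<close>

lemma self_adjoint_spectrum_real:
  assumes "self_adjoint (a::'a::unital_cstar_algebra)" "z \<in> spectrum a"
  shows "z \<in> \<real>"
proof -
  have bound: "(Im z)\<^sup>2 + 2 * Im z * l \<le> (norm a)\<^sup>2" for l :: real
  proof -
    let ?b = "a + (\<i> * of_real l) *\<^sub>C 1"
    have eq: "(z + \<i> * of_real l) *\<^sub>C 1 - ?b = z *\<^sub>C 1 - a" by (simp add: scaleC_add_left)
    have "z + \<i> * of_real l \<in> spectrum ?b" using assms(2) unfolding spectrum_unit_el eq .
    then have 1: "cmod (z + \<i> * of_real l) \<le> norm ?b" by (rule spectrum_bound)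
    have "star ?b = a - (\<i> * of_real l) *\<^sub>C 1"
      using assms(1) by (simp add: self_adjoint_def star_add star_scaleC scaleC_minus_left)
    then have "star ?b * ?b = (a - (\<i> * of_real l) *\<^sub>C 1) * ?b" by simp
    also have "\<dots> = a * a + (l * l) *\<^sub>R 1"
      by (simp add: algebra_simps mult_scaleC_left mult_scaleC_right scaleC_scaleC
          scaleC_minus_left scaleC_diff_right flip: scaleC_of_real)
    finally have "star ?b * ?b = a * a + (l * l) *\<^sub>R 1" .
    then have "(norm ?b)\<^sup>2 = norm (a * a + (l * l) *\<^sub>R 1)" by (simp flip: cstar_identity)
    also have "\<dots> \<le> (norm a)\<^sup>2 + l * l"
      using norm_triangle_ineq[of "a * a" "(l * l) *\<^sub>R 1"] assms(1) by (simp add: norm_square_self_adjoint)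
    finally have "(cmod (z + \<i> * of_real l))\<^sup>2 \<le> (norm a)\<^sup>2 + l * l"
      using 1 by (meson norm_ge_zero order_trans power_mono)
    moreover have "(cmod (z + \<i> * of_real l))\<^sup>2 = (Re z)\<^sup>2 + (Im z + l)\<^sup>2" by (simp add: cmod_power2)
    moreover have "(Im z + l)\<^sup>2 = (Im z)\<^sup>2 + 2 * Im z * l + l * l" by (simp add: power2_eq_square algebra_simps)
    ultimately show ?thesis using zero_le_power2[of "Re z"] by linarith
  qed
  have "Im z = 0"
  proof (rule ccontr)
    assume "Im z \<noteq> 0"
    then have "2 * Im z * (((norm a)\<^sup>2 + 1) / (2 * Im z)) = (norm a)\<^sup>2 + 1" by simp
    with bound[of "((norm a)\<^sup>2 + 1) / (2 * Im z)"] zero_le_power2[of "Im z"] show False by linarith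
  qed
  then show ?thesis by (simp add: complex_is_Real_iff)
qed

text \<open>The spectrum is real, so if it contained neither \<open>1\<close> nor \<open>-1\<close>, the resolvent \<open>R(a,z)\<close> would be defined and
  uniformly continuous on the closed disc. Squaring repeatedly keeps \<open>R(a\<^sup>n,1)\<close> uniformly close to
  \<open>R(a\<^sup>n,s\<^sup>n)\<close> for \<open>n = 2\<^sup>k\<close> and a fixed \<open>s < 1\<close>; the latter tends to \<open>1\<close>, so \<open>a\<^sup>n\<close> becomes small,
  although its norm stays \<open>1\<close> by the C*-identity.\<close>

lemma norm_in_spectrum_aux:
  assumes sa: "self_adjoint (a::'a::unital_cstar_algebra)" and n1: "norm a = 1"
  shows "1 \<in> spectrum a \<or> -1 \<in> spectrum a"
proof (rule ccontr)
  assume contra: "\<not> (1 \<in> spectrum a \<or> -1 \<in> spectrum a)"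
  have U: "unit_el (1 - z *\<^sub>C a)" if z: "cmod z \<le> 1" for z
  proof (cases "z = 0")
    case True then show ?thesis by (auto simp: unit_el_def)
  next
    case False
    have "inverse z \<notin> spectrum a"
    proof
      assume i: "inverse z \<in> spectrum a"
      then have "cmod (inverse z) \<le> 1" using spectrum_bound n1 by metis
      then have "cmod (inverse z) = 1"
        using z False one_le_inverse[of "cmod z"] unfolding norm_inverse by simp
      moreover obtain r where r: "inverse z = of_real r"
        using self_adjoint_spectrum_real[OF sa i] by (rule Reals_cases)
      ultimately have "r = 1 \<or> r = -1" by auto
      then show False using i r contra by auto
    qed
    then have "unit_el (z *\<^sub>C (inverse z *\<^sub>C 1 - a))" using False by (simp add: unit_el_scaleC spectrum_unit_el)
    then show ?thesis using False by (simp add: scaleC_diff_right scaleC_scaleC)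
  qed
  have "continuous_on (cball 0 1) (\<lambda>z. minv (1 - z *\<^sub>C a))"
    unfolding continuous_on_iff
  proof (intro ballI allI impI)
    fix z :: complex and e :: real assume z: "z \<in> cball 0 1" and e: "0 < e"
    define M where "M = norm (minv (1 - z *\<^sub>C a))"
    have M: "0 \<le> M" by (simp add: M_def)
    define d where "d = min (1 / (2 * M + 2)) (e / (2 * M\<^sup>2 + 2))"
    have d: "d > 0" using M e by (auto simp: d_def intro!: divide_pos_pos add_nonneg_pos)
    have "dist (minv (1 - w *\<^sub>C a)) (minv (1 - z *\<^sub>C a)) < e" if w: "dist w z < d" for w
    proof -
      have "(1 - w *\<^sub>C a) - (1 - z *\<^sub>C a) = (z - w) *\<^sub>C a" by (simp add: scaleC_diff_left)
      then have eq: "norm ((1 - w *\<^sub>C a) - (1 - z *\<^sub>C a)) = dist w z"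
        by (simp add: norm_scaleC n1 dist_norm norm_minus_commute)
      have "dist w z * (2 * M + 2) \<le> 1" using w M by (simp add: d_def pos_less_divide_eq)
      moreover have "dist w z * (2 * M + 2) = 2 * (dist w z * M) + 2 * dist w z" by (simp add: algebra_simps)
      ultimately have "dist w z * M \<le> 1 / 2" using zero_le_dist[of w z] by linarith
      then have "norm (minv (1 - w *\<^sub>C a) - minv (1 - z *\<^sub>C a)) \<le> 2 * M\<^sup>2 * dist w z"
        using resolvent_bound(2)[of "1 - z *\<^sub>C a" "1 - w *\<^sub>C a", unfolded eq, folded M_def] U[of z] z
        by simp
      also have "\<dots> \<le> (2 * M\<^sup>2 + 2) * dist w z" by (simp add: algebra_simps)
      also have "\<dots> < e"
      proof -
        have "dist w z < e / (2 * M\<^sup>2 + 2)" using w by (simp add: d_def)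
        moreover have "2 * M\<^sup>2 + 2 > 0" by (simp add: add_nonneg_pos)
        ultimately show ?thesis by (simp add: pos_less_divide_eq mult.commute)
      qed
      finally show ?thesis by (simp add: dist_norm)
    qed
    with d show "\<exists>d>0. \<forall>w\<in>cball 0 1. dist w z < d \<longrightarrow> dist (minv (1 - w *\<^sub>C a)) (minv (1 - z *\<^sub>C a)) < e"
      by blast
  qed
  then have "uniformly_continuous_on (cball 0 1) (\<lambda>z. minv (1 - z *\<^sub>C a))"
    by (intro compact_uniformly_continuous) auto
  then obtain d where d: "d > 0" and
    D: "\<And>z w. cmod z \<le> 1 \<Longrightarrow> cmod w \<le> 1 \<Longrightarrow> dist w z < d \<Longrightarrow>
       dist (minv (1 - w *\<^sub>C a)) (minv (1 - z *\<^sub>C a)) < 1/8"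
    unfolding uniformly_continuous_on_def by (metis mem_cball_0 zero_less_divide_1_iff zero_less_numeral)
  define s where "s = max 0 (1 - d/2)"
  have s: "0 \<le> s" "s < 1" using d by (auto simp: s_def)
  have start: "norm (minv (1 - z *\<^sub>C a) - minv (1 - (of_real s * z) *\<^sub>C a)) \<le> 1/8" if z: "cmod z \<le> 1" for z
  proof -
    have "dist z (of_real s * z) = cmod (of_real (1 - s) * z)" by (simp add: dist_norm algebra_simps)
    also have "\<dots> = (1 - s) * cmod z" using s by (simp only: norm_mult norm_of_real)
    also have "\<dots> \<le> (1 - s) * 1" using s z by (intro mult_left_mono) auto
    also have "\<dots> < d" using d by (auto simp: s_def max_def)
    finally have "dist z (of_real s * z) < d" .
    moreover have "cmod (of_real s * z) \<le> 1" using s z by (simp add: norm_mult mult_le_one)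
    ultimately show ?thesis using D[of "of_real s * z" z] z by (simp add: dist_norm)
  qed
  have main: "(\<forall>z. cmod z \<le> 1 \<longrightarrow> unit_el (1 - z *\<^sub>C (a ^ (2 ^ k)))) \<and>
     (\<forall>z. cmod z \<le> 1 \<longrightarrow> norm (minv (1 - z *\<^sub>C (a ^ (2 ^ k))) -
         minv (1 - (of_real (s ^ (2 ^ k)) * z) *\<^sub>C (a ^ (2 ^ k)))) \<le> 1/8) \<and> norm (a ^ (2 ^ k)) = 1" for k
  proof (induction k)
    case 0 then show ?case using U start n1 by simp
  next
    case (Suc k)
    have p: "b ^ (2 ^ Suc k) = b ^ (2 ^ k) * b ^ (2 ^ k)" for b :: "'b::monoid_mult"
      by (simp add: mult_2 power_add)
    have sk: "0 \<le> s ^ 2 ^ k" "s ^ 2 ^ k \<le> 1" using s by (auto intro: power_le_one)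
    have "self_adjoint (a ^ 2 ^ k)" using sa by (simp add: self_adjoint_def star_power)
    then have "norm (a ^ 2 ^ k * a ^ 2 ^ k) = 1" using Suc by (simp add: norm_square_self_adjoint)
    then show ?case unfolding p
      using resolvent_square[where a="a ^ 2 ^ k" and s="s ^ 2 ^ k" and e="1/8"] Suc sk by blast
  qed
  have "(\<lambda>n. s ^ n) \<longlonglongrightarrow> 0" using s by (intro LIMSEQ_realpow_zero) auto
  then have "eventually (\<lambda>n. s ^ n < 1/16) sequentially" by (rule order_tendstoD) simp
  then obtain N where N: "\<And>n. n \<ge> N \<Longrightarrow> s ^ n < 1/16" by (auto simp: eventually_sequentially)
  define b where "b = a ^ (2 ^ N)"
  define r where "r = s ^ (2 ^ N)"
  have r: "0 \<le> r" "r < 1/16" using s N[of "2 ^ N"] by (auto simp: r_def self_le_power less_imp_le)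
  have b1: "norm b = 1" and bU: "unit_el (1 - b)"
    and bG: "norm (minv (1 - b) - minv (1 - of_real r *\<^sub>C b)) \<le> 1/8"
    using main[of N] by (auto simp: b_def r_def dest: spec[of _ "1::complex"])
  have one: "minv (1::'a) = 1" "unit_el (1::'a)" by (auto intro: minv_unique simp: unit_el_def)
  have "norm (minv (1 - of_real r *\<^sub>C b) - minv 1) \<le> 2 * (norm (minv (1::'a)))\<^sup>2 * norm ((1 - of_real r *\<^sub>C b) - 1)"
    by (rule resolvent_bound(2)) (use r b1 one in \<open>auto simp: norm_scaleC\<close>)
  then have "norm (minv (1 - of_real r *\<^sub>C b) - 1) \<le> 1/8" using r b1 by (simp add: one norm_scaleC)
  then have x: "norm (minv (1 - b) - 1) \<le> 1/4"
    using bG norm_triangle_ineq[of "minv (1 - b) - minv (1 - of_real r *\<^sub>C b)" "minv (1 - of_real r *\<^sub>C b) - 1"] by simp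
  define x where "x = minv (1 - b) - 1"
  have "(1 - b) * (1 + x) = 1" using minv(1)[OF bU] by (simp add: x_def)
  then have "b = x - b * x" by (simp add: algebra_simps)
  then have "norm b \<le> norm x + norm b * norm x"
    by (metis add_left_mono norm_mult_ineq norm_triangle_ineq4 order_trans)
  with b1 x show False by (simp add: x_def)
qed

lemma norm_in_spectrum:
  assumes sa: "self_adjoint (a::'a::unital_cstar_algebra)"
  shows "\<exists>r. complex_of_real r \<in> spectrum a \<and> \<bar>r\<bar> = norm a"
proof (cases "a = 0")
  case True
  have "\<not> unit_el (0::'a)" by (simp add: unit_el_def)
  then show ?thesis using True by (intro exI[of _ 0]) (simp add: spectrum_unit_el)
next
  case False
  define n where "n = norm a"
  have n: "n > 0" using False by (simp add: n_def)
  define b where "b = inverse n *\<^sub>R a"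
  have "self_adjoint b" using sa by (simp add: b_def self_adjoint_def star_scaleR)
  moreover have "norm b = 1" using n by (simp add: b_def n_def)
  ultimately have "1 \<in> spectrum b \<or> -1 \<in> spectrum b" by (rule norm_in_spectrum_aux)
  moreover have "of_real (n * e) \<in> spectrum a" if "of_real e \<in> spectrum b" for e
  proof -
    have "of_real (n * e) *\<^sub>C 1 - a = of_real n *\<^sub>C (of_real e *\<^sub>C 1 - b)"
      using n by (simp add: b_def scaleC_diff_right scaleC_scaleC) (simp add: scaleC_of_real)
    then show ?thesis using that n by (simp add: spectrum_unit_el unit_el_scaleC)
  qed
  from this[of 1] this[of "-1"] have "of_real (n * 1) \<in> spectrum a \<or> of_real (n * -1) \<in> spectrum a"
    using calculation by auto
  then show ?thesis using n unfolding n_def[symmetric] by (metis abs_minus_cancel abs_of_pos mult.right_neutral mult_minus_right)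
qed

section \<open>Continuous functional calculus\<close>

definition peval :: "'a::unital_cstar_algebra \<Rightarrow> complex poly \<Rightarrow> 'a"
  where "peval a p = fold_coeffs (\<lambda>c x. c *\<^sub>C 1 + a * x) p 0"

lemma peval_0 [simp]: "peval a 0 = 0"
  by (simp add: peval_def)

lemma peval_pCons [simp]: "peval a (pCons c p) = c *\<^sub>C 1 + a * peval a p"
  by (cases "p = 0 \<and> c = 0") (auto simp: peval_def)

lemma peval_1 [simp]: "peval a 1 = 1"
  by (simp add: one_pCons)

lemma peval_add: "peval a (p + q) = peval a p + peval a q"
  by (induction p q rule: poly_induct2) (simp_all add: scaleC_add_left algebra_simps)

lemma peval_smult: "peval a (smult c p) = c *\<^sub>C peval a p"
  by (induction p) (simp_all add: scaleC_add_right scaleC_scaleC mult_scaleC_right)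

lemma peval_minus: "peval a (- p) = - peval a p"
  using peval_smult[of a "-1" p] by (simp add: scaleC_minus_left)

lemma peval_diff: "peval a (p - q) = peval a p - peval a q"
  using peval_add[of a p "- q"] by (simp add: peval_minus)

lemma peval_commute: "a * peval a p = peval a p * a"
  by (induction p) (simp_all add: algebra_simps mult_scaleC_left mult_scaleC_right, metis mult.assoc)

lemma peval_mult: "peval a (p * q) = peval a p * peval a q"
  by (induction p)
     (simp_all add: peval_add peval_smult algebra_simps mult_scaleC_left)

lemma peval_pcompose: "peval a (pcompose p q) = peval (peval a q) p"
  by (induction p) (simp_all add: pcompose_pCons peval_add peval_mult)

lemma star_peval:
  assumes "self_adjoint a" shows "star (peval a p) = peval a (map_poly cnj p)"
  using assms
  by (induction p)
     (simp_all add: map_poly_pCons star_add star_scaleC star_mult self_adjoint_def peval_commute)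

lemma poly_map_cnj: "poly (map_poly cnj p) (complex_of_real t) = cnj (poly p (complex_of_real t))"
  by (induction p) (simp_all add: map_poly_pCons)

lemma unit_el_peval:
  assumes "p \<noteq> 0" "\<And>m. poly p m = 0 \<Longrightarrow> unit_el (m *\<^sub>C 1 - a)"
  shows "unit_el (peval a p)"
  using assms
proof (induction "degree p" arbitrary: p rule: less_induct)
  case less
  show ?case
  proof (cases "degree p = 0")
    case True
    then obtain c where c: "p = [:c:]" by (rule degree_eq_zeroE)
    have "unit_el (1::'a)" by (simp add: unit_el_def)
    then show ?thesis using c less.prems(1) by (simp add: unit_el_scaleC)
  next
    case False
    then have "\<not> constant (poly p)" by (simp add: constant_degree)
    then obtain m where m: "poly p m = 0" using fundamental_theorem_of_algebra by blast
    then obtain q where q: "p = [:- m, 1:] * q" by (auto simp: poly_eq_0_iff_dvd)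
    have q0: "q \<noteq> 0" using q less.prems(1) by auto
    have "degree p = Suc (degree q)" using q0 unfolding q by (subst degree_mult_eq) auto
    then have "unit_el (peval a q)" using q0 less.prems(2) by (intro less.hyps) (auto simp: q)
    moreover have "unit_el (- 1 *\<^sub>C (m *\<^sub>C 1 - a))" using less.prems(2)[OF m] by (subst unit_el_scaleC) auto
    then have "unit_el (peval a [:- m, 1:])" by (simp add: scaleC_minus_left)
    ultimately show ?thesis unfolding q peval_mult by (intro unit_el_mult)
  qed
qed

definition rspec :: "'a::unital_cstar_algebra \<Rightarrow> real set"
  where "rspec a = complex_of_real -` spectrum a"

lemma rspec_bound: "t \<in> rspec a \<Longrightarrow> \<bar>t\<bar> \<le> norm a"
  using spectrum_bound[of "of_real t" a] by (simp add: rspec_def)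

lemma rspec_nonempty: "self_adjoint a \<Longrightarrow> rspec a \<noteq> {}"
  using norm_in_spectrum[of a] by (auto simp: rspec_def)

lemma compact_rspec: "compact (rspec (a::'a::unital_cstar_algebra))"
proof -
  have "open (- rspec a)"
    unfolding open_dist
  proof
    fix t assume "t \<in> - rspec a"
    then have u: "unit_el (of_real t *\<^sub>C 1 - a)" by (simp add: rspec_def spectrum_unit_el)
    define M where "M = norm (minv (of_real t *\<^sub>C 1 - a))"
    have M: "0 \<le> M" by (simp add: M_def)
    have "y \<in> - rspec a" if y: "dist y t < 1 / (2 * M + 2)" for y
    proof -
      have "(of_real y *\<^sub>C 1 - a) - (of_real t *\<^sub>C 1 - a) = of_real (y - t) *\<^sub>C 1"
        by (simp add: scaleC_diff_left)
      then have eq: "norm ((of_real y *\<^sub>C 1 - a) - (of_real t *\<^sub>C 1 - a)) = dist y t"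
        by (simp only: norm_scaleC) (simp add: dist_norm flip: of_real_diff)
      have "dist y t * (2 * M + 2) \<le> 1" using y M by (simp add: pos_less_divide_eq)
      moreover have "dist y t * (2 * M + 2) = 2 * (dist y t * M) + 2 * dist y t" by (simp add: algebra_simps)
      ultimately have "dist y t * M \<le> 1 / 2" using zero_le_dist[of y t] by linarith
      then have "unit_el (of_real y *\<^sub>C 1 - a)"
        using resolvent_bound(1)[OF u, of "of_real y *\<^sub>C 1 - a", unfolded eq, folded M_def] by simp
      then show ?thesis by (simp add: rspec_def spectrum_unit_el)
    qed
    then show "\<exists>e>0. \<forall>y. dist y t < e \<longrightarrow> y \<in> - rspec a"
      using M by (intro exI[of _ "1 / (2 * M + 2)"]) auto
  qed
  then have "closed (rspec a)" by (simp add: closed_def)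
  moreover have "bounded (rspec a)" using rspec_bound[of _ a] by (auto simp: bounded_iff)
  ultimately show ?thesis by (simp add: compact_eq_bounded_closed)
qed

lemma poly_rspec_le_norm_peval:
  assumes "t \<in> rspec a"
  shows "cmod (poly p (of_real t)) \<le> norm (peval a p)"
proof -
  let ?c = "poly p (of_real t)"
  have "poly ([:?c:] - p) (of_real t) = 0" by simp
  then obtain q where q: "[:?c:] - p = [:- of_real t, 1:] * q"
    by (auto simp: poly_eq_0_iff_dvd simp del: poly_diff)
  have "\<not> unit_el (?c *\<^sub>C 1 - peval a p)"
  proof
    assume "unit_el (?c *\<^sub>C 1 - peval a p)"
    moreover have "?c *\<^sub>C 1 - peval a p = peval a [:- of_real t, 1:] * peval a q"
      unfolding peval_mult[symmetric] q[symmetric] by (simp add: peval_diff)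
    moreover have "peval a [:- of_real t, 1:] * peval a q = peval a q * peval a [:- of_real t, 1:]"
      by (metis peval_mult mult.commute)
    ultimately have "unit_el (peval a [:- of_real t, 1:])" by (metis unit_el_factor)
    then have "unit_el (- 1 *\<^sub>C peval a [:- of_real t, 1:])" by (subst unit_el_scaleC) auto
    with assms show False
      by (simp add: rspec_def spectrum_unit_el scaleC_minus_left)
  qed
  then show ?thesis by (intro spectrum_bound) (simp add: spectrum_unit_el)
qed

text \<open>The inclusion of the spectral mapping theorem that needs the factorisation of polynomials
  over \<open>\<complex>\<close>.\<close>

lemma spectrum_peval:
  assumes sa: "self_adjoint a" and z: "z \<in> spectrum (peval a p)"
  shows "\<exists>t\<in>rspec a. z = poly p (of_real t)"
proof -
  have "\<exists>m\<in>spectrum a. z = poly p m"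
  proof (cases "[:z:] - p = 0")
    case True
    then have "poly ([:z:] - p) m = 0" for m by simp
    then show ?thesis using rspec_nonempty[OF sa] by (auto simp: rspec_def)
  next
    case False
    moreover have "\<not> unit_el (peval a ([:z:] - p))"
      using z by (simp add: spectrum_unit_el peval_diff)
    ultimately obtain m where "poly ([:z:] - p) m = 0" "\<not> unit_el (m *\<^sub>C 1 - a)"
      using unit_el_peval[of "[:z:] - p" a] by blast
    then show ?thesis by (intro bexI[of _ m]) (auto simp: spectrum_unit_el)
  qed
  then show ?thesis
    using self_adjoint_spectrum_real[OF sa] by (force simp: rspec_def elim: Reals_cases)
qed

text \<open>By the C*-identity it suffices to bound the norm of the self-adjoint element \<open>p(a)\<^sup>* p(a)\<close>,
  which is attained on its spectrum, that is, at some \<open>|p(t)|\<^sup>2\<close>.\<close>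

lemma norm_peval_le:
  assumes sa: "self_adjoint a" and le: "\<And>t. t \<in> rspec a \<Longrightarrow> cmod (poly p (of_real t)) \<le> e"
  shows "norm (peval a p) \<le> e"
proof -
  have e: "e \<ge> 0" using rspec_nonempty[OF sa] le norm_ge_zero order_trans by (metis ex_in_conv)
  define q where "q = map_poly cnj p * p"
  have w: "peval a q = star (peval a p) * peval a p" by (simp add: q_def peval_mult star_peval sa)
  then have "self_adjoint (peval a q)" by (simp add: self_adjoint_def star_mult star_star)
  then obtain r where r: "complex_of_real r \<in> spectrum (peval a q)" "\<bar>r\<bar> = norm (peval a q)"
    using norm_in_spectrum by blast
  obtain t where tin: "t \<in> rspec a" and t: "of_real r = poly q (of_real t)"
    using spectrum_peval[OF sa r(1)] by blast
  have "(norm (peval a p))\<^sup>2 = \<bar>r\<bar>" using r(2) w by (simp add: cstar_identity)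
  also have "\<dots> = cmod (poly q (of_real t))" by (simp flip: t)
  also have "\<dots> = (cmod (poly p (of_real t)))\<^sup>2"
    by (simp add: q_def poly_map_cnj norm_mult power2_eq_square)
  also have "\<dots> \<le> e\<^sup>2" using le[OF tin] by (intro power_mono) auto
  finally show ?thesis using e by (rule power2_le_imp_le)
qed

lemma Weierstrass_complex_poly:
  fixes f :: "real \<Rightarrow> complex"
  assumes "compact S" "continuous_on S f" "0 < e"
  shows "\<exists>p. \<forall>t\<in>S. cmod (f t - poly p (of_real t)) < e"
proof -
  have R: "\<exists>p. \<forall>t\<in>S. cmod (of_real (g t) - poly p (of_real t)) < d"
    if g: "continuous_on S g" and d: "0 < d" for g :: "real \<Rightarrow> real" and d
  proof -
    obtain h where h: "real_polynomial_function h" "\<And>x. x \<in> S \<Longrightarrow> \<bar>g x - h x\<bar> < d"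
      using Stone_Weierstrass_real_polynomial_function[OF assms(1) g d] by blast
    obtain c n where c: "h = (\<lambda>x. \<Sum>i\<le>n. c i * x ^ i)"
      using h(1) by (auto simp: real_polynomial_function_iff_sum)
    have "poly (\<Sum>i\<le>n. monom (of_real (c i)) i) (of_real t) = complex_of_real (h t)" for t
      by (simp add: c poly_sum poly_monom)
    moreover have "cmod (of_real (g t) - of_real (h t)) = \<bar>g t - h t\<bar>" for t
      by (metis norm_of_real of_real_diff)
    ultimately show ?thesis using h(2) by (intro exI[of _ "\<Sum>i\<le>n. monom (of_real (c i)) i"]) auto
  qed
  obtain p where p: "\<forall>t\<in>S. cmod (of_real (Re (f t)) - poly p (of_real t)) < e/2"
    using R[of "\<lambda>t. Re (f t)" "e/2"] assms by (auto intro: continuous_intros)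
  obtain q where q: "\<forall>t\<in>S. cmod (of_real (Im (f t)) - poly q (of_real t)) < e/2"
    using R[of "\<lambda>t. Im (f t)" "e/2"] assms by (auto intro: continuous_intros)
  have "cmod (f t - poly (p + smult \<i> q) (of_real t)) < e" if "t \<in> S" for t
  proof -
    have "f t - poly (p + smult \<i> q) (of_real t) =
      (of_real (Re (f t)) - poly p (of_real t)) + \<i> * (of_real (Im (f t)) - poly q (of_real t))"
      by (subst (1) complex_eq[of "f t"]) (simp add: algebra_simps)
    also have "cmod \<dots> < e/2 + e/2"
    proof (rule le_less_trans[OF norm_triangle_ineq add_strict_mono])
      show "cmod (of_real (Re (f t)) - poly p (of_real t)) < e/2" using p that by blast
      show "cmod (\<i> * (of_real (Im (f t)) - poly q (of_real t))) < e/2" using q that by (simp add: norm_mult)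
    qed
    finally show ?thesis by simp
  qed
  then show ?thesis by blast
qed

text \<open>The functional calculus as a relation: \<open>b\<close> is a norm limit of \<open>p\<^sub>n(a)\<close> for polynomials
  \<open>p\<^sub>n\<close> that converge to \<open>f\<close> uniformly on the spectrum. As a relation it inherits the algebraic
  laws directly from polynomials; that it is a function follows from the norm estimate.\<close>

definition cfc_lim :: "'a::unital_cstar_algebra \<Rightarrow> (real \<Rightarrow> complex) \<Rightarrow> 'a \<Rightarrow> bool"
  where "cfc_lim a f b \<longleftrightarrow> (\<exists>P. uniform_limit (rspec a) (\<lambda>n t. poly (P n) (of_real t)) f sequentially \<and>
    (\<lambda>n. peval a (P n)) \<longlonglongrightarrow> b)"

lemma cfc_lim_poly: "cfc_lim a (\<lambda>t. poly p (of_real t)) (peval a p)"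
  unfolding cfc_lim_def by (intro exI[of _ "\<lambda>_. p"]) (auto intro: uniform_limit_const)

lemma cfc_lim_cong:
  assumes "cfc_lim a f b" "\<And>t. t \<in> rspec a \<Longrightarrow> f t = g t" shows "cfc_lim a g b"
  using assms unfolding cfc_lim_def by (metis (no_types, lifting) uniform_limit_cong')

lemma cfc_lim_add: "cfc_lim a f b \<Longrightarrow> cfc_lim a g c \<Longrightarrow> cfc_lim a (\<lambda>t. f t + g t) (b + c)"
  unfolding cfc_lim_def
proof (elim exE conjE)
  fix P Q assume "uniform_limit (rspec a) (\<lambda>n t. poly (P n) (of_real t)) f sequentially"
    "(\<lambda>n. peval a (P n)) \<longlonglongrightarrow> b"
    "uniform_limit (rspec a) (\<lambda>n t. poly (Q n) (of_real t)) g sequentially"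
    "(\<lambda>n. peval a (Q n)) \<longlonglongrightarrow> c"
  then show "\<exists>P. uniform_limit (rspec a) (\<lambda>n t. poly (P n) (of_real t)) (\<lambda>t. f t + g t) sequentially \<and>
    (\<lambda>n. peval a (P n)) \<longlonglongrightarrow> b + c"
    by (intro exI[of _ "\<lambda>n. P n + Q n"]) (simp add: peval_add uniform_limit_add tendsto_add)
qed

lemma tendsto_star: "f \<longlonglongrightarrow> b \<Longrightarrow> (\<lambda>n. star (f n)) \<longlonglongrightarrow> star (b::'a::unital_cstar_algebra)"
proof (rule LIM_zero_cancel)
  assume "f \<longlonglongrightarrow> b"
  then have "(\<lambda>n. norm (f n - b)) \<longlonglongrightarrow> 0" by (simp add: LIM_zero tendsto_norm_zero)
  then have "(\<lambda>n. norm (star (f n) - star b)) \<longlonglongrightarrow> 0" by (simp flip: star_diff)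
  then show "(\<lambda>n. star (f n) - star b) \<longlonglongrightarrow> 0" by (simp add: tendsto_norm_zero_iff)
qed

lemma cfc_lim_cnj:
  assumes "self_adjoint a" "cfc_lim a f b" shows "cfc_lim a (\<lambda>t. cnj (f t)) (star b)"
proof -
  obtain P where P: "uniform_limit (rspec a) (\<lambda>n t. poly (P n) (of_real t)) f sequentially"
    "(\<lambda>n. peval a (P n)) \<longlonglongrightarrow> b" using assms(2) unfolding cfc_lim_def by blast
  have "uniform_limit (rspec a) (\<lambda>n t. poly (map_poly cnj (P n)) (of_real t)) (\<lambda>t. cnj (f t)) sequentially"
    using P(1) by (simp add: uniform_limit_iff poly_map_cnj dist_norm flip: complex_cnj_diff)
  moreover have "(\<lambda>n. peval a (map_poly cnj (P n))) \<longlonglongrightarrow> star b"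
    using tendsto_star[OF P(2)] by (simp add: star_peval assms(1))
  ultimately show ?thesis unfolding cfc_lim_def
    by (intro exI[of _ "\<lambda>n. map_poly cnj (P n)"] conjI)
qed

lemma cfc_lim_norm_le:
  assumes sa: "self_adjoint a" and "cfc_lim a f b" and le: "\<And>t. t \<in> rspec a \<Longrightarrow> cmod (f t) \<le> e"
  shows "norm b \<le> e"
proof (rule field_le_epsilon)
  fix d :: real assume d: "0 < d"
  obtain P where P: "uniform_limit (rspec a) (\<lambda>n t. poly (P n) (of_real t)) f sequentially"
    "(\<lambda>n. peval a (P n)) \<longlonglongrightarrow> b" using assms(2) unfolding cfc_lim_def by blast
  have "eventually (\<lambda>n. \<forall>t\<in>rspec a. dist (poly (P n) (of_real t)) (f t) < d) sequentially"
    using P(1) d by (simp add: uniform_limit_iff)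
  then have ev: "eventually (\<lambda>n. norm (peval a (P n)) \<le> e + d) sequentially"
  proof eventually_elim
    case (elim n)
    show ?case
    proof (rule norm_peval_le[OF sa])
      fix t assume t: "t \<in> rspec a"
      then have "cmod (poly (P n) (of_real t) - f t) < d" using elim by (simp add: dist_norm)
      then show "cmod (poly (P n) (of_real t)) \<le> e + d"
        using le[OF t] norm_triangle_ineq2[of "poly (P n) (of_real t)" "f t"] by linarith
    qed
  qed
  show "norm b \<le> e + d" by (rule tendsto_upperbound[OF tendsto_norm[OF P(2)] ev]) simp
qed

lemma cfc_lim_norm_ge:
  assumes "cfc_lim a f b" and t: "t \<in> rspec a" shows "cmod (f t) \<le> norm b"
proof -
  obtain P where P: "uniform_limit (rspec a) (\<lambda>n t. poly (P n) (of_real t)) f sequentially"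
    "(\<lambda>n. peval a (P n)) \<longlonglongrightarrow> b" using assms unfolding cfc_lim_def by blast
  have "(\<lambda>n. poly (P n) (of_real t)) \<longlonglongrightarrow> f t" using P(1) t by (rule tendsto_uniform_limitI)
  from LIMSEQ_le[OF tendsto_norm[OF this] tendsto_norm[OF P(2)]] show ?thesis
    using poly_rspec_le_norm_peval[OF t] by blast
qed

lemma cfc_lim_mult:
  assumes "cfc_lim a f b" "cfc_lim a g c" shows "cfc_lim a (\<lambda>t. f t * g t) (b * c)"
proof -
  obtain P where P: "uniform_limit (rspec a) (\<lambda>n t. poly (P n) (of_real t)) f sequentially"
    "(\<lambda>n. peval a (P n)) \<longlonglongrightarrow> b" using assms unfolding cfc_lim_def by blast
  obtain Q where Q: "uniform_limit (rspec a) (\<lambda>n t. poly (Q n) (of_real t)) g sequentially"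
    "(\<lambda>n. peval a (Q n)) \<longlonglongrightarrow> c" using assms unfolding cfc_lim_def by blast
  have "bounded (f ` rspec a)" "bounded (g ` rspec a)"
    using cfc_lim_norm_ge[OF assms(1)] cfc_lim_norm_ge[OF assms(2)] by (auto simp: bounded_iff)
  then have "uniform_limit (rspec a) (\<lambda>n t. poly (P n) (of_real t) * poly (Q n) (of_real t))
      (\<lambda>t. f t * g t) sequentially"
    using P(1) Q(1) by (intro uniform_lim_mult)
  then show ?thesis unfolding cfc_lim_def using P(2) Q(2)
    by (intro exI[of _ "\<lambda>n. P n * Q n"]) (auto simp: peval_mult intro: tendsto_mult)
qed

lemma cfc_lim_scaleC:
  assumes "cfc_lim a f b" shows "cfc_lim a (\<lambda>t. c * f t) (c *\<^sub>C b)"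
  using cfc_lim_mult[OF cfc_lim_poly[of a "[:c:]"] assms] by (simp add: mult_scaleC_left)

lemma cfc_lim_diff: "cfc_lim a f b \<Longrightarrow> cfc_lim a g c \<Longrightarrow> cfc_lim a (\<lambda>t. f t - g t) (b - c)"
  using cfc_lim_add[of a f b "\<lambda>t. -1 * g t" "-1 *\<^sub>C c"] cfc_lim_scaleC[of a g c "-1"]
  by (simp add: scaleC_minus_left)

lemma cfc_lim_unique:
  assumes "self_adjoint a" "cfc_lim a f b" "cfc_lim a f c" shows "b = c"
  using cfc_lim_norm_le[OF assms(1) cfc_lim_diff[OF assms(2,3)], of 0] by simp

lemma cfc_lim_exists:
  assumes sa: "self_adjoint a" and f: "continuous_on (rspec a) f"
  shows "\<exists>b. cfc_lim a f b"
proof -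
  have "\<forall>n. \<exists>p. \<forall>t\<in>rspec a. cmod (f t - poly p (of_real t)) < 1 / Suc n"
    using Weierstrass_complex_poly[OF compact_rspec f] by simp
  then obtain P where P: "\<And>n t. t \<in> rspec a \<Longrightarrow> cmod (f t - poly (P n) (of_real t)) < 1 / Suc n"
    by metis
  have small: "\<exists>N. \<forall>n\<ge>N. 1 / real (Suc n) < e" if e: "0 < e" for e :: real
  proof -
    obtain N where N: "1 / real (Suc N) < e" using nat_approx_posE[OF e] by metis
    have "1 / real (Suc n) \<le> 1 / real (Suc N)" if "N \<le> n" for n using that by (simp add: frac_le)
    with N show ?thesis by (intro exI[of _ N]) (auto intro: le_less_trans)
  qed
  have u: "uniform_limit (rspec a) (\<lambda>n t. poly (P n) (of_real t)) f sequentially"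
    unfolding uniform_limit_iff eventually_sequentially
  proof (intro allI impI)
    fix e :: real assume "0 < e"
    then obtain N where N: "\<And>n. n \<ge> N \<Longrightarrow> 1 / real (Suc n) < e" using small by auto
    have "dist (poly (P n) (of_real t)) (f t) < e" if "N \<le> n" "t \<in> rspec a" for n t
      using less_trans[OF P[OF that(2), of n] N[OF that(1)]] by (simp only: dist_norm norm_minus_commute)
    then show "\<exists>N. \<forall>n\<ge>N. \<forall>t\<in>rspec a. dist (poly (P n) (of_real t)) (f t) < e" by blast
  qed
  have "Cauchy (\<lambda>n. peval a (P n))"
    unfolding Cauchy_def
  proof (intro allI impI)
    fix e :: real assume "0 < e"
    then obtain N where N: "\<And>n. n \<ge> N \<Longrightarrow> 1 / real (Suc n) < e/3" using small[of "e/3"] by auto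
    have "dist (peval a (P m)) (peval a (P n)) < e" if "m \<ge> N" "n \<ge> N" for m n
    proof -
      have "norm (peval a (P m - P n)) \<le> e/3 + e/3"
      proof (rule norm_peval_le[OF sa])
        fix t assume t: "t \<in> rspec a"
        have "poly (P m - P n) (of_real t) = (f t - poly (P n) (of_real t)) - (f t - poly (P m) (of_real t))"
          by simp
        also have "cmod \<dots> \<le> e/3 + e/3"
          using P[OF t, of m] P[OF t, of n] N[OF that(1)] N[OF that(2)]
            norm_triangle_ineq4[of "f t - poly (P n) (of_real t)" "f t - poly (P m) (of_real t)"]
          by linarith
        finally show "cmod (poly (P m - P n) (of_real t)) \<le> e/3 + e/3" .
      qed
      then show ?thesis using \<open>0 < e\<close> by (simp add: dist_norm flip: peval_diff)
    qed
    then show "\<exists>M. \<forall>m\<ge>M. \<forall>n\<ge>M. dist (peval a (P m)) (peval a (P n)) < e" by blast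
  qed
  then obtain b where "(\<lambda>n. peval a (P n)) \<longlonglongrightarrow> b" using Cauchy_convergent convergent_def by blast
  with u show ?thesis unfolding cfc_lim_def by blast
qed

lemma C_embeddingD:
  assumes "C_embedding S \<phi>"
  shows C_embedding_add: "\<And>f g. continuous_on S f \<Longrightarrow> continuous_on S g \<Longrightarrow> \<phi> (\<lambda>x. f x + g x) = \<phi> f + \<phi> g"
    and C_embedding_mult: "\<And>f g. continuous_on S f \<Longrightarrow> continuous_on S g \<Longrightarrow> \<phi> (\<lambda>x. f x * g x) = \<phi> f * \<phi> g"
    and C_embedding_scale: "\<And>c f. continuous_on S f \<Longrightarrow> \<phi> (\<lambda>x. c * f x) = c *\<^sub>C \<phi> f"
    and C_embedding_cnj: "\<And>f. continuous_on S f \<Longrightarrow> \<phi> (\<lambda>x. cnj (f x)) = star (\<phi> f)"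
    and C_embedding_one: "\<phi> (\<lambda>x. 1) = 1"
    and C_embedding_norm: "\<And>f. continuous_on S f \<Longrightarrow> norm (\<phi> f) = (SUP x\<in>S. cmod (f x))"
  using assms unfolding C_embedding_def by blast+

lemma C_embedding_poly:
  assumes "C_embedding (rspec a) \<phi>" "\<phi> complex_of_real = a"
  shows "\<phi> (\<lambda>t. poly p (of_real t)) = peval a p"
proof (induction p)
  case 0
  have "\<phi> (\<lambda>x. 0 * 1) = 0 *\<^sub>C \<phi> (\<lambda>x. 1)"
    by (rule C_embedding_scale[OF assms(1)]) (rule continuous_on_const)
  then show ?case by simp
next
  case (pCons c p)
  have 1: "continuous_on (rspec a) (\<lambda>t. c * 1)" "continuous_on (rspec a) (\<lambda>t. 1::complex)"
     "continuous_on (rspec a) complex_of_real" "continuous_on (rspec a) (\<lambda>t. poly p (of_real t))"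
     "continuous_on (rspec a) (\<lambda>t. complex_of_real t * poly p (of_real t))"
    by (intro continuous_intros)+
  have "\<phi> (\<lambda>t. c * 1 + of_real t * poly p (of_real t)) = \<phi> (\<lambda>t. c * 1) + \<phi> (\<lambda>t. of_real t * poly p (of_real t))"
    by (rule C_embedding_add[OF assms(1) 1(1) 1(5)])
  also have "\<phi> (\<lambda>t. c * 1) = c *\<^sub>C 1"
    using C_embedding_scale[OF assms(1) 1(2)] C_embedding_one[OF assms(1)] by simp
  also have "\<phi> (\<lambda>t. of_real t * poly p (of_real t)) = a * peval a p"
    using C_embedding_mult[OF assms(1) 1(3) 1(4)] assms(2) pCons.IH by simp
  finally show ?case by simp
qed

text \<open>The relation defines an embedding of the continuous functions on the spectrum. Any other embedding with
  the same value at the identity agrees with it on polynomials and is isometric, so the description that defines \<open>cfc\<close> is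
  met by exactly one element.\<close>

lemma cfc_eqI:
  assumes sa: "self_adjoint a" and f: "continuous_on (rspec a) f" and b: "cfc_lim a f b"
  shows "cfc f a = b"
  unfolding cfc_def rspec_def[symmetric]
proof (rule the_equality)
  define \<phi> where "\<phi> f = (THE b. cfc_lim a f b)" for f
  have eq: "\<phi> f = b" if "cfc_lim a f b" for f b
    unfolding \<phi>_def using that cfc_lim_unique[OF sa] by (intro the_equality) auto
  have lim: "cfc_lim a f (\<phi> f)" if h: "continuous_on (rspec a) f" for f
  proof -
    obtain b where b: "cfc_lim a f b" using cfc_lim_exists[OF sa h] by blast
    show ?thesis unfolding eq[OF b] by (rule b)
  qed
  have "C_embedding (rspec a) \<phi>"
    unfolding C_embedding_def
  proof (intro conjI allI impI)
    fix f g :: "real \<Rightarrow> complex" and c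
    assume f: "continuous_on (rspec a) f"
    show "\<phi> (\<lambda>x. c * f x) = c *\<^sub>C \<phi> f" by (intro eq cfc_lim_scaleC lim f)
    show "\<phi> (\<lambda>x. cnj (f x)) = star (\<phi> f)" by (intro eq cfc_lim_cnj lim f sa)
    show "norm (\<phi> f) = (SUP x\<in>rspec a. cmod (f x))"
    proof (rule antisym)
      have bdd: "bdd_above ((\<lambda>x. cmod (f x)) ` rspec a)"
        using cfc_lim_norm_ge[OF lim[OF f]] by (auto intro!: bdd_aboveI)
      show "norm (\<phi> f) \<le> (SUP x\<in>rspec a. cmod (f x))"
        by (rule cfc_lim_norm_le[OF sa lim[OF f]]) (rule cSUP_upper[OF _ bdd])
      show "(SUP x\<in>rspec a. cmod (f x)) \<le> norm (\<phi> f)"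
        by (rule cSUP_least[OF rspec_nonempty[OF sa]]) (rule cfc_lim_norm_ge[OF lim[OF f]])
    qed
    assume g: "continuous_on (rspec a) g"
    show "\<phi> (\<lambda>x. f x + g x) = \<phi> f + \<phi> g" by (intro eq cfc_lim_add lim f g)
    show "\<phi> (\<lambda>x. f x * g x) = \<phi> f * \<phi> g" by (intro eq cfc_lim_mult lim f g)
  next
    show "\<phi> (\<lambda>x. 1) = 1" using eq[OF cfc_lim_poly[of a "[:1:]"]] by simp
  qed
  moreover have "\<phi> complex_of_real = a" using eq[OF cfc_lim_poly[of a "[:0, 1:]"]] by simp
  ultimately show "\<exists>\<phi>. C_embedding (rspec a) \<phi> \<and> \<phi> complex_of_real = a \<and> \<phi> f = b"
    using eq[OF b] by metis
next
  fix c assume "\<exists>\<phi>. C_embedding (rspec a) \<phi> \<and> \<phi> complex_of_real = a \<and> \<phi> f = c"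
  then obtain \<phi> where \<phi>: "C_embedding (rspec a) \<phi>" "\<phi> complex_of_real = a" "\<phi> f = c" by blast
  obtain P where P: "uniform_limit (rspec a) (\<lambda>n t. poly (P n) (of_real t)) f sequentially"
    "(\<lambda>n. peval a (P n)) \<longlonglongrightarrow> b" using b unfolding cfc_lim_def by blast
  have "(\<lambda>n. peval a (P n)) \<longlonglongrightarrow> c"
  proof (rule metric_LIMSEQ_I)
    fix e :: real assume e: "0 < e"
    have "eventually (\<lambda>n. \<forall>t\<in>rspec a. dist (poly (P n) (of_real t)) (f t) < e/2) sequentially"
      using P(1) half_gt_zero[OF e] unfolding uniform_limit_iff by blast
    then have "eventually (\<lambda>n. dist (peval a (P n)) c < e) sequentially"
    proof eventually_elim
      case (elim n)
      let ?g = "\<lambda>t. poly (P n) (of_real t)"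
      have g: "continuous_on (rspec a) ?g" "continuous_on (rspec a) (\<lambda>t. - 1 * f t)"
        "continuous_on (rspec a) (\<lambda>t. ?g t + - 1 * f t)"
        using f by (intro continuous_intros; assumption)+
      have "\<phi> (\<lambda>t. ?g t + - 1 * f t) = peval a (P n) + (- 1) *\<^sub>C c"
        using C_embedding_add[OF \<phi>(1) g(1,2)] C_embedding_scale[OF \<phi>(1) f, of "-1"]
          C_embedding_poly[OF \<phi>(1,2)] \<phi>(3) by simp
      moreover have "norm (\<phi> (\<lambda>t. ?g t + - 1 * f t)) = (SUP t\<in>rspec a. cmod (?g t + - 1 * f t))"
        by (rule C_embedding_norm[OF \<phi>(1) g(3)])
      ultimately have "norm (peval a (P n) - c) = (SUP t\<in>rspec a. cmod (?g t + - 1 * f t))"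
        by (simp add: scaleC_minus_left)
      also have "\<dots> \<le> e/2"
        using elim by (intro cSUP_least[OF rspec_nonempty[OF sa]]) (auto simp: dist_norm intro: less_imp_le)
      finally show ?case using e by (simp add: dist_norm)
    qed
    then show "\<exists>no. \<forall>n\<ge>no. dist (peval a (P n)) c < e" by (simp add: eventually_sequentially)
  qed
  then show "c = b" using P(2) LIMSEQ_unique by blast
qed

lemma cfc_lim_cfc:
  assumes "self_adjoint a" "continuous_on (rspec a) f"
  shows "cfc_lim a f (cfc f a)"
proof -
  obtain b where b: "cfc_lim a f b" using cfc_lim_exists[OF assms] by blast
  show ?thesis unfolding cfc_eqI[OF assms b] by (rule b)
qed

lemma norm_cfc_diff_peval_le:
  assumes "self_adjoint a" "continuous_on (rspec a) f"
    and "\<And>t. t \<in> rspec a \<Longrightarrow> cmod (f t - poly p (of_real t)) \<le> e"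
  shows "norm (cfc f a - peval a p) \<le> e"
  by (rule cfc_lim_norm_le[OF assms(1) cfc_lim_diff[OF cfc_lim_cfc[OF assms(1,2)] cfc_lim_poly]])
     (rule assms(3))

lemma positive_sqrt_exists:
  assumes "positive a" shows "\<exists>v. self_adjoint v \<and> v * v = a"
proof -
  have sa: "self_adjoint a" using assms by (simp add: positive_def)
  have pos: "0 \<le> t" if "t \<in> rspec a" for t
    using assms that by (auto simp: positive_def rspec_def nonneg_Reals_of_real_iff dest!: subsetD)
  let ?f = "\<lambda>t. complex_of_real (sqrt t)"
  have f: "continuous_on (rspec a) ?f" by (intro continuous_intros)
  obtain v where v: "cfc_lim a ?f v" using cfc_lim_exists[OF sa f] by blast
  have "star v = v" using cfc_lim_unique[OF sa cfc_lim_cnj[OF sa v]] v by simp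
  moreover have "cfc_lim a (\<lambda>t. poly [:0, 1:] (of_real t)) (v * v)"
    using cfc_lim_mult[OF v v] pos by (elim cfc_lim_cong) (simp flip: of_real_mult)
  from cfc_lim_unique[OF sa cfc_lim_poly[of a "[:0, 1:]"] this] have "v * v = a" by simp
  ultimately show ?thesis by (auto simp: self_adjoint_def)
qed

section \<open>Tracial seminorms\<close>

lemma positive_square:
  assumes "self_adjoint v" shows "positive (v * v)"
proof -
  have "v * v = peval v [:0, 0, 1:]" by simp
  then have "z \<in> \<real>\<^sub>\<ge>\<^sub>0" if "z \<in> spectrum (v * v)" for z
    using spectrum_peval[OF assms, of z "[:0, 0, 1:]"] that
    by (auto simp: nonneg_Reals_of_real_iff simp flip: of_real_mult)
  moreover have "self_adjoint (v * v)" using assms by (simp add: self_adjoint_def star_mult)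
  ultimately show ?thesis by (auto simp: positive_def)
qed

lemma positive_norm_minus:
  assumes "self_adjoint a" "norm a \<le> c" shows "positive (c *\<^sub>R 1 - a)"
proof -
  have eq: "c *\<^sub>R 1 - a = peval a [:of_real c, - 1:]" by (simp add: scaleC_of_real scaleC_minus_left)
  have "z \<in> \<real>\<^sub>\<ge>\<^sub>0" if z: "z \<in> spectrum (c *\<^sub>R 1 - a)" for z
  proof -
    obtain t where "t \<in> rspec a" "z = poly [:of_real c, - 1:] (of_real t)"
      using spectrum_peval[OF assms(1), of z "[:of_real c, - 1:]"] z unfolding eq by blast
    then have "t \<le> c" "z = of_real (c - t)" using rspec_bound[of t a] assms(2) by auto
    then show ?thesis by (simp only: nonneg_Reals_of_real_iff)
  qed
  moreover have "self_adjoint (c *\<^sub>R 1 - a)"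
    using assms by (simp add: self_adjoint_def star_diff star_scaleR)
  ultimately show ?thesis by (auto simp: positive_def)
qed

lemma tracial_stateD:
  assumes "\<tau> \<in> tracial_states"
  shows trace_add: "\<And>x y. \<tau> (x + y) = \<tau> x + \<tau> y"
    and trace_scaleC: "\<And>c x. \<tau> (c *\<^sub>C x) = c * \<tau> x"
    and trace_positive: "\<And>a. positive a \<Longrightarrow> \<tau> a \<in> \<real>\<^sub>\<ge>\<^sub>0"
    and trace_one: "\<tau> 1 = 1"
    and trace_commute: "\<And>x y. \<tau> (x * y) = \<tau> (y * x)"
  using assms unfolding tracial_states_def by blast+

lemma trace_minus: "\<tau> \<in> tracial_states \<Longrightarrow> \<tau> (- x) = - \<tau> x"
  using trace_scaleC[of \<tau> "-1" x] by (simp add: scaleC_minus_left)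

lemma trace_diff: "\<tau> \<in> tracial_states \<Longrightarrow> \<tau> (x - y) = \<tau> x - \<tau> y"
  using trace_add[of \<tau> x "-y"] by (simp add: trace_minus)

lemma trace_zero: "\<tau> \<in> tracial_states \<Longrightarrow> \<tau> 0 = 0"
  using trace_diff[of \<tau> 0 0] by simp

lemma trace_scaleR: "\<tau> \<in> tracial_states \<Longrightarrow> \<tau> (r *\<^sub>R x) = of_real r * \<tau> x"
  using trace_scaleC[of \<tau> "of_real r" x] by (simp add: scaleC_of_real)

lemma trace_self_adjoint_real:
  assumes \<tau>: "\<tau> \<in> tracial_states" and "self_adjoint a" shows "\<tau> a \<in> \<real>"
proof -
  have "\<tau> (norm a *\<^sub>R 1 - a) \<in> \<real>"
    using trace_positive[OF \<tau> positive_norm_minus[OF assms(2)]] nonneg_Reals_subset_Reals by blast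
  then have "of_real (norm a) - \<tau> a \<in> \<real>"
    by (simp add: trace_diff[OF \<tau>] trace_scaleR[OF \<tau>] trace_one[OF \<tau>])
  from Reals_diff[OF Reals_of_real[of "norm a"] this] show ?thesis by simp
qed

lemma cartesian_decomposition:
  "\<exists>h k. self_adjoint h \<and> self_adjoint k \<and> (x::'a::unital_cstar_algebra) = h + \<i> *\<^sub>C k"
proof (intro exI conjI)
  show "self_adjoint ((1/2) *\<^sub>C (x + star x))"
    by (simp add: self_adjoint_def star_scaleC star_add star_star add.commute)
  show "self_adjoint ((- \<i>/2) *\<^sub>C (x - star x))"
    by (simp add: self_adjoint_def star_scaleC star_diff star_star scaleC_diff_right scaleC_minus_left)
  have "\<i> *\<^sub>C (- \<i>/2) *\<^sub>C (x - star x) = (1/2) *\<^sub>C (x - star x)" by (simp add: scaleC_scaleC)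
  moreover have "(1/2) *\<^sub>C (x + star x) + (1/2) *\<^sub>C (x - star x) = (1/2 + 1/2) *\<^sub>C x"
    by (simp only: scaleC_add_left) (simp add: scaleC_add_right scaleC_diff_right)
  ultimately show "x = (1/2) *\<^sub>C (x + star x) + \<i> *\<^sub>C (- \<i>/2) *\<^sub>C (x - star x)" by simp
qed

lemma trace_star:
  assumes \<tau>: "\<tau> \<in> tracial_states" shows "\<tau> (star x) = cnj (\<tau> x)"
proof -
  obtain h k where hk: "self_adjoint h" "self_adjoint k" "x = h + \<i> *\<^sub>C k"
    using cartesian_decomposition by blast
  have "star x = h + (- \<i>) *\<^sub>C k" using hk by (simp add: star_add star_scaleC self_adjoint_def)
  then show ?thesis
    using trace_self_adjoint_real[OF \<tau> hk(1)] trace_self_adjoint_real[OF \<tau> hk(2)]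
    by (simp add: hk(3) trace_add[OF \<tau>] trace_scaleC[OF \<tau>] complex_eq_iff complex_is_Real_iff)
qed

text \<open>Positivity of \<open>x\<^sup>*x\<close> under a trace is elementary: with \<open>x = h + ik\<close> the cross terms of
  \<open>x\<^sup>*x\<close> form a commutator.\<close>

lemma trace_star_mult_nonneg:
  assumes \<tau>: "\<tau> \<in> tracial_states" shows "\<tau> (star x * x) \<in> \<real>\<^sub>\<ge>\<^sub>0"
proof -
  obtain h k where hk: "self_adjoint h" "self_adjoint k" "x = h + \<i> *\<^sub>C k"
    using cartesian_decomposition by blast
  have "star x = h + (- \<i>) *\<^sub>C k" using hk by (simp add: star_add star_scaleC self_adjoint_def)
  then have "star x * x = (h + (- \<i>) *\<^sub>C k) * (h + \<i> *\<^sub>C k)" using hk(3) by simp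
  also have "\<dots> = h * h + k * k + \<i> *\<^sub>C (h * k - k * h)"
    by (simp add: algebra_simps mult_scaleC_left mult_scaleC_right scaleC_scaleC
        scaleC_minus_left scaleC_diff_right)
  finally have "star x * x = h * h + k * k + \<i> *\<^sub>C (h * k - k * h)" .
  then have "\<tau> (star x * x) = \<tau> (h * h) + \<tau> (k * k)"
    by (simp add: trace_add[OF \<tau>] trace_scaleC[OF \<tau>] trace_diff[OF \<tau>] trace_commute[OF \<tau>, of h k])
  moreover have "\<tau> (h * h) \<in> \<real>\<^sub>\<ge>\<^sub>0" "\<tau> (k * k) \<in> \<real>\<^sub>\<ge>\<^sub>0"
    using hk by (auto intro: trace_positive[OF \<tau>] positive_square)
  ultimately show ?thesis by (simp add: nonneg_Reals_add_I)
qed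

text \<open>All estimates are carried out for one trace at a time;
  bounds on \<open>tnorm\<close> are used in the form \<open>trnorm_le_tnorm\<close>.\<close>

definition trnorm :: "('a::unital_cstar_algebra \<Rightarrow> complex) \<Rightarrow> 'a \<Rightarrow> real"
  where "trnorm \<tau> x = sqrt (Re (\<tau> (star x * x)))"

lemma Re_trace_star_mult_nonneg: "\<tau> \<in> tracial_states \<Longrightarrow> 0 \<le> Re (\<tau> (star x * x))"
  using trace_star_mult_nonneg[of \<tau> x] by (auto simp: complex_nonneg_Reals_iff)

lemma trnorm_nonneg: "\<tau> \<in> tracial_states \<Longrightarrow> 0 \<le> trnorm \<tau> x"
  by (simp add: trnorm_def Re_trace_star_mult_nonneg)

lemma trnorm_square: "\<tau> \<in> tracial_states \<Longrightarrow> (trnorm \<tau> x)\<^sup>2 = Re (\<tau> (star x * x))"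
  by (simp add: trnorm_def Re_trace_star_mult_nonneg)

lemma trnorm_star: "\<tau> \<in> tracial_states \<Longrightarrow> trnorm \<tau> (star x) = trnorm \<tau> x"
  by (simp add: trnorm_def star_star trace_commute[of \<tau> x])

lemma trnorm_minus: "trnorm \<tau> (- x) = trnorm \<tau> x"
  by (simp add: trnorm_def star_minus)

lemma trnorm_diff_commute: "trnorm \<tau> (x - y) = trnorm \<tau> (y - x)"
  using trnorm_minus[of \<tau> "x - y"] by simp

lemma trnorm_diff_expand:
  assumes \<tau>: "\<tau> \<in> tracial_states"
  shows "(trnorm \<tau> (x - t *\<^sub>R y))\<^sup>2 =
    (trnorm \<tau> x)\<^sup>2 - 2 * t * Re (\<tau> (star y * x)) + t\<^sup>2 * (trnorm \<tau> y)\<^sup>2"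
proof -
  have "\<tau> (star x * y) = cnj (\<tau> (star y * x))"
    using trace_star[OF \<tau>, of "star y * x"] by (simp add: star_mult star_star)
  then have "Re (\<tau> (star x * y)) = Re (\<tau> (star y * x))" by simp
  moreover have "star (x - t *\<^sub>R y) * (x - t *\<^sub>R y) =
      star x * x - t *\<^sub>R (star x * y) - t *\<^sub>R (star y * x) + (t * t) *\<^sub>R (star y * y)"
    by (simp add: star_diff star_scaleR algebra_simps)
  ultimately show ?thesis
    unfolding trnorm_square[OF \<tau>]
    by (simp add: trace_diff[OF \<tau>] trace_add[OF \<tau>] trace_scaleR[OF \<tau>] power2_eq_square)
qed

text \<open>Expand the seminorm of \<open>x - ty\<close> and choose \<open>t\<close>: large if \<open>y\<close> has seminorm \<open>0\<close>, the minimiser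
  if \<open>x\<close> has seminorm \<open>0\<close>, and otherwise the ratio of the two seminorms.\<close>

lemma trace_Cauchy_Schwarz:
  assumes \<tau>: "\<tau> \<in> tracial_states"
  shows "Re (\<tau> (star y * x)) \<le> trnorm \<tau> x * trnorm \<tau> y"
proof (cases "trnorm \<tau> y = 0")
  case True
  show ?thesis
  proof (rule ccontr)
    assume "\<not> ?thesis"
    then have B: "Re (\<tau> (star y * x)) > 0" using True by simp
    define t where "t = ((trnorm \<tau> x)\<^sup>2 + 1) / (2 * Re (\<tau> (star y * x)))"
    have "2 * t * Re (\<tau> (star y * x)) = (trnorm \<tau> x)\<^sup>2 + 1" using B by (simp add: t_def)
    then show False
      using trnorm_diff_expand[OF \<tau>, of x t y] True zero_le_power2[of "trnorm \<tau> (x - t *\<^sub>R y)"] by simp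
  qed
next
  case False
  then have y: "trnorm \<tau> y > 0" using trnorm_nonneg[OF \<tau>, of y] by simp
  show ?thesis
  proof (cases "trnorm \<tau> x = 0")
    case True
    let ?B = "Re (\<tau> (star y * x))"
    have "0 \<le> - 2 * (?B / (trnorm \<tau> y)\<^sup>2) * ?B + (?B / (trnorm \<tau> y)\<^sup>2)\<^sup>2 * (trnorm \<tau> y)\<^sup>2"
      using trnorm_diff_expand[OF \<tau>, of x "?B / (trnorm \<tau> y)\<^sup>2" y] True
        zero_le_power2[of "trnorm \<tau> (x - (?B / (trnorm \<tau> y)\<^sup>2) *\<^sub>R y)"] by simp
    also have "\<dots> = - (?B\<^sup>2 / (trnorm \<tau> y)\<^sup>2)" using y by (simp add: field_simps power2_eq_square)
    finally have "?B\<^sup>2 / (trnorm \<tau> y)\<^sup>2 \<le> 0" by simp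
    then have "?B = 0" using y by (simp add: divide_le_0_iff)
    then show ?thesis using True by simp
  next
    case False
    then have x: "trnorm \<tau> x > 0" using trnorm_nonneg[OF \<tau>, of x] by simp
    define t where "t = trnorm \<tau> x / trnorm \<tau> y"
    have t: "t > 0" using x y by (simp add: t_def)
    have "t\<^sup>2 * (trnorm \<tau> y)\<^sup>2 = (trnorm \<tau> x)\<^sup>2" using y by (simp add: t_def power_divide)
    then have "2 * t * Re (\<tau> (star y * x)) \<le> 2 * (trnorm \<tau> x)\<^sup>2"
      using trnorm_diff_expand[OF \<tau>, of x t y] zero_le_power2[of "trnorm \<tau> (x - t *\<^sub>R y)"] by linarith
    also have "\<dots> = 2 * t * (trnorm \<tau> x * trnorm \<tau> y)" using y by (simp add: t_def power2_eq_square)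
    finally show ?thesis using t by (simp add: mult.assoc)
  qed
qed

lemma trnorm_triangle:
  assumes \<tau>: "\<tau> \<in> tracial_states" shows "trnorm \<tau> (x + y) \<le> trnorm \<tau> x + trnorm \<tau> y"
proof (rule power2_le_imp_le)
  have "(trnorm \<tau> (x + y))\<^sup>2 = (trnorm \<tau> x)\<^sup>2 + 2 * Re (\<tau> (star y * x)) + (trnorm \<tau> y)\<^sup>2"
    using trnorm_diff_expand[OF \<tau>, of x "-1" y] by simp
  also have "\<dots> \<le> (trnorm \<tau> x + trnorm \<tau> y)\<^sup>2"
    using trace_Cauchy_Schwarz[OF \<tau>, of y x] by (simp add: power2_sum)
  finally show "(trnorm \<tau> (x + y))\<^sup>2 \<le> (trnorm \<tau> x + trnorm \<tau> y)\<^sup>2" .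
qed (simp add: trnorm_nonneg[OF \<tau>])

lemma trnorm_triangle_diff:
  assumes \<tau>: "\<tau> \<in> tracial_states" shows "trnorm \<tau> (x - z) \<le> trnorm \<tau> (x - y) + trnorm \<tau> (y - z)"
  using trnorm_triangle[OF \<tau>, of "x - y" "y - z"] by simp

text \<open>The seminorm of \<open>x - \<tau>(x)1\<close>, a variance, is nonnegative.\<close>

lemma cmod_trace_le_trnorm:
  assumes \<tau>: "\<tau> \<in> tracial_states" shows "cmod (\<tau> x) \<le> trnorm \<tau> x"
proof (rule power2_le_imp_le)
  let ?l = "\<tau> x"
  have "star (x - ?l *\<^sub>C 1) * (x - ?l *\<^sub>C 1) = star x * x - ?l *\<^sub>C star x - cnj ?l *\<^sub>C x + (cnj ?l * ?l) *\<^sub>C 1"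
    by (simp add: star_diff star_scaleC algebra_simps mult_scaleC_left mult_scaleC_right scaleC_scaleC
        scaleC_diff_right)
  then have "\<tau> (star (x - ?l *\<^sub>C 1) * (x - ?l *\<^sub>C 1)) = \<tau> (star x * x) - ?l * cnj ?l"
    by (simp add: trace_add[OF \<tau>] trace_diff[OF \<tau>] trace_scaleC[OF \<tau>] trace_one[OF \<tau>] trace_star[OF \<tau>])
  then have "0 \<le> Re (\<tau> (star x * x) - ?l * cnj ?l)"
    using Re_trace_star_mult_nonneg[OF \<tau>, of "x - ?l *\<^sub>C 1"] by simp
  then show "(cmod ?l)\<^sup>2 \<le> (trnorm \<tau> x)\<^sup>2"
    unfolding trnorm_square[OF \<tau>] cmod_power2 by (simp add: power2_eq_square)
qed (simp add: trnorm_nonneg[OF \<tau>])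

text \<open>With \<open>v\<^sup>2 = \<parallel>x\<parallel>\<^sup>2 - x\<^sup>*x\<close>, the difference of the squares of the two sides is the trace of
  \<open>(vy)\<^sup>*(vy)\<close>.\<close>

lemma trnorm_mult_left:
  assumes \<tau>: "\<tau> \<in> tracial_states" shows "trnorm \<tau> (x * y) \<le> norm x * trnorm \<tau> y"
proof (rule power2_le_imp_le)
  let ?c = "(norm x)\<^sup>2"
  have "self_adjoint (star x * x)" by (simp add: self_adjoint_def star_mult star_star)
  then have "positive (?c *\<^sub>R 1 - star x * x)" by (rule positive_norm_minus) (simp add: cstar_identity)
  then obtain v where v: "self_adjoint v" "v * v = ?c *\<^sub>R 1 - star x * x"
    using positive_sqrt_exists by blast
  have "star (v * y) * (v * y) = star y * (v * v) * y"
    using v(1) by (simp add: star_mult self_adjoint_def mult.assoc)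
  also have "\<dots> = ?c *\<^sub>R (star y * y) - star (x * y) * (x * y)"
    unfolding v(2) by (simp add: algebra_simps star_mult)
  finally have "0 \<le> Re (\<tau> (?c *\<^sub>R (star y * y) - star (x * y) * (x * y)))"
    using Re_trace_star_mult_nonneg[OF \<tau>, of "v * y"] by simp
  then show "(trnorm \<tau> (x * y))\<^sup>2 \<le> (norm x * trnorm \<tau> y)\<^sup>2"
    by (simp add: power_mult_distrib trnorm_square[OF \<tau>] trace_diff[OF \<tau>] trace_scaleR[OF \<tau>])
qed (simp add: trnorm_nonneg[OF \<tau>])

lemma trnorm_mult_right:
  assumes \<tau>: "\<tau> \<in> tracial_states" shows "trnorm \<tau> (x * y) \<le> trnorm \<tau> x * norm y"
  using trnorm_mult_left[OF \<tau>, of "star y" "star x"] trnorm_star[OF \<tau>, of "x * y"] trnorm_star[OF \<tau>, of x]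
  by (simp add: star_mult mult.commute)

lemma trnorm_contraction_left:
  assumes "\<tau> \<in> tracial_states" "norm x \<le> 1" shows "trnorm \<tau> (x * y) \<le> trnorm \<tau> y"
  using trnorm_mult_left[OF assms(1), of x y] mult_right_mono[OF assms(2) trnorm_nonneg[OF assms(1), of y]]
  by simp

lemma trnorm_contraction_right:
  assumes "\<tau> \<in> tracial_states" "norm y \<le> 1" shows "trnorm \<tau> (x * y) \<le> trnorm \<tau> x"
  using trnorm_mult_right[OF assms(1), of x y] mult_left_mono[OF assms(2) trnorm_nonneg[OF assms(1), of x]]
  by simp

lemma trnorm_one: "\<tau> \<in> tracial_states \<Longrightarrow> trnorm \<tau> 1 = 1"
  by (simp add: trnorm_def trace_one)

lemma trnorm_zero: "\<tau> \<in> tracial_states \<Longrightarrow> trnorm \<tau> 0 = 0"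
  by (simp add: trnorm_def trace_zero)

lemma trnorm_le_norm:
  assumes \<tau>: "\<tau> \<in> tracial_states" shows "trnorm \<tau> x \<le> norm x"
  using trnorm_mult_left[OF \<tau>, of x 1] by (simp add: trnorm_one[OF \<tau>])

lemma bdd_above_tnorm: "bdd_above (insert 0 ((\<lambda>\<tau>. sqrt (Re (\<tau> (star a * a)))) ` tracial_states))"
  using trnorm_le_norm[of _ a] by (intro bdd_aboveI[of _ "norm a"]) (auto simp: trnorm_def)

lemma trnorm_le_tnorm:
  assumes \<tau>: "\<tau> \<in> tracial_states" shows "trnorm \<tau> a \<le> tnorm a"
  unfolding tnorm_def trnorm_def using \<tau> by (intro cSup_upper bdd_above_tnorm) auto

lemma tnorm_nonneg: "0 \<le> tnorm a"
  unfolding tnorm_def by (intro cSup_upper bdd_above_tnorm) auto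

lemma tdist_lessD:
  assumes "tdist a S < e" "S \<noteq> {}" shows "\<exists>s\<in>S. tnorm (a - s) < e"
proof -
  have "bdd_below ((\<lambda>s. tnorm (a - s)) ` S)" by (intro bdd_belowI[of _ 0]) (auto simp: tnorm_nonneg)
  then show ?thesis using assms by (simp add: tdist_def cINF_less_iff)
qed

text \<open>Otherwise some sequence of traces makes \<open>v\<close> tend to \<open>0\<close> in seminorm. The elements that tend to \<open>0\<close>
  along this sequence form a closed two-sided ideal, which contains \<open>v\<close> but not \<open>1\<close>.\<close>

lemma simple_trace_lower_bound:
  fixes v :: "'a::unital_cstar_algebra"
  assumes simple: "simple_cstar_algebra TYPE('a)" and "v \<noteq> 0"
  shows "\<exists>\<eta>>0. \<forall>\<tau>\<in>tracial_states. \<eta> \<le> trnorm \<tau> v"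
proof (rule ccontr)
  assume contra: "\<not> ?thesis"
  have "\<forall>n. \<exists>\<tau>\<in>tracial_states. trnorm \<tau> v < 1 / real (Suc n)"
  proof
    fix n
    have "0 < 1 / real (Suc n)" by simp
    with contra show "\<exists>\<tau>\<in>tracial_states. trnorm \<tau> v < 1 / real (Suc n)" by (meson not_le_imp_less)
  qed
  then obtain T where T: "\<And>n. T n \<in> tracial_states" "\<And>n. trnorm (T n) v < 1 / real (Suc n)" by metis
  define I where "I = {x. (\<lambda>n. trnorm (T n) x) \<longlonglongrightarrow> 0}"
  have squeeze: "(\<lambda>n. trnorm (T n) y) \<longlonglongrightarrow> 0"
    if g: "g \<longlonglongrightarrow> 0" "\<And>n. trnorm (T n) y \<le> g n" for g y
    by (rule tendsto_sandwich[OF _ _ tendsto_const g(1)])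
       (simp_all add: trnorm_nonneg[OF T(1)] g(2))
  have dom: "y \<in> I" if "x \<in> I" "\<And>n. trnorm (T n) y \<le> c * trnorm (T n) x" for x y c
  proof -
    have "(\<lambda>n. c * trnorm (T n) x) \<longlonglongrightarrow> c * 0"
      using that(1) unfolding I_def by (intro tendsto_mult_left) simp
    then have "(\<lambda>n. c * trnorm (T n) x) \<longlonglongrightarrow> 0" by simp
    then show ?thesis unfolding I_def mem_Collect_eq by (rule squeeze) (rule that(2))
  qed
  have "closed_two_sided_ideal I"
    unfolding closed_two_sided_ideal_def complex_subspace_def
  proof (intro conjI allI ballI)
    show "0 \<in> I" by (simp add: I_def trnorm_zero[OF T(1)])
    fix x assume x: "x \<in> I"
    show "x + y \<in> I" if y: "y \<in> I" for y
    proof -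
      have "(\<lambda>n. trnorm (T n) x + trnorm (T n) y) \<longlonglongrightarrow> 0 + 0"
        using x y unfolding I_def by (intro tendsto_add) auto
      then have "(\<lambda>n. trnorm (T n) x + trnorm (T n) y) \<longlonglongrightarrow> 0" by simp
      then show ?thesis unfolding I_def mem_Collect_eq by (rule squeeze) (rule trnorm_triangle[OF T(1)])
    qed
    show "a * x \<in> I" for a using dom[OF x, of "a * x" "norm a"] trnorm_mult_left[OF T(1)] by simp
    then show "c *\<^sub>C x \<in> I" for c
      by (metis mult_scaleC_left mult.left_neutral)
    show "x * a \<in> I" for a
      using dom[OF x, of "x * a" "norm a"] trnorm_mult_right[OF T(1)] by (simp add: mult.commute)
  next
    show "closed I"
      unfolding closed_sequential_limits
    proof (intro allI impI, elim conjE)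
      fix X l assume X: "\<forall>n. X n \<in> I" and l: "X \<longlonglongrightarrow> l"
      show "l \<in> I" unfolding I_def mem_Collect_eq
      proof (rule metric_LIMSEQ_I)
        fix e :: real assume e: "0 < e"
        obtain k where k: "dist (X k) l < e/2" using metric_LIMSEQ_D[OF l half_gt_zero[OF e]] by blast
        have "(\<lambda>n. trnorm (T n) (X k)) \<longlonglongrightarrow> 0" using X by (simp add: I_def)
        from metric_LIMSEQ_D[OF this half_gt_zero[OF e]] obtain N
          where N: "\<And>n. n \<ge> N \<Longrightarrow> trnorm (T n) (X k) < e/2" using trnorm_nonneg[OF T(1)] by auto
        have "trnorm (T n) l < e" if "n \<ge> N" for n
          using trnorm_triangle_diff[OF T(1), of n l 0 "X k"] N[OF that] k
            trnorm_le_norm[OF T(1), of n "l - X k"] by (simp add: dist_norm norm_minus_commute)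
        then show "\<exists>no. \<forall>n\<ge>no. dist (trnorm (T n) l) 0 < e" using trnorm_nonneg[OF T(1)] by auto
      qed
    qed
  qed
  then have "I = {0} \<or> I = UNIV" using simple by (simp add: simple_cstar_algebra_def)
  moreover have "v \<in> I" unfolding I_def mem_Collect_eq
  proof (rule squeeze)
    show "(\<lambda>n. 1 / real (Suc n)) \<longlonglongrightarrow> 0" using LIMSEQ_inverse_real_of_nat by (simp add: inverse_eq_divide)
  qed (rule less_imp_le[OF T(2)])
  moreover have "1 \<notin> I" using trnorm_one[OF T(1)] by (simp add: I_def LIMSEQ_const_iff)
  ultimately show False using \<open>v \<noteq> 0\<close> by auto
qed

lemma norm_peval_bounded:
  "\<exists>M\<ge>0. \<forall>b :: 'a::unital_cstar_algebra. norm b \<le> 1 \<longrightarrow> norm (peval b p) \<le> M"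
proof (induction p)
  case 0 then show ?case by auto
next
  case (pCons c p)
  then obtain M where M: "M \<ge> 0" "\<And>b :: 'a. norm b \<le> 1 \<Longrightarrow> norm (peval b p) \<le> M" by blast
  have "norm (peval b (pCons c p)) \<le> cmod c + M" if b: "norm b \<le> 1" for b :: 'a
  proof -
    have "norm (b * peval b p) \<le> 1 * M"
      using M b by (intro order_trans[OF norm_mult_ineq mult_mono]) auto
    then show ?thesis using norm_triangle_ineq[of "c *\<^sub>C 1" "b * peval b p"] by (simp add: norm_scaleC)
  qed
  then show ?case using M(1) by (intro exI[of _ "cmod c + M"]) auto
qed

text \<open>The constant works for all traces at once, so closeness in seminorm of two contractions makes their
  moments close uniformly in the trace.\<close>

lemma peval_trace_Lipschitz:
  "\<exists>L\<ge>0. \<forall>\<tau>\<in>tracial_states. \<forall>a b :: 'a::unital_cstar_algebra. norm a \<le> 1 \<longrightarrow> norm b \<le> 1 \<longrightarrow>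
     trnorm \<tau> (peval a p - peval b p) \<le> L * trnorm \<tau> (a - b)"
proof (induction p)
  case 0 then show ?case by (auto simp: trnorm_zero)
next
  case (pCons c p)
  then obtain L where L: "L \<ge> 0" and le: "\<And>\<tau> (a :: 'a) b. \<tau> \<in> tracial_states \<Longrightarrow> norm a \<le> 1 \<Longrightarrow> norm b \<le> 1 \<Longrightarrow>
     trnorm \<tau> (peval a p - peval b p) \<le> L * trnorm \<tau> (a - b)" by blast
  obtain M where M0: "M \<ge> 0" and M: "\<And>b :: 'a. norm b \<le> 1 \<Longrightarrow> norm (peval b p) \<le> M"
    using norm_peval_bounded[of p] by blast
  show ?case
  proof (intro exI[of _ "L + M"] conjI ballI allI impI)
    show "0 \<le> L + M" using L M0 by simp
    fix \<tau> :: "'a \<Rightarrow> complex" and a b :: 'a assume \<tau>: "\<tau> \<in> tracial_states" and ab: "norm a \<le> 1" "norm b \<le> 1"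
    have "peval a (pCons c p) - peval b (pCons c p) = a * (peval a p - peval b p) + (a - b) * peval b p"
      by (simp add: algebra_simps)
    then have "trnorm \<tau> (peval a (pCons c p) - peval b (pCons c p)) \<le>
        trnorm \<tau> (a * (peval a p - peval b p)) + trnorm \<tau> ((a - b) * peval b p)"
      using trnorm_triangle[OF \<tau>] by metis
    also have "\<dots> \<le> L * trnorm \<tau> (a - b) + trnorm \<tau> (a - b) * M"
      using trnorm_contraction_left[OF \<tau> ab(1), of "peval a p - peval b p"] le[OF \<tau> ab]
        trnorm_mult_right[OF \<tau>, of "a - b" "peval b p"]
        mult_left_mono[OF M[OF ab(2)] trnorm_nonneg[OF \<tau>, of "a - b"]] by linarith
    finally show "trnorm \<tau> (peval a (pCons c p) - peval b (pCons c p)) \<le> (L + M) * trnorm \<tau> (a - b)"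
      by (simp add: algebra_simps)
  qed
qed

section \<open>Continuous functions inside a C*-algebra\<close>

locale compact_C_embedding =
  fixes \<iota> :: "('x::metric_space \<Rightarrow> complex) \<Rightarrow> 'a::unital_cstar_algebra"
  assumes embedding: "C_embedding UNIV \<iota>" and compact_space: "compact (UNIV :: 'x set)"
begin

lemmas \<iota>_add = C_embedding_add[OF embedding]
  and \<iota>_mult = C_embedding_mult[OF embedding]
  and \<iota>_scale = C_embedding_scale[OF embedding]
  and \<iota>_cnj = C_embedding_cnj[OF embedding]
  and \<iota>_one = C_embedding_one[OF embedding]

lemma bdd_above_cmod: "continuous_on UNIV f \<Longrightarrow> bdd_above (range (\<lambda>x :: 'x. cmod (f x)))"
  by (intro bounded_imp_bdd_above compact_imp_bounded compact_continuous_image compact_space continuous_intros)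

lemma norm_\<iota>_le: "continuous_on UNIV f \<Longrightarrow> (\<And>x. cmod (f x) \<le> c) \<Longrightarrow> norm (\<iota> f) \<le> c"
  by (subst C_embedding_norm[OF embedding]) (auto intro: cSUP_least)

lemma cmod_le_norm_\<iota>: "continuous_on UNIV f \<Longrightarrow> cmod (f x) \<le> norm (\<iota> f)"
  by (subst C_embedding_norm[OF embedding]) (auto intro: cSUP_upper bdd_above_cmod)

lemma \<iota>_diff:
  assumes "continuous_on UNIV f" "continuous_on UNIV g"
  shows "\<iota> (\<lambda>x. f x - g x) = \<iota> f - \<iota> g"
proof -
  have "continuous_on UNIV (\<lambda>x. - 1 * g x)" using assms by (intro continuous_intros)
  from \<iota>_add[OF assms(1) this] \<iota>_scale[OF assms(2), of "-1"] show ?thesis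
    by (simp add: scaleC_minus_left)
qed

lemma \<iota>_injective:
  assumes "continuous_on UNIV f" "continuous_on UNIV g" "\<iota> f = \<iota> g"
  shows "f = g"
proof
  fix x
  have "cmod (f x - g x) \<le> norm (\<iota> (\<lambda>x. f x - g x))"
    by (intro cmod_le_norm_\<iota>[of "\<lambda>x. f x - g x"] continuous_intros assms)
  then show "f x = g x" by (simp add: \<iota>_diff assms)
qed

definition emb :: "('x \<Rightarrow> real) \<Rightarrow> 'a"
  where "emb k = \<iota> (\<lambda>x. complex_of_real (k x))"

lemma emb_add: "continuous_on UNIV k \<Longrightarrow> continuous_on UNIV l \<Longrightarrow> emb (\<lambda>x. k x + l x) = emb k + emb l"
  by (simp add: emb_def \<iota>_add continuous_intros)

lemma emb_diff: "continuous_on UNIV k \<Longrightarrow> continuous_on UNIV l \<Longrightarrow> emb (\<lambda>x. k x - l x) = emb k - emb l"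
  by (simp add: emb_def \<iota>_diff continuous_intros)

lemma emb_mult: "continuous_on UNIV k \<Longrightarrow> continuous_on UNIV l \<Longrightarrow> emb (\<lambda>x. k x * l x) = emb k * emb l"
  by (simp add: emb_def \<iota>_mult continuous_intros)

lemma emb_scaleR: "continuous_on UNIV k \<Longrightarrow> emb (\<lambda>x. c * k x) = c *\<^sub>R emb k"
  by (simp add: emb_def \<iota>_scale continuous_intros flip: scaleC_of_real)

lemma emb_one [simp]: "emb (\<lambda>x. 1) = 1"
  by (simp add: emb_def \<iota>_one)

lemma emb_zero: "emb (\<lambda>x. 0) = 0"
  using emb_scaleR[of "\<lambda>x. 1" 0] by simp

lemma star_emb [simp]: "continuous_on UNIV k \<Longrightarrow> star (emb k) = emb k"
  using \<iota>_cnj[of "\<lambda>x. complex_of_real (k x)"] by (simp add: emb_def continuous_intros)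

lemma self_adjoint_emb: "continuous_on UNIV k \<Longrightarrow> self_adjoint (emb k)"
  by (simp add: self_adjoint_def)

lemma norm_emb_le: "continuous_on UNIV k \<Longrightarrow> (\<And>x. \<bar>k x\<bar> \<le> c) \<Longrightarrow> norm (emb k) \<le> c"
  unfolding emb_def by (rule norm_\<iota>_le) (auto intro: continuous_intros)

text \<open>The spectrum is taken in the whole algebra, so an inverse of \<open>t - k\<close> need not be a function. For
  \<open>t\<close> in the range of \<open>k\<close>, a bump function at a point where \<open>k\<close> takes the value \<open>t\<close> excludes any inverse by its norm.\<close>

lemma rspec_emb:
  assumes k: "continuous_on UNIV k" shows "rspec (emb k) = range k"
proof (intro equalityI subsetI)
  fix t assume "t \<in> rspec (emb k)"
  then have nu: "\<not> unit_el (of_real t *\<^sub>C 1 - emb k)" by (simp add: rspec_def spectrum_unit_el)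
  show "t \<in> range k"
  proof (rule ccontr)
    assume "t \<notin> range k"
    then have nz: "t - k x \<noteq> 0" for x by auto
    let ?u = "\<lambda>x. t - k x" and ?v = "\<lambda>x. inverse (t - k x)"
    have c: "continuous_on UNIV ?u" "continuous_on UNIV ?v"
      using nz by (auto intro!: continuous_intros k)
    have "emb ?u * emb ?v = 1" "emb ?v * emb ?u = 1"
      using emb_mult[OF c] emb_mult[OF c(2,1)] nz by simp_all
    moreover have "emb ?u = of_real t *\<^sub>C 1 - emb k"
      using emb_diff[of "\<lambda>x. t * 1" k] emb_scaleR[of "\<lambda>x. 1" t] k by (simp add: scaleC_of_real)
    ultimately show False using nu by (auto simp: unit_el_def)
  qed
next
  fix t assume "t \<in> range k"
  then obtain x0 where x0: "t = k x0" by auto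
  show "t \<in> rspec (emb k)"
  proof (rule ccontr)
    assume "t \<notin> rspec (emb k)"
    then obtain c where c: "c * (of_real t *\<^sub>C 1 - emb k) = 1"
      by (auto simp: rspec_def spectrum_unit_el unit_el_def)
    define M where "M = norm c + 1"
    have M: "M > 0" by (simp add: M_def add_nonneg_pos)
    \<comment> \<open>a bump at \<open>x0\<close>, supported where \<open>t - k\<close> is too small for its inverse to have norm at most \<open>M\<close>\<close>
    define b where "b x = max 0 (1 - 2 * M * \<bar>t - k x\<bar>)" for x
    have cb: "continuous_on UNIV b" unfolding b_def by (intro continuous_intros k)
    have ctk: "continuous_on UNIV (\<lambda>x. t - k x)" by (intro continuous_intros k)
    have eq: "of_real t *\<^sub>C 1 - emb k = emb (\<lambda>x. t - k x)"
      using emb_diff[of "\<lambda>x. t * 1" k] emb_scaleR[of "\<lambda>x. 1" t] k by (simp add: scaleC_of_real)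
    have small: "\<bar>(t - k x) * b x\<bar> \<le> 1 / (2 * M)" for x
    proof (cases "\<bar>t - k x\<bar> \<le> 1 / (2 * M)")
      case True
      have "\<bar>b x\<bar> \<le> 1" using M by (simp add: b_def)
      then have "\<bar>t - k x\<bar> * \<bar>b x\<bar> \<le> 1 / (2 * M) * 1" using True M by (intro mult_mono) auto
      then show ?thesis by (simp add: abs_mult)
    next
      case False
      then have "b x = 0" using M by (simp add: b_def field_simps)
      then show ?thesis using M by simp
    qed
    have "emb b = c * (emb (\<lambda>x. t - k x) * emb b)" using c unfolding eq by (metis mult.assoc mult.left_neutral)
    also have "\<dots> = c * emb (\<lambda>x. (t - k x) * b x)" by (simp add: emb_mult ctk cb)
    finally have "norm (emb b) \<le> norm c * norm (emb (\<lambda>x. (t - k x) * b x))" by (metis norm_mult_ineq)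
    also have "\<dots> \<le> norm c * (1 / (2 * M))"
      by (intro mult_left_mono norm_emb_le small continuous_on_mult ctk cb) auto
    also have "\<dots> \<le> 1 / 2" using M by (simp add: M_def field_simps)
    finally have "norm (emb b) \<le> 1/2" .
    moreover have "cmod (of_real (b x0)) \<le> norm (emb b)"
      unfolding emb_def by (rule cmod_le_norm_\<iota>) (intro continuous_intros cb)
    moreover have "b x0 = 1" by (simp add: b_def x0)
    ultimately show False by simp
  qed
qed

lemma positive_emb:
  assumes k: "continuous_on UNIV k" and "\<And>x. 0 \<le> k x" shows "positive (emb k)"
proof -
  have "z \<in> \<real>\<^sub>\<ge>\<^sub>0" if z: "z \<in> spectrum (emb k)" for z
  proof -
    obtain t where t: "z = of_real t"
      using self_adjoint_spectrum_real[OF self_adjoint_emb[OF k] z] by (rule Reals_cases)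
    then have "t \<in> rspec (emb k)" using z by (simp add: rspec_def)
    then show ?thesis using assms(2) rspec_emb[OF k] t by auto
  qed
  then show ?thesis using self_adjoint_emb[OF k] by (auto simp: positive_def)
qed

lemma self_adjoint_\<iota>_eq_emb:
  assumes f: "continuous_on UNIV f" and sa: "self_adjoint (\<iota> f)"
  shows "\<iota> f = emb (\<lambda>x. Re (f x))"
proof -
  have "\<iota> (\<lambda>x. cnj (f x)) = \<iota> f" using sa by (simp add: \<iota>_cnj f self_adjoint_def)
  then have "(\<lambda>x. cnj (f x)) = f" by (intro \<iota>_injective continuous_intros f)
  then have "f x = of_real (Re (f x))" for x by (metis Reals_cnj_iff of_real_Re)
  then have "(\<lambda>x. complex_of_real (Re (f x))) = f" by (intro ext) simp
  then show ?thesis by (simp add: emb_def)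
qed

lemma peval_emb:
  assumes k: "continuous_on UNIV k" shows "peval (emb k) p = \<iota> (\<lambda>x. poly p (of_real (k x)))"
proof (induction p)
  case 0
  show ?case using \<iota>_scale[of "\<lambda>x. 0" 0] by simp
next
  case (pCons c p)
  have 1: "continuous_on UNIV (\<lambda>x. poly p (complex_of_real (k x)))"
    "continuous_on UNIV (\<lambda>x. complex_of_real (k x))" "continuous_on UNIV (\<lambda>x :: 'x. c * 1)"
    "continuous_on UNIV (\<lambda>x. complex_of_real (k x) * poly p (complex_of_real (k x)))"
    by (intro continuous_intros k)+
  have "\<iota> (\<lambda>x. c * 1) = c *\<^sub>C 1" using \<iota>_scale[of "\<lambda>x. 1" c] by (simp add: \<iota>_one)
  then show ?case
    using \<iota>_add[OF 1(3,4)] \<iota>_mult[OF 1(2,1)] pCons.IH by (simp add: emb_def)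
qed

lemma cfc_emb:
  assumes k: "continuous_on UNIV k" and f: "continuous_on (range k) f"
  shows "cfc f (emb k) = \<iota> (\<lambda>x. f (k x))"
proof -
  have cf: "continuous_on (rspec (emb k)) f" using f by (simp add: rspec_emb[OF k])
  obtain P where P: "uniform_limit (range k) (\<lambda>n t. poly (P n) (of_real t)) f sequentially"
    "(\<lambda>n. peval (emb k) (P n)) \<longlonglongrightarrow> cfc f (emb k)"
    using cfc_lim_cfc[OF self_adjoint_emb[OF k] cf] by (auto simp: cfc_lim_def rspec_emb[OF k])
  have fk: "continuous_on UNIV (\<lambda>x. f (k x))" using continuous_on_compose[OF k f] by (simp add: o_def)
  have "(\<lambda>n. peval (emb k) (P n)) \<longlonglongrightarrow> \<iota> (\<lambda>x. f (k x))"
  proof (rule metric_LIMSEQ_I)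
    fix e :: real assume e: "0 < e"
    have "eventually (\<lambda>n. \<forall>t\<in>range k. dist (poly (P n) (of_real t)) (f t) < e/2) sequentially"
      using P(1) half_gt_zero[OF e] unfolding uniform_limit_iff by blast
    then have "eventually (\<lambda>n. dist (peval (emb k) (P n)) (\<iota> (\<lambda>x. f (k x))) < e) sequentially"
    proof eventually_elim
      case (elim n)
      have pk: "continuous_on UNIV (\<lambda>x. poly (P n) (complex_of_real (k x)))" by (intro continuous_intros k)
      have "norm (\<iota> (\<lambda>x. poly (P n) (of_real (k x)) - f (k x))) \<le> e/2"
        using elim by (intro norm_\<iota>_le continuous_on_diff pk fk) (auto simp: dist_norm intro: less_imp_le)
      then show ?case using e by (simp add: peval_emb[OF k] dist_norm \<iota>_diff[OF pk fk])
    qed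
    then show "\<exists>no. \<forall>n\<ge>no. dist (peval (emb k) (P n)) (\<iota> (\<lambda>x. f (k x))) < e"
      by (simp add: eventually_sequentially)
  qed
  with P(2) show ?thesis using LIMSEQ_unique by blast
qed

lemma trnorm_\<iota>_square:
  assumes \<tau>: "\<tau> \<in> tracial_states" and f: "continuous_on UNIV f"
  shows "(trnorm \<tau> (\<iota> f))\<^sup>2 = Re (\<tau> (emb (\<lambda>x. (cmod (f x))\<^sup>2)))"
proof -
  have "star (\<iota> f) * \<iota> f = \<iota> (\<lambda>x. cnj (f x) * f x)"
    by (simp add: \<iota>_mult \<iota>_cnj f continuous_intros)
  also have "(\<lambda>x. cnj (f x) * f x) = (\<lambda>x. complex_of_real ((cmod (f x))\<^sup>2))"
    by (intro ext) (simp add: complex_norm_square mult.commute del: of_real_power)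
  finally show ?thesis by (simp add: trnorm_square[OF \<tau>] emb_def)
qed

lemma trace_emb_mono:
  assumes \<tau>: "\<tau> \<in> tracial_states" and k: "continuous_on UNIV k" and l: "continuous_on UNIV l"
    and "\<And>x. k x \<le> l x"
  shows "Re (\<tau> (emb k)) \<le> Re (\<tau> (emb l))"
proof -
  have "positive (emb (\<lambda>x. l x - k x))" using assms by (intro positive_emb continuous_intros) auto
  from trace_positive[OF \<tau> this] show ?thesis
    by (simp add: emb_diff k l trace_diff[OF \<tau>] complex_nonneg_Reals_iff)
qed

text \<open>Monotonicity of the seminorm in the modulus of a function is what makes pointwise inequalities usable
  in the estimates for approximate projections.\<close>

lemma trnorm_mono:
  assumes \<tau>: "\<tau> \<in> tracial_states" and f: "continuous_on UNIV f" and g: "continuous_on UNIV g"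
    and le: "\<And>x. cmod (f x) \<le> cmod (g x)"
  shows "trnorm \<tau> (\<iota> f) \<le> trnorm \<tau> (\<iota> g)"
proof (rule power2_le_imp_le)
  show "(trnorm \<tau> (\<iota> f))\<^sup>2 \<le> (trnorm \<tau> (\<iota> g))\<^sup>2"
    unfolding trnorm_\<iota>_square[OF \<tau> f] trnorm_\<iota>_square[OF \<tau> g]
    by (intro trace_emb_mono[OF \<tau>] continuous_intros f g power_mono le) auto
qed (rule trnorm_nonneg[OF \<tau>])

lemma trnorm_emb_mono:
  assumes \<tau>: "\<tau> \<in> tracial_states" and k: "continuous_on UNIV k" and l: "continuous_on UNIV l"
    and le: "\<And>x. \<bar>k x\<bar> \<le> \<bar>l x\<bar>"
  shows "trnorm \<tau> (emb k) \<le> trnorm \<tau> (emb l)"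
  unfolding emb_def using le by (intro trnorm_mono[OF \<tau>] continuous_intros k l) auto

lemma trace_emb_le_trnorm:
  assumes \<tau>: "\<tau> \<in> tracial_states" and k: "continuous_on UNIV k"
  shows "\<bar>Re (\<tau> (emb k))\<bar> \<le> trnorm \<tau> (emb k)"
  using cmod_trace_le_trnorm[OF \<tau>, of "emb k"] abs_Re_le_cmod[of "\<tau> (emb k)"] by linarith

text \<open>The roots of \<open>k\<close> increase with their order, so the limit that defines \<open>d_tau\<close> exists and
  dominates its first term. These two bounds replace the measure of \<open>{k > 0}\<close>, so that no representing measure
  of the trace has to be constructed.\<close>

lemma d_tau_emb:
  assumes \<tau>: "\<tau> \<in> tracial_states" and k: "continuous_on UNIV k" and k01: "\<And>x. 0 \<le> k x" "\<And>x. k x \<le> 1"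
  shows "Re (\<tau> (emb k)) \<le> d_tau \<tau> (emb k)"
    and "\<And>\<psi>. continuous_on UNIV \<psi> \<Longrightarrow> (\<And>x. 0 \<le> \<psi> x) \<Longrightarrow> (\<And>x. 0 < k x \<Longrightarrow> 1 \<le> \<psi> x) \<Longrightarrow>
      d_tau \<tau> (emb k) \<le> Re (\<tau> (emb \<psi>))"
proof -
  define a where "a n = Re (\<tau> (emb (\<lambda>x. root n (k x))))" for n
  have c: "continuous_on UNIV (\<lambda>x. root n (k x))" for n by (intro continuous_intros k)
  have "d_tau \<tau> (emb k) = lim a"
    unfolding d_tau_def a_def by (subst cfc_emb[OF k]) (auto simp: emb_def intro!: continuous_intros)
  moreover have le: "root n (k x) \<le> root m (k x)" if "n \<le> m" for n m x
    using real_root_increasing[of n m "k x"] that k01[of x] by (cases "n = 0"; cases "n = m") auto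
  then have "incseq a" unfolding incseq_def a_def by (auto intro!: trace_emb_mono[OF \<tau>] c)
  moreover have root1: "root n (k x) \<le> 1" for n x using k01[of x] by (cases "n = 0") auto
  then have "a n \<le> Re (\<tau> (emb (\<lambda>x. 1)))" for n
    unfolding a_def by (intro trace_emb_mono[OF \<tau>] c continuous_on_const)
  ultimately have lim: "a \<longlonglongrightarrow> d_tau \<tau> (emb k)" and upper: "a n \<le> d_tau \<tau> (emb k)" for n
    using incseq_convergent[of a "Re (\<tau> (emb (\<lambda>x. 1)))"] by (metis limI)+
  show "Re (\<tau> (emb k)) \<le> d_tau \<tau> (emb k)" using upper[of 1] by (simp add: a_def)
  fix \<psi> :: "'x \<Rightarrow> real" assume \<psi>: "continuous_on UNIV \<psi>" "\<And>x. 0 \<le> \<psi> x" "\<And>x. 0 < k x \<Longrightarrow> 1 \<le> \<psi> x"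
  have "root n (k x) \<le> \<psi> x" for n x
    using root1[of n x] \<psi>(2,3)[of x] k01(1)[of x] by (cases "k x = 0") force+
  then have "a n \<le> Re (\<tau> (emb \<psi>))" for n unfolding a_def by (intro trace_emb_mono[OF \<tau>] c \<psi>(1))
  then show "d_tau \<tau> (emb k) \<le> Re (\<tau> (emb \<psi>))" using lim by (intro LIMSEQ_le_const2[OF lim]) auto
qed

end

section \<open>Ramps, hereditary subalgebras and approximate projections\<close>

text \<open>The decreasing piecewise linear function that is \<open>1\<close> up to \<open>l\<close> and \<open>0\<close> from \<open>u\<close> on. Composed
  with \<open>f\<close>, it is a continuous approximation to the indicator of a sublevel set of \<open>f\<close>.\<close>

definition ramp :: "real \<Rightarrow> real \<Rightarrow> real \<Rightarrow> real"
  where "ramp l u s = max 0 (min 1 ((u - s) / (u - l)))"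

lemma continuous_on_ramp [continuous_intros]:
  "l < u \<Longrightarrow> continuous_on S k \<Longrightarrow> continuous_on S (\<lambda>x. ramp l u (k x))"
  unfolding ramp_def by (intro continuous_intros) auto

lemma ramp_nonneg [simp]: "0 \<le> ramp l u s" and ramp_le_1 [simp]: "ramp l u s \<le> 1"
  by (simp_all add: ramp_def)

lemma ramp_eq_1: "l < u \<Longrightarrow> s \<le> l \<Longrightarrow> ramp l u s = 1"
  by (simp add: ramp_def field_simps)

lemma ramp_eq_0: "l < u \<Longrightarrow> u \<le> s \<Longrightarrow> ramp l u s = 0"
  by (simp add: ramp_def divide_nonpos_pos)

lemma ramp_pos: "l < u \<Longrightarrow> s < u \<Longrightarrow> 0 < ramp l u s"
  by (simp add: ramp_def)

lemma ramp_less_1: "l < u \<Longrightarrow> l < s \<Longrightarrow> ramp l u s < 1"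
  by (simp add: ramp_def field_simps)

lemma continuous_on_chi [simp]: "continuous_on UNIV (chi d)" if "d > 0"
proof -
  have "chi d = (\<lambda>t. max 0 (min 1 (2 - \<bar>t\<bar> / d)))"
    using that by (intro ext) (auto simp: chi_def field_simps)
  then show ?thesis using that by (auto intro!: continuous_intros)
qed

lemma hereditary_left_unit:
  assumes "y \<in> hereditary g B" "r * g = (g :: 'a::unital_cstar_algebra)" shows "r * y = y"
proof -
  have "closed {y. r * y = y}" by (intro closed_Collect_eq continuous_intros)
  moreover have "(\<lambda>b. g * b * g) ` B \<subseteq> {y. r * y = y}"
    using assms(2) by (auto simp flip: mult.assoc)
  ultimately have "hereditary g B \<subseteq> {y. r * y = y}" unfolding hereditary_def by (intro closure_minimal)
  then show ?thesis using assms(1) by auto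
qed

lemma hereditary_right_zero:
  assumes "y \<in> hereditary g B" "g * m = (0 :: 'a::unital_cstar_algebra)" shows "y * m = 0"
proof -
  have "closed {y. y * m = 0}" by (intro closed_Collect_eq continuous_intros)
  moreover have "(\<lambda>b. g * b * g) ` B \<subseteq> {y. y * m = 0}"
    using assms(2) by (auto simp: mult.assoc)
  ultimately have "hereditary g B \<subseteq> {y. y * m = 0}" unfolding hereditary_def by (intro closure_minimal)
  then show ?thesis using assms(1) by auto
qed

lemma norm_mult_le_1:
  fixes x y :: "'a::real_normed_algebra_1"
  assumes "norm x \<le> 1" "norm y \<le> 1" shows "norm (x * y) \<le> 1"
  using norm_mult_ineq[of x y] mult_mono[OF assms] by simp

text \<open>The failure of \<open>e\<close> to be idempotent, measured in the seminorm, is stable under conjugation by an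
  approximate unitary and, by the next lemma, under small perturbations.\<close>

lemma trnorm_idempotent_conjugate:
  fixes e u :: "'a::unital_cstar_algebra"
  assumes \<tau>: "\<tau> \<in> tracial_states" and n: "norm e \<le> 1" "norm u \<le> 1"
  shows "trnorm \<tau> (u * e * star u * (u * e * star u) - u * e * star u) \<le>
    trnorm \<tau> (star u * u - 1) + trnorm \<tau> (e * e - e)"
proof -
  have "u * e * star u * (u * e * star u) - u * e * star u =
      (u * e) * (star u * u - 1) * (e * star u) + u * (e * e - e) * star u"
    by (simp add: algebra_simps)
  also have "trnorm \<tau> \<dots> \<le> trnorm \<tau> ((u * e) * (star u * u - 1) * (e * star u)) + trnorm \<tau> (u * (e * e - e) * star u)"
    by (rule trnorm_triangle[OF \<tau>])
  also have "\<dots> \<le> trnorm \<tau> (star u * u - 1) + trnorm \<tau> (e * e - e)"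
  proof (rule add_mono)
    have ue: "norm (u * e) \<le> 1" "norm (e * star u) \<le> 1" by (intro norm_mult_le_1; simp add: n)+
    show "trnorm \<tau> ((u * e) * (star u * u - 1) * (e * star u)) \<le> trnorm \<tau> (star u * u - 1)"
      using trnorm_contraction_right[OF \<tau> ue(2)] trnorm_contraction_left[OF \<tau> ue(1)] order_trans by blast
    have su: "norm (star u) \<le> 1" using n by simp
    show "trnorm \<tau> (u * (e * e - e) * star u) \<le> trnorm \<tau> (e * e - e)"
      using trnorm_contraction_right[OF \<tau> su] trnorm_contraction_left[OF \<tau> n(2)] order_trans by blast
  qed
  finally show ?thesis .
qed

lemma trnorm_idempotent_perturb:
  fixes q v :: "'a::unital_cstar_algebra"
  assumes \<tau>: "\<tau> \<in> tracial_states" and n: "norm q \<le> 1" "norm v \<le> 1" and c: "trnorm \<tau> (v - q) \<le> c"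
  shows "trnorm \<tau> (q * q - q) \<le> trnorm \<tau> (v * v - v) + 3 * c"
proof -
  have eq: "q * q - q = (v * v - v) + (q * (q - v) + ((q - v) * v + (v - q)))" by (simp add: algebra_simps)
  have "trnorm \<tau> (q * q - q) \<le>
      trnorm \<tau> (v * v - v) + (trnorm \<tau> (q * (q - v)) + (trnorm \<tau> ((q - v) * v) + trnorm \<tau> (v - q)))"
    using trnorm_triangle[OF \<tau>, of "v * v - v" "q * (q - v) + ((q - v) * v + (v - q))"]
      trnorm_triangle[OF \<tau>, of "q * (q - v)" "(q - v) * v + (v - q)"]
      trnorm_triangle[OF \<tau>, of "(q - v) * v" "v - q"] unfolding eq by linarith
  also have "\<dots> \<le> trnorm \<tau> (v * v - v) + (c + (c + c))"
    using trnorm_contraction_left[OF \<tau> n(1), of "q - v"] trnorm_contraction_right[OF \<tau> n(2), of "q - v"] c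
      trnorm_diff_commute[of \<tau> q v] by (intro add_mono) auto
  finally show ?thesis by simp
qed

text \<open>Property (E) concerns positive contractions, whereas Property (S) yields self-adjoint ones; the substitution
  \<open>s = (1 + t) / 2\<close> translates between them.\<close>

lemma affine_cfc:
  fixes g :: "'a::unital_cstar_algebra" and f :: "real \<Rightarrow> complex"
  assumes g: "self_adjoint g" "norm g \<le> 1" and f: "continuous_on {-1..1} f"
  defines "a \<equiv> (1/2) *\<^sub>R (1 + g)"
  shows "positive a" "norm a \<le> 1" "cfc (\<lambda>s. f (2 * s - 1)) a = cfc f g"
proof -
  have rg: "rspec g \<subseteq> {-1..1}" using rspec_bound[of _ g] g(2) by force
  have "norm (1 + g) \<le> 1 + 1" using norm_triangle_ineq[of 1 g] g(2) by simp
  then show na: "norm a \<le> 1" by (simp add: a_def)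
  have sa: "self_adjoint a" using g(1) by (simp add: a_def self_adjoint_def star_scaleR star_add)
  have ag: "a = peval g [:1/2, 1/2:]"
    by (simp add: a_def mult_scaleC_right scaleC_add_right flip: scaleC_of_real)
  have pos: "0 \<le> t" if t: "t \<in> rspec a" for t
  proof -
    have "complex_of_real t \<in> spectrum (peval g [:1/2, 1/2:])" using t unfolding rspec_def ag[symmetric] by simp
    then obtain s where "s \<in> rspec g" "complex_of_real t = poly [:1/2, 1/2:] (of_real s)"
      using spectrum_peval[OF g(1)] by blast
    then have s: "s \<ge> -1" and "complex_of_real t = of_real ((1 + s) / 2)"
      using rg by (auto simp: add_divide_distrib)
    then have "t = (1 + s) / 2" by (simp only: of_real_eq_iff)
    with s show ?thesis by simp
  qed
  have "z \<in> \<real>\<^sub>\<ge>\<^sub>0" if z: "z \<in> spectrum a" for z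
  proof -
    obtain t where "z = of_real t" using self_adjoint_spectrum_real[OF sa z] by (rule Reals_cases)
    then show ?thesis using pos[of t] z by (simp add: rspec_def)
  qed
  with sa show "positive a" by (auto simp: positive_def)
  have ra: "2 * t - 1 \<in> {-1..1}" if "t \<in> rspec a" for t using pos[OF that] rspec_bound[OF that] na by auto
  have ga: "peval a [:-1, 2:] = g"
    by (simp add: a_def mult_scaleC_right scaleC_minus_left scaleC_add_right flip: scaleC_of_real)
       (simp add: scaleC_scaleC)
  have cg: "continuous_on (rspec g) f" using f rg continuous_on_subset by blast
  have ca: "continuous_on (rspec a) (\<lambda>s. f (2 * s - 1))"
    by (rule continuous_on_compose2[OF f]) (use ra in \<open>auto intro!: continuous_intros\<close>)
  have "norm (cfc (\<lambda>s. f (2 * s - 1)) a - cfc f g) \<le> 0"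
  proof (rule field_le_epsilon)
    fix e :: real assume e: "0 < e"
    obtain p where p: "\<forall>t\<in>{-1..1}. cmod (f t - poly p (of_real t)) < e/2"
      using Weierstrass_complex_poly[OF _ f half_gt_zero[OF e]] by blast
    have 1: "norm (cfc f g - peval g p) \<le> e/2"
      using p rg by (intro norm_cfc_diff_peval_le[OF g(1) cg] less_imp_le) blast
    have "norm (cfc (\<lambda>s. f (2 * s - 1)) a - peval a (pcompose p [:-1, 2:])) \<le> e/2"
    proof (rule norm_cfc_diff_peval_le[OF sa ca])
      fix t assume "t \<in> rspec a"
      then have "cmod (f (2 * t - 1) - poly p (of_real (2 * t - 1))) < e/2" using p ra by blast
      moreover have "poly (pcompose p [:-1, 2:]) (of_real t) = poly p (complex_of_real (2 * t - 1))"
        by (simp add: poly_pcompose algebra_simps)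
      ultimately show "cmod (f (2 * t - 1) - poly (pcompose p [:-1, 2:]) (of_real t)) \<le> e/2" by simp
    qed
    then have 2: "norm (cfc (\<lambda>s. f (2 * s - 1)) a - peval g p) \<le> e/2" unfolding peval_pcompose ga .
    show "norm (cfc (\<lambda>s. f (2 * s - 1)) a - cfc f g) \<le> 0 + e"
      using norm_triangle_ineq4[of "cfc (\<lambda>s. f (2 * s - 1)) a - peval g p" "cfc f g - peval g p"] 1 2 by simp
  qed
  then show "cfc (\<lambda>s. f (2 * s - 1)) a = cfc f g" by simp
qed

context compact_C_embedding
begin

abbreviation Dset :: "'a set" where "Dset \<equiv> \<iota> ` {f. continuous_on UNIV f}"

lemma emb_in_Dset: "continuous_on UNIV k \<Longrightarrow> emb k \<in> Dset"
  unfolding emb_def by (intro imageI CollectI continuous_intros)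

lemma emb_in_unit_ball: "continuous_on UNIV k \<Longrightarrow> (\<And>x. \<bar>k x\<bar> \<le> 1) \<Longrightarrow> emb k \<in> unit_ball Dset"
  by (simp add: unit_ball_def emb_in_Dset norm_emb_le)

lemma unit_ball_nonempty: "unit_ball Dset \<noteq> {}"
  using emb_in_unit_ball[of "\<lambda>x. 0"] by auto

lemma unit_ball_function:
  assumes "d \<in> unit_ball Dset" obtains d' where "continuous_on UNIV d'" "\<And>x. cmod (d' x) \<le> 1" "d = \<iota> d'"
  using assms cmod_le_norm_\<iota> unfolding unit_ball_def by (fastforce intro: order_trans)

text \<open>As \<open>h\<close> is bounded below on the support of \<open>k\<close>, the function \<open>k / h\<^sup>2\<close> is continuous after
  truncating the denominator, and \<open>k\<close> is exactly of the form \<open>hbh\<close>.\<close>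

lemma emb_in_hereditary:
  assumes k: "continuous_on UNIV k" and h: "continuous_on UNIV h" and c: "c > 0"
    and supp: "\<And>x. k x \<noteq> 0 \<Longrightarrow> c \<le> h x"
  shows "emb k \<in> hereditary (emb h) Dset"
proof -
  define b where "b x = k x / (max (h x) c)\<^sup>2" for x
  have b: "continuous_on UNIV b" unfolding b_def using c by (intro continuous_intros k h) (auto simp: max_def)
  have "h x * b x * h x = k x" for x
    using supp[of x] c by (cases "k x = 0") (auto simp: b_def max_def power2_eq_square)
  then have "emb k = emb (\<lambda>x. h x * b x * h x)" by simp
  also have "\<dots> = emb h * emb b * emb h"
    by (subst emb_mult) (auto intro!: continuous_intros h b simp: emb_mult h b)
  finally have "emb k = emb h * emb b * emb h" .
  then show ?thesis unfolding hereditary_def using emb_in_Dset[OF b] closure_subset by fastforce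
qed

text \<open>Approximants in \<open>D\<close> of a self-adjoint element may be replaced by their real parts.\<close>

lemma trnorm_Re_le:
  assumes \<tau>: "\<tau> \<in> tracial_states" and d: "continuous_on UNIV d" and v: "self_adjoint v"
  shows "trnorm \<tau> (v - emb (\<lambda>x. Re (d x))) \<le> trnorm \<tau> (v - \<iota> d)"
proof -
  have "\<iota> d + star (\<iota> d) = \<iota> (\<lambda>x. d x + cnj (d x))" by (simp add: \<iota>_add \<iota>_cnj d continuous_intros)
  also have "(\<lambda>x. d x + cnj (d x)) = (\<lambda>x. complex_of_real (2 * Re (d x)))"
    by (simp add: complex_add_cnj)
  also have "\<iota> \<dots> = 2 *\<^sub>R emb (\<lambda>x. Re (d x))"
    using emb_scaleR[of "\<lambda>x. Re (d x)" 2] d by (simp add: emb_def continuous_intros)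
  finally have "emb (\<lambda>x. Re (d x)) = (1/2) *\<^sub>R (\<iota> d + star (\<iota> d))" by simp
  moreover have "star v = v" using v by (simp add: self_adjoint_def)
  moreover have "v = (1/2) *\<^sub>R (v + v)" by (simp flip: scaleR_2)
  ultimately have "v - emb (\<lambda>x. Re (d x)) = (1/2) *\<^sub>R 1 * ((v - \<iota> d) + star (v - \<iota> d))"
    by (simp add: star_diff algebra_simps)
  then have "trnorm \<tau> (v - emb (\<lambda>x. Re (d x))) \<le> norm ((1/2) *\<^sub>R (1::'a)) * trnorm \<tau> ((v - \<iota> d) + star (v - \<iota> d))"
    using trnorm_mult_left[OF \<tau>] by metis
  also have "\<dots> \<le> (1/2) * (trnorm \<tau> (v - \<iota> d) + trnorm \<tau> (v - \<iota> d))"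
    using trnorm_triangle[OF \<tau>, of "v - \<iota> d" "star (v - \<iota> d)"] by (simp add: trnorm_star[OF \<tau>])
  finally show ?thesis by simp
qed

text \<open>For \<open>0 \<le> k \<le> 1\<close> the trace of \<open>k\<close> dominates that of \<open>k\<^sup>2\<close>, which is a squared seminorm.\<close>

lemma emb_trace_lower_bound:
  assumes simple: "simple_cstar_algebra TYPE('a)" and k: "continuous_on UNIV k"
    and k01: "\<And>x. 0 \<le> k x" "\<And>x. k x \<le> 1" and nz: "k x0 \<noteq> 0"
  shows "\<exists>\<eta>>0. \<forall>\<tau>\<in>tracial_states. \<eta> \<le> Re (\<tau> (emb k))"
proof -
  have "cmod (of_real (k x0)) \<le> norm (emb k)"
    unfolding emb_def by (rule cmod_le_norm_\<iota>) (intro continuous_intros k)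
  then have "emb k \<noteq> 0" using nz by auto
  then obtain \<eta> where \<eta>: "\<eta> > 0" "\<And>\<tau>. \<tau> \<in> tracial_states \<Longrightarrow> \<eta> \<le> trnorm \<tau> (emb k)"
    using simple_trace_lower_bound[OF simple] by blast
  have "\<eta>\<^sup>2 \<le> Re (\<tau> (emb k))" if \<tau>: "\<tau> \<in> tracial_states" for \<tau>
  proof -
    have "\<eta>\<^sup>2 \<le> (trnorm \<tau> (emb k))\<^sup>2" using \<eta>(1) \<eta>(2)[OF \<tau>] by (intro power_mono) auto
    also have "\<dots> = Re (\<tau> (emb (\<lambda>x. (k x)\<^sup>2)))"
      using trnorm_\<iota>_square[OF \<tau>, of "\<lambda>x. of_real (k x)"] k by (simp add: emb_def continuous_intros)
    also have "\<dots> \<le> Re (\<tau> (emb k))"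
      using k01 by (intro trace_emb_mono[OF \<tau>] continuous_intros k)
        (auto simp: power2_eq_square mult_left_le_one_le)
    finally show ?thesis .
  qed
  then show ?thesis using \<eta>(1) by (intro exI[of _ "\<eta>\<^sup>2"]) auto
qed


text \<open>Property (S) moves \<open>f\<close> by a small amount in the trace seminorm to some \<open>g\<close> in the algebra with little mass near \<open>0\<close>,
  and Property (E) finds a function \<open>\<beta>\<close> with the distribution of \<open>g\<close>. The test functions in \<open>F\<close> are
  approximated by polynomials before \<open>g\<close> is chosen, because the Lipschitz constants of these
  polynomials decide how close \<open>g\<close> has to be to \<open>f\<close>.\<close>

lemma same_distribution_function:
  assumes S: "property_S TYPE('a)" and E: "property_E Dset"
    and f: "continuous_on UNIV f" "\<And>x. \<bar>f x\<bar> \<le> 1"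
    and F: "finite F" "\<And>\<phi>. \<phi> \<in> F \<Longrightarrow> continuous_on UNIV \<phi>" and \<eta>: "\<eta> > 0"
  shows "\<exists>\<beta> \<delta>. continuous_on UNIV \<beta> \<and> \<delta> > 0 \<and>
    (\<forall>\<tau>\<in>tracial_states. Re (\<tau> (emb (\<lambda>x. chi \<delta> (\<beta> x)))) < \<eta>) \<and>
    (\<forall>\<phi>\<in>F. \<forall>\<tau>\<in>tracial_states. \<bar>Re (\<tau> (emb (\<lambda>x. \<phi> (\<beta> x)))) - Re (\<tau> (emb (\<lambda>x. \<phi> (f x))))\<bar> < \<eta>)"
proof -
  have cof: "continuous_on T (\<lambda>s. complex_of_real (\<phi> s))" if "continuous_on UNIV \<phi>" for T and \<phi> :: "real \<Rightarrow> real"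
    using that by (intro continuous_intros continuous_on_subset[OF that]) auto
  have e8: "\<eta> / 8 > 0" using \<eta> by simp
  have "\<forall>\<phi>\<in>F. \<exists>p. \<forall>t\<in>{-1..1}. cmod (of_real (\<phi> t) - poly p (of_real t)) < \<eta> / 8"
    using Weierstrass_complex_poly[OF _ cof e8, of "{-1..1}"] F(2) by blast
  from bchoice[OF this] obtain P
    where P: "\<And>\<phi> t. \<phi> \<in> F \<Longrightarrow> t \<in> {-1..1} \<Longrightarrow> cmod (of_real (\<phi> t) - poly (P \<phi>) (of_real t)) < \<eta> / 8"
    by blast
  have "\<forall>\<phi>. \<exists>L\<ge>0. \<forall>\<tau>\<in>tracial_states. \<forall>a b :: 'a. norm a \<le> 1 \<longrightarrow> norm b \<le> 1 \<longrightarrow>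
     trnorm \<tau> (peval a (P \<phi>) - peval b (P \<phi>)) \<le> L * trnorm \<tau> (a - b)"
    using peval_trace_Lipschitz by blast
  from choice[OF this] obtain L where L0: "\<And>\<phi>. L \<phi> \<ge> 0" and
    L: "\<And>\<phi> \<tau> (a::'a) b. \<tau> \<in> tracial_states \<Longrightarrow> norm a \<le> 1 \<Longrightarrow> norm b \<le> 1 \<Longrightarrow>
     trnorm \<tau> (peval a (P \<phi>) - peval b (P \<phi>)) \<le> L \<phi> * trnorm \<tau> (a - b)"
    by blast
  define M where "M = 1 + (\<Sum>\<phi>\<in>F. L \<phi>)"
  have M1: "M \<ge> 1" using sum_nonneg[of F L] L0 by (simp add: M_def)
  have LM: "L \<phi> \<le> M" if "\<phi> \<in> F" for \<phi>
    using member_le_sum[of \<phi> F L] that L0 F(1) by (simp add: M_def)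
  note M = M1 LM
  define \<epsilon> where "\<epsilon> = \<eta> / (8 * M)"
  have \<epsilon>: "\<epsilon> > 0" "\<epsilon> \<le> \<eta> / 8" "M * \<epsilon> = \<eta> / 8"
    using \<eta> M(1) by (auto simp: \<epsilon>_def field_simps)
  have nf: "norm (emb f) \<le> 1" using f by (intro norm_emb_le)
  have "\<exists>g. self_adjoint g \<and> norm g \<le> 1 \<and> tnorm (emb f - g) < \<epsilon> \<and>
      (\<exists>\<delta>>0. \<forall>\<tau>\<in>tracial_states. Re (\<tau> (cfc (\<lambda>t. complex_of_real (chi \<delta> t)) g)) < \<epsilon>)"
    using S self_adjoint_emb[OF f(1)] nf \<epsilon>(1) unfolding property_S_def contraction_def by blast
  then obtain g \<delta> where g: "self_adjoint g" "norm g \<le> 1" "tnorm (emb f - g) < \<epsilon>" and \<delta>: "\<delta> > 0"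
    and chi: "\<And>\<tau>. \<tau> \<in> tracial_states \<Longrightarrow> Re (\<tau> (cfc (\<lambda>t. complex_of_real (chi \<delta> t)) g)) < \<epsilon>"
    by blast
  define a where "a = (1/2) *\<^sub>R (1 + g)"
  define G where "G = insert (chi \<delta>) F"
  have G: "continuous_on UNIV \<phi>" if "\<phi> \<in> G" for \<phi> using that F(2) \<delta> by (auto simp: G_def)
  have a: "positive a" "norm a \<le> 1"
    using affine_cfc(1,2)[OF g(1,2), of "\<lambda>_. 0"] by (auto simp: a_def)
  have cfca: "cfc (\<lambda>s. complex_of_real (\<phi> (2 * s - 1))) a = cfc (\<lambda>s. complex_of_real (\<phi> s)) g" if "\<phi> \<in> G" for \<phi>
    unfolding a_def by (rule affine_cfc(3)[OF g(1,2) cof[OF G[OF that]]])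
  let ?aff = "\<lambda>\<phi> s. complex_of_real (\<phi> (2 * s - 1))"
  have E': "\<exists>b\<in>Dset. positive b \<and> contraction b \<and>
      (\<forall>f\<in>H. \<forall>\<tau>\<in>tracial_states. cmod (\<tau> (cfc f a) - \<tau> (cfc f b)) < \<eta> / 8)"
    if "finite H" "\<forall>f\<in>H. continuous_on {0..1} f" for H
  proof -
    have "positive a \<and> contraction a" using a by (simp add: contraction_def)
    from mp[OF spec[OF mp[OF spec[OF E[unfolded property_E_def]] this]] conjI[OF that]]
    have "\<forall>\<epsilon>>0. \<exists>b\<in>Dset. positive b \<and> contraction b \<and>
      (\<forall>f\<in>H. \<forall>\<tau>\<in>tracial_states. cmod (\<tau> (cfc f a) - \<tau> (cfc f b)) < \<epsilon>)" .
    from spec[OF this, of "\<eta> / 8"] e8 show ?thesis by (rule mp)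
  qed
  have "finite (?aff ` G)" using F(1) by (simp add: G_def)
  moreover have caff: "continuous_on T (?aff \<phi>)" if "\<phi> \<in> G" for \<phi> T
    by (rule continuous_on_compose2[OF cof[OF G[OF that], of UNIV]]) (auto intro!: continuous_intros)
  ultimately have "\<exists>b\<in>Dset. positive b \<and> contraction b \<and>
      (\<forall>f\<in>?aff ` G. \<forall>\<tau>\<in>tracial_states. cmod (\<tau> (cfc f a) - \<tau> (cfc f b)) < \<eta> / 8)"
    by (intro E') auto
  then obtain b where b: "b \<in> Dset" "positive b" "norm b \<le> 1"
    and bH: "\<forall>f\<in>?aff ` G. \<forall>\<tau>\<in>tracial_states. cmod (\<tau> (cfc f a) - \<tau> (cfc f b)) < \<eta> / 8"
    unfolding contraction_def by blast
  have bG: "cmod (\<tau> (cfc (?aff \<phi>) a) - \<tau> (cfc (?aff \<phi>) b)) < \<eta> / 8"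
    if "\<phi> \<in> G" "\<tau> \<in> tracial_states" for \<phi> \<tau>
    using bH[THEN bspec, OF imageI[OF that(1)], THEN bspec, OF that(2)] .
  obtain b' where b': "continuous_on UNIV b'" "b = \<iota> b'" using b(1) by blast
  define k where "k x = Re (b' x)" for x
  have k: "continuous_on UNIV k" unfolding k_def by (intro continuous_intros b')
  have bk: "b = emb k"
    using self_adjoint_\<iota>_eq_emb[OF b'(1)] b(2) unfolding b'(2) k_def positive_def by blast
  define \<beta> where "\<beta> x = 2 * k x - 1" for x
  have \<beta>: "continuous_on UNIV \<beta>" unfolding \<beta>_def by (intro continuous_intros k)
  have cfcb: "cfc (?aff \<phi>) b = emb (\<lambda>x. \<phi> (\<beta> x))" if "\<phi> \<in> G" for \<phi>
    unfolding bk by (subst cfc_emb[OF k caff[OF that]]) (simp add: emb_def \<beta>_def)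
  have close: "cmod (\<tau> (cfc (\<lambda>s. complex_of_real (\<phi> s)) g) - \<tau> (emb (\<lambda>x. \<phi> (\<beta> x)))) < \<eta> / 8"
    if "\<phi> \<in> G" "\<tau> \<in> tracial_states" for \<phi> \<tau>
    using bG[OF that] by (simp add: cfca cfcb that)
  have 1: "Re (\<tau> (emb (\<lambda>x. chi \<delta> (\<beta> x)))) < \<eta>" if \<tau>: "\<tau> \<in> tracial_states" for \<tau>
    using chi[OF \<tau>] close[OF _ \<tau>, of "chi \<delta>"] \<epsilon>(2) \<eta>
      abs_Re_le_cmod[of "\<tau> (cfc (\<lambda>s. complex_of_real (chi \<delta> s)) g) - \<tau> (emb (\<lambda>x. chi \<delta> (\<beta> x)))"]
    by (simp add: G_def)
  have 2: "\<bar>Re (\<tau> (emb (\<lambda>x. \<phi> (\<beta> x)))) - Re (\<tau> (emb (\<lambda>x. \<phi> (f x))))\<bar> < \<eta>"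
    if \<phi>: "\<phi> \<in> F" and \<tau>: "\<tau> \<in> tracial_states" for \<phi> \<tau>
  proof -
    have dist: "cmod (\<tau> x - \<tau> y) \<le> norm (x - y)" for x y
      using cmod_trace_le_trnorm[OF \<tau>, of "x - y"] trnorm_le_norm[OF \<tau>, of "x - y"] by (simp add: trace_diff[OF \<tau>])
    let ?g = "cfc (\<lambda>s. complex_of_real (\<phi> s)) g" and ?pg = "peval g (P \<phi>)" and ?pf = "peval (emb f) (P \<phi>)"
    have "norm (?g - ?pg) \<le> \<eta> / 8"
    proof (rule norm_cfc_diff_peval_le[OF g(1) cof[OF F(2)[OF \<phi>]]])
      fix t assume "t \<in> rspec g"
      then have "t \<in> {-1..1}" using rspec_bound[of t g] g(2) by auto
      then show "cmod (of_real (\<phi> t) - poly (P \<phi>) (of_real t)) \<le> \<eta> / 8" using P[OF \<phi>] less_imp_le by blast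
    qed
    then have 1: "cmod (\<tau> ?g - \<tau> ?pg) \<le> \<eta> / 8" using dist order_trans by blast
    have "cmod (\<tau> ?pg - \<tau> ?pf) \<le> trnorm \<tau> (?pg - ?pf)"
      using cmod_trace_le_trnorm[OF \<tau>, of "?pg - ?pf"] by (simp add: trace_diff[OF \<tau>])
    also have "\<dots> \<le> L \<phi> * trnorm \<tau> (g - emb f)" by (rule L[OF \<tau> g(2) nf])
    also have "\<dots> \<le> M * \<epsilon>"
      using M(2)[OF \<phi>] M(1) trnorm_le_tnorm[OF \<tau>, of "emb f - g"] g(3) trnorm_nonneg[OF \<tau>]
      by (intro mult_mono) (auto simp: trnorm_diff_commute[of \<tau> g])
    finally have 2: "cmod (\<tau> ?pg - \<tau> ?pf) \<le> \<eta> / 8" by (simp add: \<epsilon>(3))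
    have pc: "continuous_on UNIV (\<lambda>x. poly (P \<phi>) (complex_of_real (f x)))"
      "continuous_on UNIV (\<lambda>x. complex_of_real (\<phi> (f x)))"
      using continuous_on_compose2[OF cof[OF F(2)[OF \<phi>], of UNIV] f(1)]
      by (auto intro!: continuous_intros f(1))
    have "?pf - emb (\<lambda>x. \<phi> (f x)) = \<iota> (\<lambda>x. poly (P \<phi>) (of_real (f x)) - of_real (\<phi> (f x)))"
      unfolding peval_emb[OF f(1)] \<iota>_diff[OF pc] by (simp add: emb_def)
    also have "norm \<dots> \<le> \<eta> / 8"
    proof (intro norm_\<iota>_le continuous_on_diff pc)
      fix x
      have "f x \<in> {-1..1}" using f(2)[of x] by auto
      then show "cmod (poly (P \<phi>) (of_real (f x)) - of_real (\<phi> (f x))) \<le> \<eta> / 8"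
        using P[OF \<phi>, of "f x"] by (simp add: norm_minus_commute)
    qed
    finally have 3: "cmod (\<tau> ?pf - \<tau> (emb (\<lambda>x. \<phi> (f x)))) \<le> \<eta> / 8" using dist order_trans by blast
    have 4: "cmod (\<tau> ?g - \<tau> (emb (\<lambda>x. \<phi> (\<beta> x)))) < \<eta> / 8" using close[OF _ \<tau>] \<phi> by (simp add: G_def)
    have "Re (\<tau> (emb (\<lambda>x. \<phi> (\<beta> x)))) - Re (\<tau> (emb (\<lambda>x. \<phi> (f x)))) =
       Re (\<tau> ?g - \<tau> ?pg) + Re (\<tau> ?pg - \<tau> ?pf) + Re (\<tau> ?pf - \<tau> (emb (\<lambda>x. \<phi> (f x)))) -
       Re (\<tau> ?g - \<tau> (emb (\<lambda>x. \<phi> (\<beta> x))))" by simp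
    then show ?thesis using 1 2 3 4 \<eta>
        abs_Re_le_cmod[of "\<tau> ?g - \<tau> ?pg"] abs_Re_le_cmod[of "\<tau> ?pg - \<tau> ?pf"]
        abs_Re_le_cmod[of "\<tau> ?pf - \<tau> (emb (\<lambda>x. \<phi> (f x)))"]
        abs_Re_le_cmod[of "\<tau> ?g - \<tau> (emb (\<lambda>x. \<phi> (\<beta> x)))"] by linarith
  qed
  show ?thesis using \<beta> \<delta> 1 2 by blast
qed


section \<open>Moving sublevel sets with Property (C)\<close>

lemma tdist_unit_ballD:
  assumes "tdist a (unit_ball Dset) < \<epsilon>"
  obtains d where "continuous_on UNIV d" "\<And>x. cmod (d x) \<le> 1" "tnorm (a - \<iota> d) < \<epsilon>"
proof -
  obtain s where "s \<in> unit_ball Dset" "tnorm (a - s) < \<epsilon>"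
    using tdist_lessD[OF assms unit_ball_nonempty] by blast
  then show ?thesis using unit_ball_function that by metis
qed

lemma property_CD:
  assumes C: "property_C Dset"
    and f: "continuous_on UNIV f" "\<And>x. 0 \<le> f x" "\<And>x. f x \<le> 1"
    and g: "continuous_on UNIV g" "\<And>x. 0 \<le> g x" "\<And>x. g x \<le> 1"
    and h: "continuous_on UNIV h" "\<And>x. 0 \<le> h x" "\<And>x. h x \<le> 1"
    and supp: "c > 0" "\<And>x. f x \<noteq> 0 \<Longrightarrow> c \<le> h x" "\<And>x. g x \<noteq> 0 \<Longrightarrow> c \<le> h x"
    and less: "\<And>\<tau>. \<tau> \<in> tracial_states \<Longrightarrow> d_tau \<tau> (emb f) < d_tau \<tau> (emb g)"
    and \<epsilon>: "\<epsilon> > 0"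
  shows "\<exists>u x z y. norm u \<le> 1 \<and> x \<in> hereditary (emb h) UNIV \<and> u = x + z *\<^sub>C 1 \<and>
    y \<in> hereditary (emb g) UNIV \<and> tnorm (u * emb f * star u - y) < \<epsilon> \<and>
    (\<forall>d\<in>unit_ball Dset. tdist (u * d * star u) (unit_ball Dset) < \<epsilon> \<and>
      tdist (star u * d * u) (unit_ball Dset) < \<epsilon>) \<and>
    tnorm (u * star u - 1) < \<epsilon> \<and> tnorm (star u * u - 1) < \<epsilon>"
proof -
  have contr: "contraction (emb k)" if "continuous_on UNIV k" "\<And>x. 0 \<le> k x" "\<And>x. k x \<le> 1" for k
    unfolding contraction_def using that by (intro norm_emb_le) auto
  have prem: "positive (emb f) \<and> contraction (emb f) \<and> positive (emb g) \<and> contraction (emb g) \<and>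
      positive (emb h) \<and> contraction (emb h) \<and> emb f \<in> hereditary (emb h) Dset \<and>
      emb g \<in> hereditary (emb h) Dset \<and> (\<forall>\<tau>\<in>tracial_states. d_tau \<tau> (emb f) < d_tau \<tau> (emb g))"
    using positive_emb[OF f(1,2)] contr[OF f] positive_emb[OF g(1,2)] contr[OF g]
      positive_emb[OF h(1,2)] contr[OF h] emb_in_hereditary[OF f(1) h(1) supp(1,2)]
      emb_in_hereditary[OF g(1) h(1) supp(1,3)] less by blast
  note C' = C[unfolded property_C_def, THEN bspec, OF emb_in_Dset[OF f(1)], THEN bspec, OF emb_in_Dset[OF g(1)],
      THEN bspec, OF emb_in_Dset[OF h(1)]]
  from mp[OF C' prem] have "\<forall>\<epsilon>>0. \<exists>u. contraction u \<and> (\<exists>x\<in>hereditary (emb h) UNIV. \<exists>c. u = x + c *\<^sub>C 1) \<and>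
         (\<exists>y\<in>hereditary (emb g) UNIV. tnorm (u * emb f * star u - y) < \<epsilon>) \<and>
         (\<forall>d\<in>unit_ball Dset. tdist (u * d * star u) (unit_ball Dset) < \<epsilon> \<and>
                          tdist (star u * d * u) (unit_ball Dset) < \<epsilon>) \<and>
         tnorm (u * star u - 1) < \<epsilon> \<and> tnorm (star u * u - 1) < \<epsilon>" .
  from spec[OF this, of \<epsilon>] \<epsilon> have "\<exists>u. contraction u \<and> (\<exists>x\<in>hereditary (emb h) UNIV. \<exists>c. u = x + c *\<^sub>C 1) \<and>
         (\<exists>y\<in>hereditary (emb g) UNIV. tnorm (u * emb f * star u - y) < \<epsilon>) \<and>
         (\<forall>d\<in>unit_ball Dset. tdist (u * d * star u) (unit_ball Dset) < \<epsilon> \<and>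
                          tdist (star u * d * u) (unit_ball Dset) < \<epsilon>) \<and>
         tnorm (u * star u - 1) < \<epsilon> \<and> tnorm (star u * u - 1) < \<epsilon>" by (rule mp)
  then show ?thesis unfolding contraction_def by blast
qed

text \<open>The function \<open>e\<close> is a ramp of \<open>\<beta>\<close> so steep that \<open>e\<^sup>2 - e\<close> vanishes off the set where \<open>\<beta>\<close> has little mass; it
  stands for \<open>{\<beta> < 0}\<close>. Since \<open>\<beta>\<close> and \<open>f\<close> have almost the same distribution, \<open>e\<close> is smaller in
  trace than \<open>{f < 2t}\<close>, with the room provided by \<open>gap\<close>. Property (C), with the unit in the
  role of \<open>h\<close>, conjugates \<open>e\<close> to an element \<open>v\<close> that is close both to the hereditary
  subalgebra of \<open>{f < 3t}\<close> and to some \<open>d \<in> D\<close>. Multiplying \<open>d\<close> by a cut-off in \<open>f\<close> makes the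
  support condition exact and changes \<open>d\<close> little.\<close>

lemma first_comparison:
  assumes C: "property_C Dset" and S: "property_S TYPE('a)" and E: "property_E Dset"
    and f: "continuous_on UNIV f" "\<And>x. \<bar>f x\<bar> \<le> 1" and t: "t > 0" and \<eta>: "\<eta> > 0" and \<zeta>: "\<zeta> > 0"
    and gap: "\<forall>\<tau>\<in>tracial_states. \<eta> \<le> Re (\<tau> (emb (\<lambda>x. ramp t (2*t) (f x) - ramp 0 t (f x))))"
  shows "\<exists>q. continuous_on UNIV q \<and> (\<forall>x. \<bar>q x\<bar> \<le> ramp (3*t) (4*t) (f x)) \<and>
    (\<forall>\<tau>\<in>tracial_states. trnorm \<tau> (emb q * emb q - emb q) \<le> \<zeta> \<and>
      Re (\<tau> (emb (\<lambda>x. ramp (-2*t) (-t) (f x)))) - \<zeta> \<le> Re (\<tau> (emb q)))"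
proof -
  define \<kappa> where "\<kappa> = min (\<eta>/2) (min (\<zeta>/20) ((\<zeta>/2)\<^sup>2))"
  have \<kappa>: "\<kappa> > 0" "\<kappa> \<le> \<eta>/2" "\<kappa> \<le> \<zeta>/20" "\<kappa> \<le> (\<zeta>/2)\<^sup>2"
    using \<eta> \<zeta> by (auto simp: \<kappa>_def min_def)
  have sk: "sqrt \<kappa> \<le> \<zeta>/2" using \<kappa>(4) \<zeta> by (intro real_le_lsqrt) auto
  define F where "F = {ramp 0 t, ramp (-2*t) (-t)}"
  have F: "finite F" "\<And>\<phi>. \<phi> \<in> F \<Longrightarrow> continuous_on UNIV \<phi>"
    using t continuous_on_ramp[OF _ continuous_on_id] by (auto simp: F_def)
  obtain \<beta> \<delta>0 where \<beta>: "continuous_on UNIV \<beta>" and \<delta>0: "\<delta>0 > 0"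
    and chi: "\<And>\<tau>. \<tau> \<in> tracial_states \<Longrightarrow> Re (\<tau> (emb (\<lambda>x. chi \<delta>0 (\<beta> x)))) < \<kappa>"
    and FF: "\<And>\<phi> \<tau>. \<phi> \<in> F \<Longrightarrow> \<tau> \<in> tracial_states \<Longrightarrow>
      \<bar>Re (\<tau> (emb (\<lambda>x. \<phi> (\<beta> x)))) - Re (\<tau> (emb (\<lambda>x. \<phi> (f x))))\<bar> < \<kappa>"
    using same_distribution_function[OF S E f F \<kappa>(1)] by blast
  define \<delta> where "\<delta> = min \<delta>0 t"
  have \<delta>: "\<delta> > 0" "\<delta> \<le> \<delta>0" "\<delta> \<le> t" using \<delta>0 t by (auto simp: \<delta>_def)
  define e where "e x = ramp (-\<delta>) 0 (\<beta> x)" for x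
  have ce: "continuous_on UNIV e" unfolding e_def using \<delta> by (intro continuous_intros \<beta>) auto
  define g where "g x = ramp (2*t) (3*t) (f x)" for x
  have cg: "continuous_on UNIV g" unfolding g_def using t by (intro continuous_intros f) auto
  define h where "h x = ramp (3*t) (4*t) (f x)" for x
  have ch: "continuous_on UNIV h" unfolding h_def using t by (intro continuous_intros f) auto
  have cr: "continuous_on UNIV (\<lambda>x. ramp l u (k x))" if "l < u" "continuous_on UNIV k" for l u and k :: "'x \<Rightarrow> real"
    using that by (rule continuous_on_ramp)
  have b: "\<And>x. 0 \<le> e x" "\<And>x. e x \<le> 1" "\<And>x. 0 \<le> g x" "\<And>x. g x \<le> 1"
    by (simp_all add: e_def g_def)
  have less: "d_tau \<tau> (emb e) < d_tau \<tau> (emb g)" if \<tau>: "\<tau> \<in> tracial_states" for \<tau>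
  proof -
    have "d_tau \<tau> (emb e) \<le> Re (\<tau> (emb (\<lambda>x. ramp 0 t (\<beta> x))))"
    proof (rule d_tau_emb(2)[OF \<tau> ce])
      fix x assume "0 < e x"
      then have "\<beta> x < 0" using ramp_eq_0[of "-\<delta>" 0 "\<beta> x"] \<delta> unfolding e_def by (cases "\<beta> x < 0") auto
      then show "1 \<le> ramp 0 t (\<beta> x)" using ramp_eq_1[of 0 t "\<beta> x"] t by simp
    qed (auto simp: e_def intro: cr t \<beta>)
    also have "\<dots> < Re (\<tau> (emb (\<lambda>x. ramp 0 t (f x)))) + \<kappa>"
      using FF[OF _ \<tau>, of "ramp 0 t"] by (simp add: F_def)
    also have "\<dots> \<le> Re (\<tau> (emb (\<lambda>x. ramp t (2*t) (f x))))"
    proof -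
      have "emb (\<lambda>x. ramp t (2*t) (f x) - ramp 0 t (f x)) =
          emb (\<lambda>x. ramp t (2*t) (f x)) - emb (\<lambda>x. ramp 0 t (f x))"
        using t f by (intro emb_diff cr) auto
      then show ?thesis using bspec[OF gap \<tau>] \<kappa> by (simp add: trace_diff[OF \<tau>])
    qed
    also have "\<dots> \<le> Re (\<tau> (emb g))"
    proof (rule trace_emb_mono[OF \<tau> _ cg])
      show "ramp t (2*t) (f x) \<le> g x" for x
        using ramp_eq_1[of "2*t" "3*t" "f x"] ramp_eq_0[of t "2*t" "f x"] t
        by (cases "f x \<le> 2*t") (auto simp: g_def)
    qed (use t f in \<open>auto intro: cr\<close>)
    also have "\<dots> \<le> d_tau \<tau> (emb g)" by (rule d_tau_emb(1)[OF \<tau> cg]) (auto simp: g_def)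
    finally show ?thesis .
  qed
  obtain u x z y where u: "norm u \<le> 1" and y: "y \<in> hereditary (emb g) UNIV" "tnorm (u * emb e * star u - y) < \<kappa>"
    and D: "\<And>d. d \<in> unit_ball Dset \<Longrightarrow> tdist (u * d * star u) (unit_ball Dset) < \<kappa>"
    and uu: "tnorm (star u * u - 1) < \<kappa>"
    using property_CD[OF C ce b(1,2) cg b(3,4) continuous_on_const zero_le_one order_refl
        zero_less_one order_refl order_refl less \<kappa>(1)] by blast
  define v where "v = u * emb e * star u"
  have nE: "norm (emb e) \<le> 1" using ce by (intro norm_emb_le) (auto simp: e_def)
  have nv: "norm v \<le> 1" unfolding v_def by (intro norm_mult_le_1) (auto simp: u nE)
  have sv: "self_adjoint v" by (simp add: v_def self_adjoint_def star_mult star_star ce mult.assoc)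
  have "emb e \<in> unit_ball Dset" by (rule emb_in_unit_ball[OF ce]) (simp add: e_def)
  from tdist_unit_ballD[OF D[OF this]] obtain d
    where d: "continuous_on UNIV d" "\<And>x. cmod (d x) \<le> 1" "tnorm (v - \<iota> d) < \<kappa>" unfolding v_def by blast
  define q where "q x = Re (of_real (h x) * d x)" for x
  have chd: "continuous_on UNIV (\<lambda>x. of_real (h x) * d x)" by (intro continuous_intros ch d)
  have cq: "continuous_on UNIV q" unfolding q_def by (intro continuous_intros chd)
  have qh: "\<bar>q x\<bar> \<le> h x" for x
  proof -
    have "\<bar>q x\<bar> = h x * \<bar>Re (d x)\<bar>" by (simp add: q_def abs_mult h_def)
    also have "\<dots> \<le> h x * 1"
      using d(2)[of x] abs_Re_le_cmod[of "d x"] by (intro mult_left_mono) (auto simp: h_def)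
    finally show ?thesis by simp
  qed
  have nh: "norm (emb h) \<le> 1" using ch by (intro norm_emb_le) (auto simp: h_def)
  have h1: "h x \<le> 1" for x by (simp add: h_def)
  have nq: "norm (emb q) \<le> 1" by (intro norm_emb_le cq order_trans[OF qh h1])
  have hg: "emb h * emb g = emb g"
  proof -
    have "h x * g x = g x" for x
      using ramp_eq_1[of "3*t" "4*t" "f x"] ramp_eq_0[of "2*t" "3*t" "f x"] t
      by (cases "f x \<le> 3*t") (auto simp: h_def g_def)
    then have eq: "(\<lambda>x. h x * g x) = g" by (rule ext)
    show ?thesis using emb_mult[OF ch cg] unfolding eq by simp
  qed
  have hy: "emb h * y = y" by (rule hereditary_left_unit[OF y(1) hg])
  have main: "trnorm \<tau> (emb q * emb q - emb q) \<le> \<zeta> \<and>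
      Re (\<tau> (emb (\<lambda>x. ramp (-2*t) (-t) (f x)))) - \<zeta> \<le> Re (\<tau> (emb q))" if \<tau>: "\<tau> \<in> tracial_states" for \<tau>
  proof -
    note tn = trnorm_le_tnorm[OF \<tau>]
    have vy: "trnorm \<tau> (v - y) \<le> \<kappa>" using tn[of "v - y"] y(2) by (simp add: v_def)
    have vd: "trnorm \<tau> (v - \<iota> d) \<le> \<kappa>" using tn[of "v - \<iota> d"] d(3) by simp
    have uu': "trnorm \<tau> (star u * u - 1) \<le> \<kappa>" using tn[of "star u * u - 1"] uu by simp
    have eq: "v - emb h * \<iota> d = (v - y) + (emb h * (y - v) + emb h * (v - \<iota> d))"
      using hy by (simp add: algebra_simps)
    have "trnorm \<tau> (v - emb h * \<iota> d) \<le> \<kappa> + (\<kappa> + \<kappa>)"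
      unfolding eq
      using trnorm_triangle[OF \<tau>, of "v - y" "emb h * (y - v) + emb h * (v - \<iota> d)"]
        trnorm_triangle[OF \<tau>, of "emb h * (y - v)" "emb h * (v - \<iota> d)"]
        trnorm_contraction_left[OF \<tau> nh, of "y - v"] trnorm_contraction_left[OF \<tau> nh, of "v - \<iota> d"]
        vy vd trnorm_diff_commute[of \<tau> y v] by linarith
    moreover have "emb h * \<iota> d = \<iota> (\<lambda>x. of_real (h x) * d x)"
      using ch d by (simp add: emb_def \<iota>_mult continuous_intros)
    ultimately have vq: "trnorm \<tau> (v - emb q) \<le> 3 * \<kappa>"
      using trnorm_Re_le[OF \<tau> chd sv] unfolding q_def by simp
    have "trnorm \<tau> (emb e * emb e - emb e) \<le> sqrt \<kappa>"
    proof -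
      have cee: "continuous_on UNIV (\<lambda>x. e x * e x - e x)" by (intro continuous_intros ce)
      have "emb e * emb e - emb e = emb (\<lambda>x. e x * e x - e x)"
        using emb_diff[of "\<lambda>x. e x * e x" e] emb_mult[OF ce ce] ce by (simp add: continuous_intros)
      then have "(trnorm \<tau> (emb e * emb e - emb e))\<^sup>2 = Re (\<tau> (emb (\<lambda>x. (e x * e x - e x)\<^sup>2)))"
        using trnorm_\<iota>_square[OF \<tau>, of "\<lambda>x. of_real (e x * e x - e x)"] cee
        unfolding emb_def norm_of_real power2_abs by (simp only: continuous_on_of_real)
      also have "\<dots> \<le> Re (\<tau> (emb (\<lambda>x. chi \<delta>0 (\<beta> x))))"
      proof (rule trace_emb_mono[OF \<tau>])
        show "continuous_on UNIV (\<lambda>x. (e x * e x - e x)\<^sup>2)" by (intro continuous_intros ce)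
        show "continuous_on UNIV (\<lambda>x. chi \<delta>0 (\<beta> x))"
          by (rule continuous_on_compose2[OF continuous_on_chi[OF \<delta>0] \<beta>]) simp
        fix x
        have e01: "0 \<le> e x" "e x \<le> 1" by (simp_all add: e_def)
        have chi0: "0 \<le> chi \<delta>0 s" for s using \<delta>0 by (auto simp: chi_def field_simps)
        show "(e x * e x - e x)\<^sup>2 \<le> chi \<delta>0 (\<beta> x)"
        proof (cases "-\<delta> < \<beta> x \<and> \<beta> x < 0")
          case True
          then have "chi \<delta>0 (\<beta> x) = 1" using \<delta> by (auto simp: chi_def)
          moreover have "\<bar>e x * e x - e x\<bar> \<le> 1"
            using e01 mult_left_le[of "e x" "e x"] mult_nonneg_nonneg[OF e01(1) e01(1)]
            unfolding abs_le_iff by linarith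
          ultimately show ?thesis using power_le_one[of "\<bar>e x * e x - e x\<bar>" 2] by simp
        next
          case False
          then have "e x = 1 \<or> e x = 0"
            using ramp_eq_1[of "-\<delta>" 0 "\<beta> x"] ramp_eq_0[of "-\<delta>" 0 "\<beta> x"] \<delta> unfolding e_def by linarith
          then show ?thesis using chi0 by auto
        qed
      qed
      also have "\<dots> \<le> \<kappa>" using chi[OF \<tau>] by simp
      finally show ?thesis by (intro real_le_rsqrt)
    qed
    then have "trnorm \<tau> (v * v - v) \<le> \<kappa> + sqrt \<kappa>"
      using trnorm_idempotent_conjugate[OF \<tau> nE u] uu' unfolding v_def by linarith
    then have 1: "trnorm \<tau> (emb q * emb q - emb q) \<le> \<zeta>"
      using trnorm_idempotent_perturb[OF \<tau> nq nv vq] \<kappa>(3) sk by linarith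
    have "Re (\<tau> (emb (\<lambda>x. ramp (-2*t) (-t) (f x)))) - \<kappa> \<le> Re (\<tau> (emb (\<lambda>x. ramp (-2*t) (-t) (\<beta> x))))"
      using FF[OF _ \<tau>, of "ramp (-2*t) (-t)"] by (simp add: F_def)
    also have "\<dots> \<le> Re (\<tau> (emb e))"
    proof (rule trace_emb_mono[OF \<tau> _ ce])
      show "ramp (-2*t) (-t) (\<beta> x) \<le> e x" for x
        using ramp_eq_1[of "-\<delta>" 0 "\<beta> x"] ramp_eq_0[of "-2*t" "-t" "\<beta> x"] t \<delta>
        by (cases "\<beta> x \<le> -\<delta>") (auto simp: e_def)
    qed (use t \<beta> in \<open>auto intro: cr\<close>)
    also have "\<tau> (emb e) = \<tau> v - \<tau> ((star u * u - 1) * emb e)"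
    proof -
      have "\<tau> v = \<tau> (star u * (u * emb e))" unfolding v_def by (rule trace_commute[OF \<tau>])
      then show ?thesis by (simp add: algebra_simps trace_diff[OF \<tau>])
    qed
    also have "Re \<dots> \<le> Re (\<tau> v) + \<kappa>"
      using cmod_trace_le_trnorm[OF \<tau>, of "(star u * u - 1) * emb e"]
        trnorm_contraction_right[OF \<tau> nE, of "star u * u - 1"] uu'
        abs_Re_le_cmod[of "\<tau> ((star u * u - 1) * emb e)"] by simp
    also have "Re (\<tau> v) \<le> Re (\<tau> (emb q)) + 3 * \<kappa>"
      using cmod_trace_le_trnorm[OF \<tau>, of "v - emb q"] vq abs_Re_le_cmod[of "\<tau> (v - emb q)"]
      by (simp add: trace_diff[OF \<tau>])
    finally show ?thesis using 1 \<kappa>(3) \<zeta> by simp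
  qed
  show ?thesis using cq qh main unfolding h_def by blast
qed

text \<open>Here \<open>k\<close> stands for \<open>{f < -3t}\<close>, and \<open>g\<close> and \<open>r\<close> are two cut-offs of \<open>q\<close> with \<open>rg = g\<close>. Property (C) gives
  \<open>u\<close> in the hereditary subalgebra of \<open>{f < 4t}\<close>, up to scalars, that conjugates \<open>k\<close> approximately into
  that of \<open>g\<close>. There \<open>r\<close> acts as an exact unit; this is why \<open>r\<close> is used in place of \<open>q\<close>, since the
  approximant \<open>y\<close> has no norm bound under which \<open>qy\<close> would be close to \<open>y\<close>. Hence \<open>w = u\<^sup>*ru\<close>
  almost acts as a unit on \<open>k\<close>. It annihilates \<open>m\<close>, the cut-off to \<open>{f > 4t}\<close>, because both \<open>u\<close>, up to a
  scalar, and \<open>r\<close> do so. Finally \<open>\<rho>\<close> is the real part of a function close to \<open>w\<close>.\<close>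

lemma second_comparison:
  assumes C: "property_C Dset" and f: "continuous_on UNIV f" and t: "t > 0"
    and q: "continuous_on UNIV q" "\<And>x. \<bar>q x\<bar> \<le> ramp (3*t) (4*t) (f x)"
    and q2: "\<And>\<tau>. \<tau> \<in> tracial_states \<Longrightarrow> trnorm \<tau> (emb q * emb q - emb q) \<le> \<zeta>"
    and qf: "\<forall>\<tau>\<in>tracial_states. Re (\<tau> (emb (\<lambda>x. ramp (-2*t) (-t) (f x)))) - \<zeta> \<le> Re (\<tau> (emb q))"
    and \<eta>: "5 * \<zeta> < \<eta>"
    and gap: "\<forall>\<tau>\<in>tracial_states.
      \<eta> \<le> Re (\<tau> (emb (\<lambda>x. ramp (-2*t) (-t) (f x) - ramp (-3*t) (-2*t) (f x))))"
    and \<epsilon>: "\<epsilon> > 0"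
  shows "\<exists>\<rho>. continuous_on UNIV \<rho> \<and> (\<forall>\<tau>\<in>tracial_states.
    trnorm \<tau> (emb \<rho> * emb \<rho> - emb \<rho>) \<le> 2 * \<zeta> + 4 * \<epsilon> \<and>
    trnorm \<tau> (emb \<rho> * emb (\<lambda>x. 1 - ramp (4*t) (5*t) (f x))) \<le> \<epsilon> \<and>
    trnorm \<tau> ((1 - emb \<rho>) * emb (\<lambda>x. ramp (-4*t) (-3*t) (f x))) \<le> 4 * \<epsilon>)"
proof -
  have cr: "continuous_on UNIV (\<lambda>x. ramp l u (k x))" if "l < u" "continuous_on UNIV k" for l u and k :: "'x \<Rightarrow> real"
    using that by (rule continuous_on_ramp)
  define h where "h x = ramp (3*t) (4*t) (f x)" for x
  define m where "m x = 1 - ramp (4*t) (5*t) (f x)" for x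
  define k where "k x = ramp (-4*t) (-3*t) (f x)" for x
  define g where "g x = 1 - ramp (1/2) (3/4) (q x)" for x
  define r where "r x = 1 - ramp (1/4) (1/2) (q x)" for x
  have ch: "continuous_on UNIV h" and cm: "continuous_on UNIV m" and ck: "continuous_on UNIV k"
    and cg: "continuous_on UNIV g" and cr': "continuous_on UNIV r"
    unfolding h_def m_def k_def g_def r_def using t f q by (auto intro!: continuous_intros)
  have q1: "\<bar>q x\<bar> \<le> 1" for x by (rule order_trans[OF q(2) ramp_le_1])
  have cqq: "continuous_on UNIV (\<lambda>x. q x * q x - q x)" by (intro continuous_intros q)
  have embqq: "emb q * emb q - emb q = emb (\<lambda>x. q x * q x - q x)"
    using emb_diff[of "\<lambda>x. q x * q x" q] emb_mult[OF q(1) q(1)] q by (simp add: continuous_intros)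
  have ksupp: "1/2 \<le> h x" if "k x \<noteq> 0" for x
    using that ramp_eq_0[of "-4*t" "-3*t" "f x"] ramp_eq_1[of "3*t" "4*t" "f x"] t
    by (cases "f x \<le> 3*t") (auto simp: k_def h_def)
  have gsupp: "1/2 \<le> h x" if "g x \<noteq> 0" for x
    using that ramp_eq_1[of "1/2" "3/4" "q x"] q(2)[of x]
    by (cases "q x \<le> 1/2") (auto simp: g_def h_def)
  have b: "\<And>x. 0 \<le> k x" "\<And>x. k x \<le> 1" "\<And>x. 0 \<le> g x" "\<And>x. g x \<le> 1" "\<And>x. 0 \<le> h x" "\<And>x. h x \<le> 1"
    by (simp_all add: k_def g_def h_def)
  have less: "d_tau \<tau> (emb k) < d_tau \<tau> (emb g)" if \<tau>: "\<tau> \<in> tracial_states" for \<tau>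
  proof -
    have "d_tau \<tau> (emb k) \<le> Re (\<tau> (emb (\<lambda>x. ramp (-3*t) (-2*t) (f x))))"
    proof (rule d_tau_emb(2)[OF \<tau> ck])
      fix x assume "0 < k x"
      then have "f x < -3*t" using ramp_eq_0[of "-4*t" "-3*t" "f x"] t by (cases "f x < -3*t") (auto simp: k_def)
      then show "1 \<le> ramp (-3*t) (-2*t) (f x)" using ramp_eq_1[of "-3*t" "-2*t" "f x"] t by simp
    qed (use t f in \<open>auto simp: k_def intro: cr\<close>)
    also have "\<dots> \<le> Re (\<tau> (emb (\<lambda>x. ramp (-2*t) (-t) (f x)))) - \<eta>"
    proof -
      have "emb (\<lambda>x. ramp (-2*t) (-t) (f x) - ramp (-3*t) (-2*t) (f x)) =
          emb (\<lambda>x. ramp (-2*t) (-t) (f x)) - emb (\<lambda>x. ramp (-3*t) (-2*t) (f x))"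
        using t f by (intro emb_diff cr) auto
      then show ?thesis using bspec[OF gap \<tau>] by (simp add: trace_diff[OF \<tau>])
    qed
    also have "\<dots> < Re (\<tau> (emb q)) - 4 * \<zeta>" using bspec[OF qf \<tau>] \<eta> by simp
    also have "Re (\<tau> (emb q)) \<le> Re (\<tau> (emb (\<lambda>x. g x + 4 * \<bar>q x * q x - q x\<bar>)))"
    proof (intro trace_emb_mono[OF \<tau> q(1)] continuous_intros cg q)
      fix x
      show "q x \<le> g x + 4 * \<bar>q x * q x - q x\<bar>"
      proof (cases "q x \<ge> 3/4")
        case True
        then have "g x = 1" using ramp_eq_0[of "1/2" "3/4" "q x"] by (simp add: g_def)
        then have "q x \<le> g x" using q1[of x] by (simp add: abs_le_iff)
        then show ?thesis by (rule order_trans) simp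
      next
        case False
        define X where "X = \<bar>q x * q x - q x\<bar>"
        define A where "A = \<bar>q x\<bar>"
        have "X = \<bar>q x\<bar> * \<bar>1 - q x\<bar>"
          unfolding X_def by (simp add: abs_mult[symmetric] algebra_simps abs_minus_commute)
        moreover have "\<bar>q x\<bar> * (1/4) \<le> \<bar>q x\<bar> * \<bar>1 - q x\<bar>" using False by (intro mult_left_mono) auto
        ultimately have "A * (1/4) \<le> X" by (simp add: A_def)
        moreover have "0 \<le> g x" by (simp add: g_def)
        moreover have "q x \<le> A" by (simp add: A_def)
        ultimately have "q x \<le> g x + 4 * X" by linarith
        then show ?thesis by (simp add: X_def)
      qed
    qed
    also have "\<dots> = Re (\<tau> (emb g)) + 4 * Re (\<tau> (emb (\<lambda>x. \<bar>q x * q x - q x\<bar>)))"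
      using cqq cg by (simp add: emb_add emb_scaleR continuous_intros trace_add[OF \<tau>] trace_scaleR[OF \<tau>])
    also have "Re (\<tau> (emb (\<lambda>x. \<bar>q x * q x - q x\<bar>))) \<le> \<zeta>"
    proof -
      have "Re (\<tau> (emb (\<lambda>x. \<bar>q x * q x - q x\<bar>))) \<le> trnorm \<tau> (emb (\<lambda>x. \<bar>q x * q x - q x\<bar>))"
        using trace_emb_le_trnorm[OF \<tau>, of "\<lambda>x. \<bar>q x * q x - q x\<bar>"] cqq by (simp add: continuous_intros)
      also have "\<dots> \<le> trnorm \<tau> (emb (\<lambda>x. q x * q x - q x))"
        by (intro trnorm_emb_mono[OF \<tau>] continuous_on_rabs cqq) auto
      also have "\<dots> \<le> \<zeta>" using q2[OF \<tau>] by (simp add: embqq)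
      finally show ?thesis .
    qed
    finally have "d_tau \<tau> (emb k) < Re (\<tau> (emb g))" by simp
    also have "\<dots> \<le> d_tau \<tau> (emb g)" by (rule d_tau_emb(1)[OF \<tau> cg]) (auto simp: g_def)
    finally show ?thesis .
  qed
  obtain u x z y where u: "norm u \<le> 1" and x: "x \<in> hereditary (emb h) UNIV" "u = x + z *\<^sub>C 1"
    and y: "y \<in> hereditary (emb g) UNIV" "tnorm (u * emb k * star u - y) < \<epsilon>"
    and D: "\<And>d. d \<in> unit_ball Dset \<Longrightarrow> tdist (star u * d * u) (unit_ball Dset) < \<epsilon>"
    and uu: "tnorm (u * star u - 1) < \<epsilon>" "tnorm (star u * u - 1) < \<epsilon>"
    using property_CD[OF C ck b(1,2) cg b(3,4) ch b(5,6) half_gt_zero[OF zero_less_one] ksupp gsupp less \<epsilon>]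
    by blast
  define R where "R = emb r"
  define K where "K = emb k"
  define M where "M = emb m"
  define w where "w = star u * R * u"
  have nR: "norm R \<le> 1" unfolding R_def by (intro norm_emb_le cr') (simp add: r_def)
  have nR1: "norm (1 - R) \<le> 1"
  proof -
    have "1 - R = emb (\<lambda>x. 1 - r x)" using emb_diff[of "\<lambda>x. 1" r] cr' by (simp add: R_def)
    also have "norm \<dots> \<le> 1" by (intro norm_emb_le continuous_intros cr') (simp add: r_def)
    finally show ?thesis .
  qed
  have nK: "norm K \<le> 1" unfolding K_def by (intro norm_emb_le ck) (simp add: k_def)
  have nM: "norm M \<le> 1" unfolding M_def by (intro norm_emb_le cm) (simp add: m_def)
  have nu: "norm (star u) \<le> 1" using u by simp
  have nw: "norm w \<le> 1" unfolding w_def by (intro norm_mult_le_1 nu nR u)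
  have sw: "self_adjoint w" by (simp add: w_def R_def self_adjoint_def star_mult star_star cr' mult.assoc)
  have "R \<in> unit_ball Dset" unfolding R_def by (rule emb_in_unit_ball[OF cr']) (simp add: r_def)
  from tdist_unit_ballD[OF D[OF this]] obtain d
    where d: "continuous_on UNIV d" "\<And>x. cmod (d x) \<le> 1" "tnorm (w - \<iota> d) < \<epsilon>" unfolding w_def by blast
  define \<rho> where "\<rho> x = Re (d x)" for x
  have c\<rho>: "continuous_on UNIV \<rho>" unfolding \<rho>_def by (intro continuous_intros d)
  have n\<rho>: "norm (emb \<rho>) \<le> 1"
  proof (rule norm_emb_le[OF c\<rho>])
    fix x show "\<bar>\<rho> x\<bar> \<le> 1" using d(2)[of x] abs_Re_le_cmod[of "d x"] unfolding \<rho>_def by linarith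
  qed
  have Ry: "R * y = y"
  proof (rule hereditary_left_unit[OF y(1)])
    have "r x * g x = g x" for x
      using ramp_eq_0[of "1/4" "1/2" "q x"] ramp_eq_1[of "1/2" "3/4" "q x"]
      by (cases "q x \<ge> 1/2") (auto simp: r_def g_def)
    then have eq: "(\<lambda>x. r x * g x) = g" by (rule ext)
    show "R * emb g = emb g" using emb_mult[OF cr' cg] unfolding eq R_def by simp
  qed
  have hm: "h x * m x = 0" for x
    using ramp_eq_1[of "4*t" "5*t" "f x"] ramp_eq_0[of "3*t" "4*t" "f x"] t
    by (cases "f x \<le> 4*t") (auto simp: h_def m_def)
  have xM: "x * M = 0"
  proof (rule hereditary_right_zero[OF x(1)])
    have eq: "(\<lambda>x. h x * m x) = (\<lambda>x. 0)" by (intro ext hm)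
    show "emb h * M = 0" using emb_mult[OF ch cm] emb_zero unfolding eq M_def by simp
  qed
  have RM: "R * M = 0"
  proof -
    have "r x * m x = 0" for x
    proof (cases "q x \<le> 1/4")
      case True then show ?thesis using ramp_eq_1[of "1/4" "1/2" "q x"] by (simp add: r_def)
    next
      case False then have "h x \<noteq> 0" using q(2)[of x] by (auto simp: h_def)
      then show ?thesis using hm[of x] by simp
    qed
    then have eq: "(\<lambda>x. r x * m x) = (\<lambda>x. 0)" by (rule ext)
    show ?thesis using emb_mult[OF cr' cm] emb_zero unfolding eq R_def M_def by simp
  qed
  \<comment> \<open>\<open>u\<close> acts on \<open>M\<close> as a scalar, and \<open>R\<close> annihilates \<open>M\<close>\<close>
  have "u * M = z *\<^sub>C M" using xM by (simp add: x(2) distrib_right mult_scaleC_left)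
  then have wM: "w * M = 0" using RM by (simp add: w_def mult.assoc mult_scaleC_right)
  have main: "trnorm \<tau> (emb \<rho> * emb \<rho> - emb \<rho>) \<le> 2 * \<zeta> + 4 * \<epsilon> \<and>
    trnorm \<tau> (emb \<rho> * M) \<le> \<epsilon> \<and> trnorm \<tau> ((1 - emb \<rho>) * K) \<le> 4 * \<epsilon>" if \<tau>: "\<tau> \<in> tracial_states" for \<tau>
  proof (intro conjI)
    note tn = trnorm_le_tnorm[OF \<tau>]
    have uu1: "trnorm \<tau> (u * star u - 1) \<le> \<epsilon>" and uu2: "trnorm \<tau> (star u * u - 1) \<le> \<epsilon>"
      using tn[of "u * star u - 1"] tn[of "star u * u - 1"] uu by simp_all
    have vy: "trnorm \<tau> (u * K * star u - y) \<le> \<epsilon>" using tn[of "u * K * star u - y"] y(2) by (simp add: K_def)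
    have w\<rho>: "trnorm \<tau> (w - emb \<rho>) \<le> \<epsilon>"
      using trnorm_Re_le[OF \<tau> d(1) sw] tn[of "w - \<iota> d"] d(3) unfolding \<rho>_def by linarith
    have "trnorm \<tau> (R * R - R) \<le> 2 * \<zeta>"
    proof -
      have crr: "continuous_on UNIV (\<lambda>x. r x * r x - r x)" by (intro continuous_intros cr')
      have "R * R - R = emb (\<lambda>x. r x * r x - r x)"
        using emb_diff[of "\<lambda>x. r x * r x" r] emb_mult[OF cr' cr'] cr' by (simp add: R_def continuous_intros)
      also have "trnorm \<tau> \<dots> \<le> trnorm \<tau> (emb (\<lambda>x. 2 * (q x * q x - q x)))"
      proof (rule trnorm_emb_mono[OF \<tau> crr])
        show "continuous_on UNIV (\<lambda>x. 2 * (q x * q x - q x))" by (intro continuous_intros q)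
        fix x
        show "\<bar>r x * r x - r x\<bar> \<le> \<bar>2 * (q x * q x - q x)\<bar>"
        proof (cases "1/4 < q x \<and> q x < 1/2")
          case True
          have "r x * r x - r x + 1/4 = (r x - 1/2) * (r x - 1/2)" by (simp add: algebra_simps)
          then have "- (r x * r x - r x) \<le> 1/4" using zero_le_square[of "r x - 1/2"] by linarith
          moreover have "r x * r x \<le> r x" using mult_left_le[of "r x" "r x"] by (simp add: r_def)
          ultimately have "\<bar>r x * r x - r x\<bar> \<le> 1/4" by linarith
          moreover have "1/4 * (1/2) \<le> q x * (1 - q x)" using True by (intro mult_mono) auto
          then have "1/4 \<le> \<bar>2 * (q x * q x - q x)\<bar>" by (simp add: algebra_simps)
          ultimately show ?thesis by linarith
        next
          case False
          then have "r x = 0 \<or> r x = 1"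
            using ramp_eq_1[of "1/4" "1/2" "q x"] ramp_eq_0[of "1/4" "1/2" "q x"] unfolding r_def by linarith
          then show ?thesis by auto
        qed
      qed
      also have "\<dots> \<le> norm (2 *\<^sub>R (1::'a)) * trnorm \<tau> (emb (\<lambda>x. q x * q x - q x))"
        using trnorm_mult_left[OF \<tau>, of "2 *\<^sub>R 1" "emb (\<lambda>x. q x * q x - q x)"] emb_scaleR[OF cqq, of 2] by simp
      also have "\<dots> \<le> 2 * \<zeta>" using q2[OF \<tau>] by (simp add: embqq)
      finally show ?thesis .
    qed
    then have "trnorm \<tau> (w * w - w) \<le> \<epsilon> + 2 * \<zeta>"
      using trnorm_idempotent_conjugate[OF \<tau> nR nu] uu1 unfolding w_def star_star by linarith
    then show "trnorm \<tau> (emb \<rho> * emb \<rho> - emb \<rho>) \<le> 2 * \<zeta> + 4 * \<epsilon>"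
      using trnorm_idempotent_perturb[OF \<tau> n\<rho> nw w\<rho>] by linarith
    have "emb \<rho> * M = (emb \<rho> - w) * M" using wM by (simp add: algebra_simps)
    then show "trnorm \<tau> (emb \<rho> * M) \<le> \<epsilon>"
      using trnorm_contraction_right[OF \<tau> nM, of "emb \<rho> - w"] w\<rho> trnorm_diff_commute[of \<tau> w] by simp
    have su: "norm (star u * (1 - R)) \<le> 1" by (intro norm_mult_le_1 nu nR1)
    have "star u * (1 - R) * (u * K * star u) * u = star u * (1 - R) * (u * K * star u - y) * u"
      using Ry by (simp add: algebra_simps)
    also have "trnorm \<tau> \<dots> \<le> \<epsilon>"
      using trnorm_contraction_right[OF \<tau> u, of "star u * (1 - R) * (u * K * star u - y)"]
        trnorm_contraction_left[OF \<tau> su, of "u * K * star u - y"] vy by linarith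
    finally have t1: "trnorm \<tau> (star u * (1 - R) * (u * K * star u) * u) \<le> \<epsilon>" .
    have sK: "norm (star u * (1 - R) * u * K) \<le> 1" by (intro norm_mult_le_1 nu nR1 u nK)
    let ?A = "(w - emb \<rho>) * K" and ?B = "(1 - star u * u) * K"
      and ?P = "star u * (1 - R) * (u * K * star u) * u" and ?Q = "(star u * (1 - R) * u * K) * (1 - star u * u)"
    have eq: "(1 - emb \<rho>) * K = (?A + ?B) + (?P + ?Q)"
      by (simp add: w_def algebra_simps)
    have "trnorm \<tau> ((1 - emb \<rho>) * K) \<le> (trnorm \<tau> ?A + trnorm \<tau> ?B) + (trnorm \<tau> ?P + trnorm \<tau> ?Q)"
      unfolding eq using trnorm_triangle[OF \<tau>, of "?A + ?B" "?P + ?Q"]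
        trnorm_triangle[OF \<tau>, of ?A ?B] trnorm_triangle[OF \<tau>, of ?P ?Q] by linarith
    also have "\<dots> \<le> (\<epsilon> + \<epsilon>) + (\<epsilon> + \<epsilon>)"
      using trnorm_contraction_right[OF \<tau> nK, of "w - emb \<rho>"] trnorm_contraction_right[OF \<tau> nK, of "1 - star u * u"]
        trnorm_contraction_left[OF \<tau> sK, of "1 - star u * u"] w\<rho> t1 uu2 trnorm_diff_commute[of \<tau> "star u * u" 1]
      by linarith
    finally show "trnorm \<tau> ((1 - emb \<rho>) * K) \<le> 4 * \<epsilon>" by simp
  qed
  show ?thesis using c\<rho> main unfolding M_def K_def m_def k_def by blast
qed


section \<open>From approximate indicators to the small boundary property\<close>

text \<open>The two comparisons need two bumps \<open>?b1\<close> and \<open>?b2\<close> of \<open>f\<close> to be nonzero, as their traces give the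
  room for the strict inequalities. If \<open>?b1\<close> vanishes, then \<open>f\<close> takes no value in \<open>(0, 2t)\<close>; if \<open>?b2\<close> vanishes,
  then \<open>f\<close> takes no value in \<open>(-3t, -t)\<close>. In both cases a ramp over the missing values is an exact
  indicator function.\<close>

lemma almost_indicator:
  assumes simple: "simple_cstar_algebra TYPE('a)"
    and C: "property_C Dset" and S: "property_S TYPE('a)" and E: "property_E Dset"
    and f: "continuous_on UNIV f" "\<And>x. \<bar>f x\<bar> \<le> 1" and t: "t > 0" and \<theta>: "\<theta> > 0"
  shows "\<exists>\<rho>. continuous_on UNIV \<rho> \<and> (\<forall>\<tau>\<in>tracial_states.
    trnorm \<tau> (emb \<rho> * emb \<rho> - emb \<rho>) \<le> \<theta> \<and>
    trnorm \<tau> (emb \<rho> * emb (\<lambda>x. 1 - ramp (4*t) (5*t) (f x))) \<le> \<theta> \<and>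
    trnorm \<tau> ((1 - emb \<rho>) * emb (\<lambda>x. ramp (-4*t) (-3*t) (f x))) \<le> \<theta>)"
proof -
  have cr: "continuous_on UNIV (\<lambda>x. ramp l u (f x))" if "l < u" for l u
    using that f(1) by (rule continuous_on_ramp)
  have exact: ?thesis
    if c\<rho>: "continuous_on UNIV \<rho>" and \<rho>01: "\<And>x. \<rho> x = 0 \<or> \<rho> x = 1"
      and hi: "\<And>x. 4*t \<le> f x \<Longrightarrow> \<rho> x = 0" and lo: "\<And>x. f x \<le> -3*t \<Longrightarrow> \<rho> x = 1" for \<rho> :: "'x \<Rightarrow> real"
  proof -
    have cm: "continuous_on UNIV (\<lambda>x. 1 - ramp (4*t) (5*t) (f x))"
      using t by (intro continuous_on_diff continuous_on_const cr) simp
    have ck: "continuous_on UNIV (\<lambda>x. ramp (-4*t) (-3*t) (f x))" using t by (intro cr) simp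
    have c1: "continuous_on UNIV (\<lambda>x. 1 - \<rho> x)" by (intro continuous_intros c\<rho>)
    have "(\<lambda>x. \<rho> x * \<rho> x) = \<rho>" using \<rho>01 by (intro ext) (metis mult_zero_left mult_1)
    then have 1: "emb \<rho> * emb \<rho> - emb \<rho> = 0" using emb_mult[OF c\<rho> c\<rho>] by simp
    have "\<rho> x * (1 - ramp (4*t) (5*t) (f x)) = 0" for x
      using hi[of x] ramp_eq_1[of "4*t" "5*t" "f x"] t by (cases "4*t \<le> f x") auto
    then have "(\<lambda>x. \<rho> x * (1 - ramp (4*t) (5*t) (f x))) = (\<lambda>x. 0)" by (rule ext)
    then have 2: "emb \<rho> * emb (\<lambda>x. 1 - ramp (4*t) (5*t) (f x)) = 0"
      using emb_mult[OF c\<rho> cm] emb_zero by metis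
    have "(1 - \<rho> x) * ramp (-4*t) (-3*t) (f x) = 0" for x
      using lo[of x] ramp_eq_0[of "-4*t" "-3*t" "f x"] t by (cases "f x \<le> -3*t") auto
    then have "(\<lambda>x. (1 - \<rho> x) * ramp (-4*t) (-3*t) (f x)) = (\<lambda>x. 0)" by (rule ext)
    then have "emb (\<lambda>x. 1 - \<rho> x) * emb (\<lambda>x. ramp (-4*t) (-3*t) (f x)) = 0"
      using emb_mult[OF c1 ck] emb_zero by metis
    moreover have "emb (\<lambda>x. 1 - \<rho> x) = 1 - emb \<rho>" using emb_diff[of "\<lambda>x. 1" \<rho>] c\<rho> by simp
    ultimately have 3: "(1 - emb \<rho>) * emb (\<lambda>x. ramp (-4*t) (-3*t) (f x)) = 0" by simp
    show ?thesis
      by (intro exI[of _ \<rho>] conjI ballI c\<rho>) (use 1 2 3 \<theta> in \<open>simp_all add: trnorm_zero\<close>)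
  qed
  let ?b1 = "\<lambda>x. ramp t (2*t) (f x) - ramp 0 t (f x)"
    and ?b2 = "\<lambda>x. ramp (-2*t) (-t) (f x) - ramp (-3*t) (-2*t) (f x)"
  have b1: "0 \<le> ?b1 x" "?b1 x \<le> 1" "0 < f x \<Longrightarrow> f x < 2*t \<Longrightarrow> ?b1 x \<noteq> 0" for x
    using ramp_eq_1[of t "2*t" "f x"] ramp_eq_0[of 0 t "f x"] ramp_less_1[of 0 t "f x"] ramp_pos[of t "2*t" "f x"] t
      ramp_nonneg[of 0 t "f x"] ramp_le_1[of t "2*t" "f x"] ramp_le_1[of 0 t "f x"] ramp_nonneg[of t "2*t" "f x"]
    by (cases "f x \<le> t"; simp)+
  have b2: "0 \<le> ?b2 x" "?b2 x \<le> 1" "-3*t < f x \<Longrightarrow> f x < -t \<Longrightarrow> ?b2 x \<noteq> 0" for x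
    using ramp_eq_1[of "-2*t" "-t" "f x"] ramp_eq_0[of "-3*t" "-2*t" "f x"] ramp_less_1[of "-3*t" "-2*t" "f x"]
      ramp_pos[of "-2*t" "-t" "f x"] t ramp_nonneg[of "-2*t" "-t" "f x"] ramp_nonneg[of "-3*t" "-2*t" "f x"]
      ramp_le_1[of "-3*t" "-2*t" "f x"] ramp_le_1[of "-2*t" "-t" "f x"]
    by (cases "f x \<le> -2*t"; simp)+
  consider "\<forall>x. ?b1 x = 0" | "\<forall>x. ?b2 x = 0" | x1 x2 where "?b1 x1 \<noteq> 0" "?b2 x2 \<noteq> 0" by blast
  then show ?thesis
  proof cases
    case 1
    then have gap: "f x \<le> 0 \<or> 2*t \<le> f x" for x using b1(3)[of x] by force
    show ?thesis
    proof (rule exact[of "\<lambda>x. ramp 0 t (f x)"])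
      show "ramp 0 t (f x) = 0 \<or> ramp 0 t (f x) = 1" for x
        using gap[of x] ramp_eq_1[of 0 t "f x"] ramp_eq_0[of 0 t "f x"] t by auto
    qed (use t in \<open>auto intro!: ramp_eq_0 ramp_eq_1 cr\<close>)
  next
    case 2
    then have gap: "f x \<le> -3*t \<or> -t \<le> f x" for x using b2(3)[of x] by force
    show ?thesis
    proof (rule exact[of "\<lambda>x. ramp (-2*t) (-t) (f x)"])
      show "ramp (-2*t) (-t) (f x) = 0 \<or> ramp (-2*t) (-t) (f x) = 1" for x
        using gap[of x] ramp_eq_1[of "-2*t" "-t" "f x"] ramp_eq_0[of "-2*t" "-t" "f x"] t by auto
    qed (use t in \<open>auto intro!: ramp_eq_0 ramp_eq_1 cr\<close>)
  next
    case 3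
    have c1: "continuous_on UNIV ?b1" and c2: "continuous_on UNIV ?b2"
      using t by (intro continuous_on_diff cr; simp)+
    obtain \<eta>1 where \<eta>1: "\<eta>1 > 0" "\<forall>\<tau>\<in>tracial_states. \<eta>1 \<le> Re (\<tau> (emb ?b1))"
      using emb_trace_lower_bound[OF simple c1 b1(1,2) 3(1)] by blast
    obtain \<eta>2 where \<eta>2: "\<eta>2 > 0" "\<forall>\<tau>\<in>tracial_states. \<eta>2 \<le> Re (\<tau> (emb ?b2))"
      using emb_trace_lower_bound[OF simple c2 b2(1,2) 3(2)] by blast
    define \<zeta> where "\<zeta> = min (\<theta>/4) (\<eta>2/6)"
    have \<zeta>: "\<zeta> > 0" "5 * \<zeta> < \<eta>2" "\<zeta> \<le> \<theta>/4" using \<theta> \<eta>2(1) by (auto simp: \<zeta>_def min_def)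
    obtain q where q: "continuous_on UNIV q" "\<And>x. \<bar>q x\<bar> \<le> ramp (3*t) (4*t) (f x)"
      and q2: "\<And>\<tau>. \<tau> \<in> tracial_states \<Longrightarrow> trnorm \<tau> (emb q * emb q - emb q) \<le> \<zeta>"
      and qf: "\<forall>\<tau>\<in>tracial_states. Re (\<tau> (emb (\<lambda>x. ramp (-2*t) (-t) (f x)))) - \<zeta> \<le> Re (\<tau> (emb q))"
      using first_comparison[OF C S E f t \<eta>1(1) \<zeta>(1) \<eta>1(2)]
      by blast
    have "\<theta>/8 > 0" using \<theta> by simp
    from second_comparison[OF C f(1) t q q2 qf \<zeta>(2) \<eta>2(2) this] obtain \<rho>
      where \<rho>: "continuous_on UNIV \<rho>" and B: "\<And>\<tau>. \<tau> \<in> tracial_states \<Longrightarrow>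
        trnorm \<tau> (emb \<rho> * emb \<rho> - emb \<rho>) \<le> 2 * \<zeta> + 4 * (\<theta>/8) \<and>
        trnorm \<tau> (emb \<rho> * emb (\<lambda>x. 1 - ramp (4*t) (5*t) (f x))) \<le> \<theta>/8 \<and>
        trnorm \<tau> ((1 - emb \<rho>) * emb (\<lambda>x. ramp (-4*t) (-3*t) (f x))) \<le> 4 * (\<theta>/8)" by blast
    have small: "2 * \<zeta> + 4 * (\<theta>/8) \<le> \<theta>" "\<theta>/8 \<le> \<theta>" "4 * (\<theta>/8) \<le> \<theta>" using \<zeta> \<theta> by simp_all
    show ?thesis
      using \<rho> B small by (intro exI[of _ \<rho>] conjI ballI) (meson order_trans)+
  qed
qed

text \<open>Chebyshev's inequality: the seminorm of a real function is its norm in \<open>L\<^sup>2(\<mu>)\<close>.\<close>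

lemma trace_measure_Chebyshev:
  assumes \<mu>: "prob_space \<mu>" "sets \<mu> = sets borel" and \<tau>: "\<tau> \<in> tracial_states"
    and rep: "\<And>f. continuous_on UNIV f \<Longrightarrow> \<tau> (\<iota> f) = (\<integral>x. f x \<partial>\<mu>)"
    and k: "continuous_on UNIV k" and c: "c > 0" and b: "trnorm \<tau> (emb k) \<le> b"
  shows "measure \<mu> {x. c \<le> \<bar>k x\<bar>} \<le> b\<^sup>2 / c\<^sup>2"
proof -
  interpret prob_space \<mu> by fact
  have sp: "space \<mu> = UNIV" using sets_eq_imp_space_eq[OF \<mu>(2)] by simp
  have k2: "continuous_on UNIV (\<lambda>x. (k x)\<^sup>2)" by (intro continuous_intros k)
  have "bounded (range (\<lambda>x. (k x)\<^sup>2))" by (intro compact_imp_bounded compact_continuous_image k2 compact_space)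
  then obtain B where B: "\<And>x. norm ((k x)\<^sup>2) \<le> B" by (auto simp: bounded_iff)
  have meas: "(\<lambda>x. (k x)\<^sup>2) \<in> borel_measurable \<mu>"
    using borel_measurable_continuous_onI[OF k2] \<mu>(2) by (simp cong: measurable_cong_sets)
  have int: "integrable \<mu> (\<lambda>x. (k x)\<^sup>2)" by (rule integrable_const_bound[OF _ meas, of B]) (use B in auto)
  have "(\<integral>x. complex_of_real ((k x)\<^sup>2) \<partial>\<mu>) = complex_of_real (\<integral>x. (k x)\<^sup>2 \<partial>\<mu>)" by (rule integral_of_real[OF int])
  then have "Re (\<tau> (emb (\<lambda>x. (k x)\<^sup>2))) = (\<integral>x. (k x)\<^sup>2 \<partial>\<mu>)"
    unfolding emb_def using rep[OF continuous_on_of_real[OF k2]] by (simp only: Re_complex_of_real)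
  moreover have "(trnorm \<tau> (emb k))\<^sup>2 = Re (\<tau> (emb (\<lambda>x. (k x)\<^sup>2)))"
    using trnorm_\<iota>_square[OF \<tau> continuous_on_of_real[OF k]]
    unfolding emb_def norm_of_real power2_abs by simp
  moreover have "(trnorm \<tau> (emb k))\<^sup>2 \<le> b\<^sup>2" by (intro power_mono b trnorm_nonneg[OF \<tau>])
  ultimately have le: "(\<integral>x. (k x)\<^sup>2 \<partial>\<mu>) \<le> b\<^sup>2" by simp
  have "c\<^sup>2 \<le> (k x)\<^sup>2 \<longleftrightarrow> c \<le> \<bar>k x\<bar>" for x using abs_le_square_iff[of c "k x"] c by simp
  then have "measure \<mu> {x. c \<le> \<bar>k x\<bar>} = measure \<mu> {x\<in>space \<mu>. (k x)\<^sup>2 \<ge> c\<^sup>2}" by (simp add: sp)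
  also have "\<dots> \<le> (\<integral>x. (k x)\<^sup>2 \<partial>\<mu>) / c\<^sup>2"
    by (rule integral_Markov_inequality_measure[OF int sets.empty_sets]) (use c in auto)
  also have "\<dots> \<le> b\<^sup>2 / c\<^sup>2" using le by (intro divide_right_mono) auto
  finally show ?thesis .
qed

text \<open>The sign function \<open>s = 1 - 2\<rho>\<close>, clipped to the interval of radius \<open>t\<close> around \<open>f\<close>. Off the three small sets of
  \<open>almost_indicator\<close>, \<open>|s| > 1/2\<close> and \<open>s\<close> has the sign of \<open>f\<close> wherever \<open>|f| \<ge> t/2\<close>, so clipping
  cannot bring the value close to \<open>0\<close>. The threshold \<open>5t'\<close> for \<open>f' = f/B\<close> is \<open>t/2\<close> for \<open>f\<close>.\<close>

lemma uniform_perturbation: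
  fixes f :: "'x \<Rightarrow> real"
  assumes simple: "simple_cstar_algebra TYPE('a)"
    and C: "property_C Dset" and S: "property_S TYPE('a)" and E: "property_E Dset"
    and f: "continuous_on UNIV f" and t: "t > 0" and \<theta>: "\<theta> > 0"
  shows "\<exists>g \<delta>. continuous_on UNIV g \<and> (\<forall>x. \<bar>g x - f x\<bar> \<le> t) \<and> \<delta> > 0 \<and>
    (\<forall>\<mu>\<in>trace_measures \<iota>. measure \<mu> {x. \<bar>g x\<bar> < \<delta>} \<le> \<theta>)"
proof -
  have "bounded (range f)" by (intro compact_imp_bounded compact_continuous_image f compact_space)
  then obtain B0 where B0: "\<And>x. \<bar>f x\<bar> \<le> B0" by (auto simp: bounded_iff)
  define B where "B = max 1 B0"
  have B: "B > 0" "\<And>x. \<bar>f x\<bar> \<le> B" using B0 by (auto simp: B_def intro: le_max_iff_disj[THEN iffD2])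
  define f' where "f' x = f x / B" for x
  define t' where "t' = t / (10 * B)"
  have t': "t' > 0" using t B by (simp add: t'_def)
  have f': "continuous_on UNIV f'" "\<And>x. \<bar>f' x\<bar> \<le> 1"
    using B f by (auto simp: f'_def intro!: continuous_intros)
  \<comment> \<open>the three Chebyshev bounds below add up to \<open>32 \<theta>'\<^sup>2\<close>\<close>
  define \<theta>' where "\<theta>' = sqrt (\<theta> / 32)"
  have \<theta>': "\<theta>' > 0" "\<theta>'\<^sup>2 = \<theta> / 32" using \<theta> by (auto simp: \<theta>'_def)
  define m where "m x = 1 - ramp (4*t') (5*t') (f' x)" for x
  define k where "k x = ramp (-4*t') (-3*t') (f' x)" for x
  have cm: "continuous_on UNIV m" and ck: "continuous_on UNIV k"
    unfolding m_def k_def using t' f' by (auto intro!: continuous_intros)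
  obtain \<rho> where \<rho>: "continuous_on UNIV \<rho>" and est: "\<And>\<tau>. \<tau> \<in> tracial_states \<Longrightarrow>
    trnorm \<tau> (emb \<rho> * emb \<rho> - emb \<rho>) \<le> \<theta>' \<and> trnorm \<tau> (emb \<rho> * emb m) \<le> \<theta>' \<and>
    trnorm \<tau> ((1 - emb \<rho>) * emb k) \<le> \<theta>'"
    using almost_indicator[OF simple C S E f' t' \<theta>'(1)] unfolding m_def[abs_def] k_def[abs_def] by blast
  define s where "s x = 1 - 2 * \<rho> x" for x
  define g where "g x = max (f x - t) (min (s x) (f x + t))" for x
  define \<delta> where "\<delta> = min (1/2) (t/2)"
  have cg: "continuous_on UNIV g" unfolding g_def s_def by (intro continuous_intros f \<rho>)
  have close: "\<bar>g x - f x\<bar> \<le> t" for x using t by (auto simp: g_def abs_le_iff max_def min_def)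
  let ?a = "\<lambda>x. \<rho> x * \<rho> x - \<rho> x" and ?b = "\<lambda>x. \<rho> x * m x" and ?c = "\<lambda>x. (1 - \<rho> x) * k x"
  have ca: "continuous_on UNIV ?a" and cb: "continuous_on UNIV ?b" and cc: "continuous_on UNIV ?c"
    by (intro continuous_intros \<rho> cm ck)+
  have c\<rho>\<rho>: "continuous_on UNIV (\<lambda>x. \<rho> x * \<rho> x)" and c1\<rho>: "continuous_on UNIV (\<lambda>x. 1 - \<rho> x)"
    by (intro continuous_intros \<rho>)+
  have emba: "emb ?a = emb \<rho> * emb \<rho> - emb \<rho>" using emb_diff[OF c\<rho>\<rho> \<rho>] emb_mult[OF \<rho> \<rho>] by simp
  have embb: "emb ?b = emb \<rho> * emb m" by (rule emb_mult[OF \<rho> cm])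
  have embc: "emb ?c = (1 - emb \<rho>) * emb k"
    using emb_mult[OF c1\<rho> ck] emb_diff[of "\<lambda>x. 1" \<rho>] \<rho> by simp
  have cover: "{x. \<bar>g x\<bar> < \<delta>} \<subseteq> {x. 3/16 \<le> \<bar>?a x\<bar>} \<union> ({x. 3/4 \<le> \<bar>?b x\<bar>} \<union> {x. 3/4 \<le> \<bar>?c x\<bar>})"
  proof (rule subsetI, rule ccontr)
    fix x assume x: "x \<in> {x. \<bar>g x\<bar> < \<delta>}"
      and "x \<notin> {x. 3/16 \<le> \<bar>?a x\<bar>} \<union> ({x. 3/4 \<le> \<bar>?b x\<bar>} \<union> {x. 3/4 \<le> \<bar>?c x\<bar>})"
    then have na: "\<bar>?a x\<bar> < 3/16" and nb: "\<bar>?b x\<bar> < 3/4" and nc: "\<bar>?c x\<bar> < 3/4" by auto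
    have "\<rho> x < 1/4 \<or> \<rho> x > 3/4"
    proof (rule ccontr)
      assume "\<not> ?thesis"
      then have "0 \<le> (\<rho> x - 1/4) * (3/4 - \<rho> x)" by (intro mult_nonneg_nonneg) auto
      then have "?a x \<le> - (3/16)" by (simp add: algebra_simps)
      with na show False by linarith
    qed
    then show False
    proof
      assume r: "\<rho> x < 1/4"
      have "f x > - (t/2)"
      proof (rule ccontr)
        assume "\<not> f x > - (t/2)"
        then have "f' x \<le> - 5 * t'" using B by (simp add: f'_def t'_def field_simps)
        then have "k x = 1" using ramp_eq_1[of "-4*t'" "-3*t'" "f' x"] t' by (simp add: k_def)
        then show False using nc r by simp
      qed
      then have "g x \<ge> \<delta>" using r t by (auto simp: g_def s_def \<delta>_def max_def min_def)
      then show False using x by auto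
    next
      assume r: "\<rho> x > 3/4"
      have "f x < t/2"
      proof (rule ccontr)
        assume "\<not> f x < t/2"
        then have "f' x \<ge> 5 * t'" using B by (simp add: f'_def t'_def field_simps)
        then have "m x = 1" using ramp_eq_0[of "4*t'" "5*t'" "f' x"] t' by (simp add: m_def)
        then show False using nb r by simp
      qed
      then have "g x \<le> - \<delta>" using r t by (auto simp: g_def s_def \<delta>_def max_def min_def)
      then show False using x by auto
    qed
  qed
  have "measure \<mu> {x. \<bar>g x\<bar> < \<delta>} \<le> \<theta>" if \<mu>T: "\<mu> \<in> trace_measures \<iota>" for \<mu>
  proof -
    obtain \<tau> where \<mu>: "prob_space \<mu>" "sets \<mu> = sets borel" and \<tau>: "\<tau> \<in> tracial_states"
      and rep: "\<And>f. continuous_on UNIV f \<Longrightarrow> \<tau> (\<iota> f) = (\<integral>x. f x \<partial>\<mu>)"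
      using \<mu>T unfolding trace_measures_def by blast
    interpret prob_space \<mu> by fact
    have ms: "{x. c \<le> \<bar>u x\<bar>} \<in> sets \<mu>" if "continuous_on UNIV u" for c and u :: "'x \<Rightarrow> real"
    proof -
      have "closed {x. c \<le> \<bar>u x\<bar>}" by (intro closed_Collect_le continuous_intros that)
      then show ?thesis using \<mu>(2) by simp
    qed
    note ch = trace_measure_Chebyshev[OF \<mu> \<tau> rep]
    let ?A = "{x. 3/16 \<le> \<bar>?a x\<bar>}" and ?B = "{x. 3/4 \<le> \<bar>?b x\<bar>}" and ?C = "{x. 3/4 \<le> \<bar>?c x\<bar>}"
    have "measure \<mu> {x. \<bar>g x\<bar> < \<delta>} \<le> measure \<mu> (?A \<union> (?B \<union> ?C))"
      by (intro finite_measure_mono cover sets.Un ms ca cb cc)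
    also have "\<dots> \<le> measure \<mu> ?A + (measure \<mu> ?B + measure \<mu> ?C)"
      using measure_Un_le[OF ms[OF ca] sets.Un[OF ms[OF cb] ms[OF cc]], of "3/16" "3/4" "3/4"]
        measure_Un_le[OF ms[OF cb] ms[OF cc], of "3/4" "3/4"] by linarith
    also have "\<dots> \<le> \<theta>'\<^sup>2 / (3/16)\<^sup>2 + (\<theta>'\<^sup>2 / (3/4)\<^sup>2 + \<theta>'\<^sup>2 / (3/4)\<^sup>2)"
      using est[OF \<tau>] by (intro add_mono ch ca cb cc) (simp_all add: emba embb embc)
    also have "\<dots> \<le> \<theta>" unfolding \<theta>'(2) using \<theta> by (simp add: power2_eq_square)
    finally show ?thesis .
  qed
  moreover have "\<delta> > 0" using t by (simp add: \<delta>_def)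
  ultimately show ?thesis using cg close by blast
qed

end

text \<open>Each step perturbs by at most a quarter of the previous width \<open>\<delta>\<close>, and the allowed perturbation \<open>t\<close> is halved at each step,
  so the limit \<open>G\<close> stays within \<open>\<delta>/2\<close> of every member of the sequence. Its zero set is therefore
  contained in each \<open>{|g\<^sub>n| < \<delta>\<^sub>n}\<close>. The bounds \<open>r/8\<close> and \<open>r/16\<close> keep \<open>G\<close> within \<open>r/4\<close>
  of \<open>f\<^sub>0\<close>, which is \<open>-r/2\<close> at \<open>x\<^sub>0\<close> and at least \<open>r/2\<close> off the ball of radius \<open>r\<close>.\<close>

lemma small_boundary_property_of_perturbation:
  fixes \<Delta> :: "'x::metric_space measure set"
  assumes prob: "\<And>\<mu>. \<mu> \<in> \<Delta> \<Longrightarrow> prob_space \<mu> \<and> sets \<mu> = sets borel"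
    and perturb: "\<And>(f :: 'x \<Rightarrow> real) t \<theta>. continuous_on UNIV f \<Longrightarrow> t > 0 \<Longrightarrow> \<theta> > 0 \<Longrightarrow>
      \<exists>g \<delta>. continuous_on UNIV g \<and> (\<forall>x. \<bar>g x - f x\<bar> \<le> t) \<and> \<delta> > 0 \<and>
        (\<forall>\<mu>\<in>\<Delta>. measure \<mu> {x. \<bar>g x\<bar> < \<delta>} \<le> \<theta>)"
  shows "small_boundary_property \<Delta>"
  unfolding small_boundary_property_def
proof (intro allI impI, elim conjE)
  fix x0 :: 'x and U assume U: "open U" "x0 \<in> U"
  then obtain r where r: "r > 0" "ball x0 r \<subseteq> U" by (auto simp: open_contains_ball)
  define f0 where "f0 x = dist x0 x - r / 2" for x
  have f0: "continuous_on UNIV f0" unfolding f0_def by (intro continuous_intros)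
  define P where "P n s = (case s of (g, \<delta>, t) \<Rightarrow> continuous_on UNIV g \<and> \<delta> > 0 \<and> t > 0 \<and> t \<le> \<delta> / 4 \<and>
      t \<le> r / 16 \<and> (n = 0 \<longrightarrow> (\<forall>x. \<bar>g x - f0 x\<bar> \<le> r / 8)) \<and>
      (\<forall>\<mu>\<in>\<Delta>. measure \<mu> {x. \<bar>g x\<bar> < \<delta>} \<le> 1 / real (Suc n)))"
    for n :: nat and s :: "('x \<Rightarrow> real) \<times> real \<times> real"
  define Q where "Q s s' = (case (s, s') of ((g, \<delta>, t), (g', \<delta>', t')) \<Rightarrow>
      (\<forall>x. \<bar>g' x - g x\<bar> \<le> t) \<and> t' \<le> t / 2)" for s s' :: "('x \<Rightarrow> real) \<times> real \<times> real"
  have "\<exists>F. \<forall>n. P n (F n) \<and> Q (F n) (F (Suc n))"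
  proof (rule dependent_nat_choice)
    obtain g \<delta> where "continuous_on UNIV g" "\<forall>x. \<bar>g x - f0 x\<bar> \<le> r / 8" "\<delta> > 0"
      "\<forall>\<mu>\<in>\<Delta>. measure \<mu> {x. \<bar>g x\<bar> < \<delta>} \<le> 1"
      using perturb[OF f0, of "r/8" 1] r by auto
    moreover define t where "t = min (\<delta> / 4) (r / 16)"
    ultimately have "P 0 (g, \<delta>, t)"
      using r min.cobounded1[of "\<delta> / 4" "r / 16"] min.cobounded2[of "\<delta> / 4" "r / 16"] by (simp add: P_def)
    then show "\<exists>s. P 0 s" by blast
  next
    fix s n assume "P n s"
    obtain g \<delta> t where s: "s = (g, \<delta>, t)" by (cases s)
    with \<open>P n s\<close> have g: "continuous_on UNIV g" and t: "t > 0" "t \<le> r / 16" by (auto simp: P_def)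
    have "1 / real (Suc (Suc n)) > 0" by simp
    from perturb[OF g t(1) this] obtain g' \<delta>' where "continuous_on UNIV g'" "\<forall>x. \<bar>g' x - g x\<bar> \<le> t" "\<delta>' > 0"
      "\<forall>\<mu>\<in>\<Delta>. measure \<mu> {x. \<bar>g' x\<bar> < \<delta>'} \<le> 1 / real (Suc (Suc n))" by blast
    then have "P (Suc n) (g', \<delta>', min (\<delta>' / 4) (t / 2)) \<and> Q s (g', \<delta>', min (\<delta>' / 4) (t / 2))"
      using t s by (auto simp: P_def Q_def min_le_iff_disj)
    then show "\<exists>s'. P (Suc n) s' \<and> Q s s'" by blast
  qed
  then obtain F where F: "\<And>n. P n (F n)" "\<And>n. Q (F n) (F (Suc n))" by blast
  define g where "g n = fst (F n)" for n
  define \<delta> where "\<delta> n = fst (snd (F n))" for n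
  define t where "t n = snd (snd (F n))" for n
  have Fn: "F n = (g n, \<delta> n, t n)" for n by (simp add: g_def \<delta>_def t_def)
  have g: "continuous_on UNIV (g n)" and \<delta>: "\<delta> n > 0" and t: "t n > 0" "t n \<le> \<delta> n / 4" "t n \<le> r / 16"
    and small: "\<And>\<mu>. \<mu> \<in> \<Delta> \<Longrightarrow> measure \<mu> {x. \<bar>g n x\<bar> < \<delta> n} \<le> 1 / real (Suc n)" for n
    using F(1)[of n] by (auto simp: P_def Fn)
  have g0: "\<bar>g 0 x - f0 x\<bar> \<le> r / 8" for x using F(1)[of 0] by (auto simp: P_def Fn)
  have step: "\<bar>g (Suc n) x - g n x\<bar> \<le> t n" "t (Suc n) \<le> t n / 2" for n x
    using F(2)[of n] by (auto simp: Q_def Fn)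
  have tail: "\<bar>g (n + j) x - g n x\<bar> \<le> 2 * t n - 2 * t (n + j)" for n j x
  proof (induction j)
    case (Suc j)
    then show ?case using step(1)[of "n + j" x] step(2)[of "n + j"] by simp
  qed simp
  have tail': "\<bar>g m x - g n x\<bar> \<le> 2 * t n" if "n \<le> m" for n m x
    using tail[of n "m - n" x] t(1)[of m] that by simp
  have tpow: "t n \<le> t 0 / 2 ^ n" for n
  proof (induction n)
    case (Suc n)
    then show ?case using step(2)[of n] by simp
  qed simp
  have "(\<lambda>n. t 0 / 2 ^ n) \<longlonglongrightarrow> 0"
    using tendsto_mult[OF tendsto_const LIMSEQ_realpow_zero[of "1/2"], of "t 0"] by (simp add: power_divide)
  then have t0: "t \<longlonglongrightarrow> 0"
    by (rule tendsto_sandwich[OF _ _ tendsto_const, rotated 2]) (simp_all add: less_imp_le[OF t(1)] tpow)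
  have tN: "\<exists>N. 2 * t N < e" if e: "e > 0" for e
  proof -
    have "eventually (\<lambda>n. t n < e / 2) sequentially" using order_tendstoD(2)[OF t0, of "e/2"] e by simp
    then obtain N where "t N < e / 2" by (auto simp: eventually_sequentially)
    then show ?thesis by (intro exI[of _ N]) simp
  qed
  have conv: "convergent (\<lambda>n. g n x)" for x
  proof (rule Cauchy_convergent, rule CauchyI)
    fix e :: real assume "e > 0"
    then obtain N where N: "2 * t N < e / 2" using tN[of "e/2"] by auto
    have "norm (g m x - g n x) < e" if "m \<ge> N" "n \<ge> N" for m n
      using tail'[of N m x] tail'[of N n x] that N unfolding real_norm_def by linarith
    then show "\<exists>M. \<forall>m\<ge>M. \<forall>n\<ge>M. norm (g m x - g n x) < e" by blast
  qed
  define G where "G x = lim (\<lambda>n. g n x)" for x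
  have G: "(\<lambda>n. g n x) \<longlonglongrightarrow> G x" for x using conv[of x] by (simp add: G_def convergent_LIMSEQ_iff)
  have near: "\<bar>G x - g n x\<bar> \<le> 2 * t n" for n x
  proof (rule LIMSEQ_le_const2)
    show "(\<lambda>m. \<bar>g m x - g n x\<bar>) \<longlonglongrightarrow> \<bar>G x - g n x\<bar>" by (intro tendsto_intros G)
    show "\<exists>N. \<forall>m\<ge>N. \<bar>g m x - g n x\<bar> \<le> 2 * t n" using tail' by blast
  qed
  have cG: "continuous_on UNIV G"
  proof (rule uniform_limit_theorem)
    show "\<forall>\<^sub>F n in sequentially. continuous_on UNIV (g n)" using g by simp
    show "uniform_limit UNIV g G sequentially"
      unfolding uniform_limit_iff
    proof (intro allI impI)
      fix e :: real assume "e > 0"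
      then obtain N where N: "2 * t N < e / 2" using tN[of "e/2"] by auto
      have "dist (g n x) (G x) < e" if "n \<ge> N" for n x
        using tail'[OF that, of x] near[of x N] N unfolding dist_real_def by linarith
      then show "\<forall>\<^sub>F n in sequentially. \<forall>x\<in>UNIV. dist (g n x) (G x) < e"
        by (auto simp: eventually_sequentially)
    qed
  qed simp
  have Gf0: "\<bar>G x - f0 x\<bar> \<le> r / 4" for x using near[of x 0] g0[of x] t(3)[of 0] by linarith
  define V where "V = {x. G x < 0}"
  have openV: "open V" unfolding V_def by (intro open_Collect_less cG continuous_intros)
  have "f0 x0 = - (r / 2)" by (simp add: f0_def)
  then have "G x0 < 0" using Gf0[of x0] r(1) by linarith
  then have "x0 \<in> V" by (simp add: V_def)
  then have "x0 \<in> interior V" using openV by (simp add: interior_open)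
  moreover have "V \<subseteq> U"
  proof
    fix x assume "x \<in> V"
    then have "G x < 0" by (simp add: V_def)
    then have "dist x0 x < r" using Gf0[of x] r(1) unfolding f0_def by linarith
    then show "x \<in> U" using r(2) by auto
  qed
  moreover have "emeasure \<mu> (frontier V) = 0" if \<mu>: "\<mu> \<in> \<Delta>" for \<mu>
  proof -
    interpret prob_space \<mu> using prob[OF \<mu>] by blast
    have sets: "sets \<mu> = sets borel" using prob[OF \<mu>] by blast
    have "closure V \<subseteq> {x. G x \<le> 0}"
      by (intro closure_minimal closed_Collect_le cG continuous_intros) (auto simp: V_def)
    then have "frontier V \<subseteq> {x. G x = 0}" using openV by (auto simp: frontier_def interior_open V_def)
    moreover have "{x. G x = 0} \<subseteq> {x. \<bar>g n x\<bar> < \<delta> n}" for n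
    proof
      fix x assume "x \<in> {x. G x = 0}"
      then show "x \<in> {x. \<bar>g n x\<bar> < \<delta> n}" using near[of x n] t(2)[of n] \<delta>[of n] by simp
    qed
    ultimately have sub: "frontier V \<subseteq> {x. \<bar>g n x\<bar> < \<delta> n}" for n by blast
    have "measure \<mu> (frontier V) \<le> 1 / real (Suc n)" for n
    proof -
      have "open {x. \<bar>g n x\<bar> < \<delta> n}" by (intro open_Collect_less continuous_intros g)
      then have "measure \<mu> (frontier V) \<le> measure \<mu> {x. \<bar>g n x\<bar> < \<delta> n}"
        using sets by (intro finite_measure_mono sub) simp
      then show ?thesis using small[OF \<mu>, of n] by simp
    qed
    then have "measure \<mu> (frontier V) \<le> 0" 
      by (intro LIMSEQ_le_const[OF LIMSEQ_inverse_real_of_nat]) (auto simp: inverse_eq_divide)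
    then show ?thesis by (simp add: emeasure_eq_measure measure_le_0_iff)
  qed
  ultimately show "\<exists>V. x0 \<in> interior V \<and> V \<subseteq> U \<and> (\<forall>\<mu>\<in>\<Delta>. emeasure \<mu> (frontier V) = 0)" by blast
qed

theorem theorem7p3:
  fixes D :: "'a::unital_cstar_algebra set"
    and \<iota> :: "('x::metric_space \<Rightarrow> complex) \<Rightarrow> 'a"
  assumes "simple_cstar_algebra TYPE('a)"
    and "unital_sub_cstar_algebra D" and "commutative_set D"
    and "compact (UNIV :: 'x set)" and "\<And>x :: 'x. \<not> x isolated_in UNIV"
    and "C_isomorphism \<iota> D"
    and "property_C D" and "property_E D"
    and "property_S TYPE('a)"
  shows "pair_SBP \<iota>"
proof -
  interpret compact_C_embedding \<iota>
    using assms(4,6) by unfold_locales (simp_all add: C_isomorphism_def)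
  have D: "D = Dset" using assms(6) by (simp add: C_isomorphism_def)
  show ?thesis
    unfolding pair_SBP_def
  proof (rule small_boundary_property_of_perturbation)
    show "prob_space \<mu> \<and> sets \<mu> = sets borel" if "\<mu> \<in> trace_measures \<iota>" for \<mu>
      using that by (auto simp: trace_measures_def)
  qed (rule uniform_perturbation[OF assms(1) assms(7)[unfolded D] assms(9) assms(8)[unfolded D]])
qed

end
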